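(* Let $n\ge1$, let $D$ be an $n$ strand type $B$ diagram, and let $\mu\in\mathtt{Dyck}(n)$ be the Dyck path corresponding to the diagram obtained from $D$ by removing its dots. Then \[ \mathrm{Coeff}_B^{(n)}(D)=Z^B(\mu)=\left(\frac{1}{[1]_s}\right)^{N(\bullet)}\ {\sum_{\mathcal{T}}}'\ \prod_{d\in\mathcal{T}}\frac{[h(d)]_s}{[h(d)+1]_s}, \] where $N(\bullet)$ is the number of dots of $D$, and the primed sum runs over all cover-inclusive Dyck tilings $\mathcal{T}\in\mathcal{D}(\mu)$ such that, for every dotted arc $c$ of $D$, $\mathcal{T}$ contains no Dyck tile of size $l(c)$ lying above $c$.
   Context: Work over $\mathbb{C}(q,s)$. Quantum numbers. $[m]=(q^m-q^{-m})/(q-q^{-1})$. Set $[0]_s=1$ and $[m]_s=q^{m-1}s+q^{-(m-1)}s^{-1}$ for $m\ge1$. Type $B$ Temperley--Lieb algebra. $\mathcal{TL}^B_n$ is generated by $e_0,\dots,e_{n-1}$ subject to the following relations: - $e_i^2=-[2]e_i$ for $i\ge1$; - $e_ie_{i\pm1}e_i=e_i$ for $i\ge1$; - $e_ie_j=e_je_i$ for $i,j\ge1$ with $|i-j|>1$; - $e_0^2=-[1]_se_0$; - $e_1e_0e_1=(qs^{-1}+q^{-1}s)e_1$; - $e_0e_i=e_ie_0$ for $i\ge2$. Natural inclusion $\mathcal{TL}^B_n\subset\mathcal{TL}^B_{n+1}$. The elements $Q^{(n)}$. $Q^{(0)}=\mathbf{1}$ and $Q^{(n+1)}=Q^{(n)}+\frac{[n]_s}{[n+1]_s}Q^{(n)}e_nQ^{(n)}$.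 Diagrams. An $n$ strand type $B$ diagram is an $n$ strand Temperley--Lieb diagram in which some of the arcs that can be reached from the left edge of the rectangle without crossing another arc carry a single dot. Here a Temperley--Lieb diagram means $n$ top and $n$ bottom points of a rectangle joined in pairs by non-crossing arcs, up to isotopy. - $e_i$ ($i\ge1$) is the diagram with a cap joining top points $i,i+1$ and a cup joining bottom points $i,i+1$. - $e_0$ is the identity diagram with a dot on strand $1$. - Products stack the first factor on top of the second. An undotted loop is removed with factor $-[2]$. A dotted loop is removed with factor $qs^{-1}+q^{-1}s$. Two dots on one arc are replaced by one dot with factor $-[1]_s$. These diagrams form a basis of $\mathcal{TL}^B_n$. $\mathrm{Coeff}_B^{(n)}(h)$ is the coefficient of the diagram $h$ in $Q^{(n)}$. Folding and Dyck path. List the $2n$ endpoints in the order $b_1,\dots,b_n,t_n,\dots,t_1$, where $b_k$ and $t_k$ are the bottom and top points numbered left to right, and number them $1,\dots,2n$. The arcs become a non-crossing perfect matching of points on a line, and dotted arcs are outermost. The Dyck path $\mu$ has $k$-th step $U=(1,1)$ if point $k$ is the left endpoint of its arc and $R=(1,-1)$ otherwise. A Dyck path of size $n$ is a lattice path from $(0,0)$ to $(2n,0)$ with these steps never going below $y=0$; $\mathtt{Dyck}(n)$ is the set of such paths. Size of an arc. An arc $c$ joining folded points $i<j$ has size $l(c)=(j-i+1)/2$. It corresponds to the up step of $\mu$ starting at $x$-coordinate $i-1$ and the down step of $\mu$ ending at $x$-coordinate $j$. A Dyck tile lies above $c$ if its leftmost box center has $x$-coordinate $i-1$ and its rightmost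 box center has $x$-coordinate $j$. Unit boxes and tiles. A unit box with center $(a,b)$ ($a,b\in\mathbb{Z}$) is the square with vertices $(a\pm1,b)$ and $(a,b\pm1)$. $R(\mu)$ is the region between $\mu$ and $U^nR^n$, a union of unit boxes. A Dyck tile of size $m\ge0$ is a set of $2m+1$ unit boxes whose centers $c_0,\dots,c_{2m}$ satisfy $c_{k+1}-c_k\in\{(1,1),(1,-1)\}$, never go below the height of $c_0$, and end at the height of $c_0$. Dyck tilings. A Dyck tiling of $R(\mu)$ is a partition of its boxes into Dyck tiles. It is cover-inclusive if the translate by $(0,-2)$ of each tile either lies strictly below $\mu$ or is contained in a single tile of the tiling. $\mathcal{D}(\mu)$ is the set of cover-inclusive Dyck tilings of $R(\mu)$. Height. $h(d)$ is the minimum $y$-coordinate of the box centers of the tile $d$.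
   Formalization: The condition "𝒯 contains no Dyck tile of size l(c) lying above c" is taken to mean that no tile of 𝒯 contains, as a set of boxes, such a Dyck tile; requiring only that no tile of 𝒯 itself be one makes the formula false (n=4, μ=URURURUR, one dot on the arc joining points 3 and 4). *)

theory Defs
  imports
    "HOL-Computational_Algebra.Polynomial"
    "HOL-Computational_Algebra.Fraction_Field"
    "HOL-Library.Poly_Mapping"
    "HOL-Library.Disjoint_Sets"
    "HOL-Library.Product_Plus"
begin

section \<open>The field \<open>\<complex>(q, s)\<close> and quantum numbers\<close>

text \<open>\<open>\<complex>(q, s)\<close> is the fraction field of \<open>\<complex>[q][s]\<close>: the inner polynomial variable is \<open>q\<close>,
  the outer one is \<open>s\<close>.\<close>

type_synonym qs_field = "complex poly poly fract"

definition q_var :: qs_field where "q_var = Fract [:[:0, 1:]:] 1"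

definition s_var :: qs_field where "s_var = Fract [:0, 1:] 1"

definition qnum :: "nat \<Rightarrow> qs_field" where
  "qnum m = (q_var ^ m - inverse q_var ^ m) / (q_var - inverse q_var)"

definition qnum_s :: "nat \<Rightarrow> qs_field" where
  "qnum_s m = (if m = 0 then 1 else q_var ^ (m - 1) * s_var + inverse q_var ^ (m - 1) * inverse s_var)"

definition dotted_loop :: qs_field where
  "dotted_loop = q_var * inverse s_var + inverse q_var * s_var"


section \<open>The type B Temperley--Lieb algebra by generators and relations\<close>

text \<open>Words in the letters \<open>e\<^sub>0, e\<^sub>1, \<dots>\<close> form a monoid, written additively because this is what
  \<open>Poly_Mapping\<close> requires of exponents; \<open>word \<Rightarrow>\<^sub>0 qs_field\<close> with its
  convolution product is then the free associative algebra on these letters.\<close>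

datatype word = Word (letters: "nat list")

instantiation word :: monoid_add
begin

definition "(0 :: word) = Word []"

definition "v + w = Word (letters v @ letters w)"

instance
  by standard (simp_all add: zero_word_def plus_word_def)

end

type_synonym free_alg = "word \<Rightarrow>\<^sub>0 qs_field"

definition scal :: "qs_field \<Rightarrow> free_alg" where
  "scal c = Poly_Mapping.single 0 c"

definition gen :: "nat \<Rightarrow> free_alg" where
  "gen i = Poly_Mapping.single (Word [i]) 1"

text \<open>The free algebra on \<open>e\<^sub>0, \<dots>, e\<^bsub>n-1\<^esub>\<close>.\<close>

definition free_on :: "nat \<Rightarrow> free_alg set" where
  "free_on n = {x. \<forall>w \<in> Poly_Mapping.keys x. set (letters w) \<subseteq> {..<n}}"

text \<open>The relation \<open>lhs = rhs\<close> is represented by the element \<open>lhs - rhs\<close>.\<close>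

definition TLB_relators :: "nat \<Rightarrow> free_alg set" where
  "TLB_relators n =
     {gen i * gen i + scal (qnum 2) * gen i | i. 1 \<le> i \<and> i < n}
   \<union> {gen i * gen j * gen i - gen i | i j. 1 \<le> i \<and> i < n \<and> 1 \<le> j \<and> j < n \<and> (j = i + 1 \<or> i = j + 1)}
   \<union> {gen i * gen j - gen j * gen i | i j.
        1 \<le> i \<and> i < n \<and> 1 \<le> j \<and> j < n \<and> \<bar>int i - int j\<bar> > 1}
   \<union> {x. 1 \<le> n \<and> x = gen 0 * gen 0 + scal (qnum_s 1) * gen 0}
   \<union> {x. 2 \<le> n \<and> x = gen 1 * gen 0 * gen 1 - scal dotted_loop * gen 1}
   \<union> {gen 0 * gen i - gen i * gen 0 | i. 2 \<le> i \<and> i < n}"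

inductive_set TLB_ideal :: "nat \<Rightarrow> free_alg set" for n :: nat where
  zero: "0 \<in> TLB_ideal n"
| relator: "r \<in> TLB_relators n \<Longrightarrow> r \<in> TLB_ideal n"
| add: "x \<in> TLB_ideal n \<Longrightarrow> y \<in> TLB_ideal n \<Longrightarrow> x + y \<in> TLB_ideal n"
| mult_left: "x \<in> TLB_ideal n \<Longrightarrow> a \<in> free_on n \<Longrightarrow> a * x \<in> TLB_ideal n"
| mult_right: "x \<in> TLB_ideal n \<Longrightarrow> a \<in> free_on n \<Longrightarrow> x * a \<in> TLB_ideal n"

text \<open>The element of the quotient algebra \<open>TL\<^sup>B\<^sub>n = free_on n / TLB_ideal n\<close> represented by \<open>x\<close>.\<close>

definition TLB_class :: "nat \<Rightarrow> free_alg \<Rightarrow> free_alg set" where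
  "TLB_class n x = {y \<in> free_on n. y - x \<in> TLB_ideal n}"

text \<open>A representative of \<open>Q\<^sup>(\<^sup>n\<^sup>)\<close>. The natural inclusion of \<open>TL\<^sup>B\<^sub>n\<close> into the next algebra sends the
  class of \<open>x\<close> to the class of \<open>x\<close>, so it is invisible at the level of representatives.\<close>

primrec Q_rep :: "nat \<Rightarrow> free_alg" where
  "Q_rep 0 = 1"
| "Q_rep (Suc n) = Q_rep n + scal (qnum_s n / qnum_s (n + 1)) * (Q_rep n * gen n * Q_rep n)"

definition Q_elem :: "nat \<Rightarrow> free_alg set" where
  "Q_elem n = TLB_class n (Q_rep n)"


section \<open>Type B diagrams\<close>

datatype point = Top nat | Bot nat

definition points :: "nat \<Rightarrow> point set" where
  "points n = Top ` {1..n} \<union> Bot ` {1..n}"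

text \<open>The position in the list \<open>b\<^sub>1, \<dots>, b\<^sub>n, t\<^sub>n, \<dots>, t\<^sub>1\<close>, which is also the order of the points along
  the boundary of the rectangle.\<close>

fun fold_pos :: "nat \<Rightarrow> point \<Rightarrow> nat" where
  "fold_pos n (Bot k) = k"
| "fold_pos n (Top k) = 2 * n + 1 - k"

type_synonym arc = "point set"

definition arc_lo :: "nat \<Rightarrow> arc \<Rightarrow> nat" where
  "arc_lo n c = Min (fold_pos n ` c)"

definition arc_hi :: "nat \<Rightarrow> arc \<Rightarrow> nat" where
  "arc_hi n c = Max (fold_pos n ` c)"

definition arc_size :: "nat \<Rightarrow> arc \<Rightarrow> nat" where
  "arc_size n c = (arc_hi n c - arc_lo n c + 1) div 2"

definition TL_diagrams :: "nat \<Rightarrow> arc set set" where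
  "TL_diagrams n = {A. partition_on (points n) A \<and> (\<forall>c\<in>A. card c = 2) \<and>
     (\<forall>c\<in>A. \<forall>d\<in>A. \<not> (arc_lo n c < arc_lo n d \<and> arc_lo n d < arc_hi n c \<and> arc_hi n c < arc_hi n d))}"

text \<open>The left edge of the rectangle joins \<open>b\<^sub>1\<close> to \<open>t\<^sub>1\<close>, the first and the last point of the folded
  list. So an arc can be reached from the left edge without crossing another arc iff it is
  outermost after folding.\<close>

definition left_exposed :: "nat \<Rightarrow> arc set \<Rightarrow> arc \<Rightarrow> bool" where
  "left_exposed n A c \<longleftrightarrow> c \<in> A \<and> (\<forall>d\<in>A. \<not> (arc_lo n d < arc_lo n c \<and> arc_hi n c < arc_hi n d))"

text \<open>A type B diagram is a pair of its set of arcs and its set of dotted arcs.\<close>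

type_synonym diagram = "arc set \<times> arc set"

abbreviation arcs :: "diagram \<Rightarrow> arc set" where "arcs D \<equiv> fst D"

abbreviation dotted :: "diagram \<Rightarrow> arc set" where "dotted D \<equiv> snd D"

definition B_diagrams :: "nat \<Rightarrow> diagram set" where
  "B_diagrams n = {(A, S). A \<in> TL_diagrams n \<and> (\<forall>c\<in>S. left_exposed n A c)}"

definition id_diagram :: "nat \<Rightarrow> diagram" where
  "id_diagram n = ((\<lambda>k. {Top k, Bot k}) ` {1..n}, {})"

definition gen_diagram :: "nat \<Rightarrow> nat \<Rightarrow> diagram" where
  "gen_diagram n i =
     (if i = 0 then (arcs (id_diagram n), {{Top 1, Bot 1}})
      else ((\<lambda>k. {Top k, Bot k}) ` ({1..n} - {i, i + 1})
              \<union> {{Top i, Top (i + 1)}, {Bot i, Bot (i + 1)}}, {}))"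

subsection \<open>Stacking\<close>

text \<open>In the picture with \<open>D\<close> stacked on top of \<open>D'\<close> the bottom points of \<open>D\<close> are glued to the top
  points of \<open>D'\<close>; the glued points are the middle nodes. The connected components of the resulting
  graph are the arcs of the product (with their two end points among the upper and lower nodes) and
  the closed loops (with middle nodes only).\<close>

datatype node = Upper nat | Middle nat | Lower nat

fun node_first :: "point \<Rightarrow> node" where
  "node_first (Top k) = Upper k"
| "node_first (Bot k) = Middle k"

fun node_second :: "point \<Rightarrow> node" where
  "node_second (Top k) = Middle k"
| "node_second (Bot k) = Lower k"

fun outer_node :: "point \<Rightarrow> node" where
  "outer_node (Top k) = Upper k"
| "outer_node (Bot k) = Lower k"

definition glue_edges :: "diagram \<Rightarrow> diagram \<Rightarrow> node set set" where
  "glue_edges D D' = (`) node_first ` arcs D \<union> (`) node_second ` arcs D'"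

definition components :: "diagram \<Rightarrow> diagram \<Rightarrow> node set set" where
  "components D D' =
     (\<lambda>v. {(x, y). \<exists>b \<in> glue_edges D D'. x \<in> b \<and> y \<in> b}\<^sup>* `` {v}) ` \<Union> (glue_edges D D')"

definition endpoints :: "node set \<Rightarrow> arc" where
  "endpoints C = outer_node -` C"

definition dots_on :: "diagram \<Rightarrow> diagram \<Rightarrow> node set \<Rightarrow> nat" where
  "dots_on D D' C =
     card {c \<in> dotted D. node_first ` c \<subseteq> C} + card {c \<in> dotted D'. node_second ` c \<subseteq> C}"

definition stack :: "diagram \<Rightarrow> diagram \<Rightarrow> diagram" where
  "stack D D' =
     ({endpoints C | C. C \<in> components D D' \<and> endpoints C \<noteq> {}},
      {endpoints C | C. C \<in> components D D' \<and> endpoints C \<noteq> {} \<and> dots_on D D' C > 0})"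

text \<open>The scalar produced by merging the dots on each component and then removing the loops: the
  product of \<open>D\<close> and \<open>D'\<close> is \<open>stack_factor D D'\<close> times the diagram \<open>stack D D'\<close>.\<close>

definition stack_factor :: "diagram \<Rightarrow> diagram \<Rightarrow> qs_field" where
  "stack_factor D D' =
     (\<Prod>C \<in> components D D'.
        (if dots_on D D' C = 0 then (if endpoints C = {} then - qnum 2 else 1)
         else (- qnum_s 1) ^ (dots_on D D' C - 1) * (if endpoints C = {} then dotted_loop else 1)))"

subsection \<open>Coefficients in the diagram basis\<close>

text \<open>The monomial \<open>e\<^sub>i \<dots> e\<^sub>j\<close> is a scalar multiple of one diagram, obtained by stacking the diagrams
  of its letters.\<close>

primrec word_diagram :: "nat \<Rightarrow> nat list \<Rightarrow> diagram" where
  "word_diagram n [] = id_diagram n"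
| "word_diagram n (i # w) = stack (gen_diagram n i) (word_diagram n w)"

primrec word_factor :: "nat \<Rightarrow> nat list \<Rightarrow> qs_field" where
  "word_factor n [] = 1"
| "word_factor n (i # w) = word_factor n w * stack_factor (gen_diagram n i) (word_diagram n w)"

definition rep_coeff :: "nat \<Rightarrow> free_alg \<Rightarrow> diagram \<Rightarrow> qs_field" where
  "rep_coeff n x h =
     (\<Sum>w \<in> Poly_Mapping.keys x.
        if word_diagram n (letters w) = h then Poly_Mapping.lookup x w * word_factor n (letters w) else 0)"

text \<open>The coefficient of the diagram \<open>h\<close> in an element \<open>X\<close> of \<open>TL\<^sup>B\<^sub>n\<close> is the common value of the
  coefficient of \<open>h\<close> over all representatives of \<open>X\<close>.\<close>

definition TLB_coeff :: "nat \<Rightarrow> free_alg set \<Rightarrow> diagram \<Rightarrow> qs_field" where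
  "TLB_coeff n X h = (THE a. \<forall>x\<in>X. rep_coeff n x h = a)"

definition Coeff_B :: "nat \<Rightarrow> diagram \<Rightarrow> qs_field" where
  "Coeff_B n h = TLB_coeff n (Q_elem n) h"


section \<open>Dyck paths\<close>

datatype step = Up | Down

primrec step_val :: "step \<Rightarrow> int" where
  "step_val Up = 1"
| "step_val Down = - 1"

definition height :: "step list \<Rightarrow> nat \<Rightarrow> int" where
  "height p k = (\<Sum>st \<leftarrow> take k p. step_val st)"

definition Dyck :: "nat \<Rightarrow> step list set" where
  "Dyck n = {p. length p = 2 * n \<and> (\<forall>k \<le> 2 * n. 0 \<le> height p k) \<and> height p (2 * n) = 0}"

definition dyck_path_of :: "nat \<Rightarrow> arc set \<Rightarrow> step list" where
  "dyck_path_of n A = map (\<lambda>k. if k \<in> arc_lo n ` A then Up else Down) [1..<2 * n + 1]"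

lemma fold_pos_bij: "bij_betw (fold_pos n) (points n) {1..2 * n}"
proof (rule bij_betwI[where g = "\<lambda>k. if k \<le> n then Bot k else Top (2 * n + 1 - k)"])
  show "fold_pos n \<in> points n \<rightarrow> {1..2 * n}"
    by (auto simp: points_def)
  show "(\<lambda>k. if k \<le> n then Bot k else Top (2 * n + 1 - k)) \<in> {1..2 * n} \<rightarrow> points n"
    unfolding points_def by (intro Pi_I) (auto intro!: imageI)
qed (auto simp: points_def)

lemma dyck_path_of_in_Dyck:
  assumes "A \<in> TL_diagrams n"
  shows "dyck_path_of n A \<in> Dyck n"
proof -
  have part: "partition_on (points n) A" and two: "\<And>c. c \<in> A \<Longrightarrow> card c = 2"
    using assms by (auto simp: TL_diagrams_def)
  have finA: "finite A"
    using part finite_elements[of "points n" A] by (auto simp: points_def)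
  have inj: "inj_on (fold_pos n) (points n)" and img: "fold_pos n ` points n = {1..2 * n}"
    using fold_pos_bij[of n] by (auto simp: bij_betw_def)
  have arc: "\<exists>a b. c = {a, b} \<and> a \<in> points n \<and> b \<in> points n
      \<and> arc_lo n c = fold_pos n a \<and> arc_hi n c = fold_pos n b \<and> fold_pos n a < fold_pos n b"
    if c: "c \<in> A" for c
  proof -
    obtain a b where ab: "c = {a, b}" "a \<noteq> b" using two[OF c] by (auto simp: card_2_iff)
    have "a \<in> points n" "b \<in> points n"
      using ab c part by (auto simp: partition_on_def)
    moreover from this ab(2) have "fold_pos n a \<noteq> fold_pos n b"
      using inj by (auto simp: inj_on_def)
    ultimately show ?thesis
    proof (cases "fold_pos n a < fold_pos n b")
      case True
      with ab \<open>a \<in> points n\<close> \<open>b \<in> points n\<close> show ?thesis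
        by (intro exI[of _ a] exI[of _ b]) (auto simp: arc_lo_def arc_hi_def)
    next
      case False
      with ab \<open>a \<in> points n\<close> \<open>b \<in> points n\<close> \<open>fold_pos n a \<noteq> fold_pos n b\<close> show ?thesis
        by (intro exI[of _ b] exI[of _ a]) (auto simp: arc_lo_def arc_hi_def insert_commute)
    qed
  qed
  have uniq: "c = d" if "c \<in> A" "d \<in> A" "x \<in> c" "x \<in> d" for c d x
    using part that unfolding partition_on_def disjoint_def by blast
  have val: "step_val (if k \<in> arc_lo n ` A then Up else Down) =
      (\<Sum>c\<in>A. (if arc_lo n c = k then 1 else 0) - (if arc_hi n c = k then 1 else 0))"
    if k: "k \<in> {1..2 * n}" for k
  proof -
    obtain p where p: "p \<in> points n" "fold_pos n p = k" using img k by (metis imageE)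
    then obtain c where c: "c \<in> A" "p \<in> c" using part by (auto simp: partition_on_def)
    obtain a b where ab: "c = {a, b}" "arc_lo n c = fold_pos n a" "arc_hi n c = fold_pos n b"
      "fold_pos n a < fold_pos n b" using arc[OF c(1)] by blast
    have other: "arc_lo n d \<noteq> k" "arc_hi n d \<noteq> k" if dA: "d \<in> A" and dc: "d \<noteq> c" for d
    proof -
      obtain a' b' where d: "d = {a', b'}" "a' \<in> points n" "b' \<in> points n"
        "arc_lo n d = fold_pos n a'" "arc_hi n d = fold_pos n b'" using arc[OF dA] by blast
      have "p \<noteq> a'" "p \<noteq> b'" using uniq[OF c(1) dA c(2)] dc d(1) by auto
      then show "arc_lo n d \<noteq> k" "arc_hi n d \<noteq> k"
        using d p inj by (auto simp: inj_on_def)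
    qed
    have "(\<Sum>d\<in>A. (if arc_lo n d = k then 1 else 0) - (if arc_hi n d = k then 1 else 0 :: int)) =
        (if arc_lo n c = k then 1 else 0) - (if arc_hi n c = k then 1 else 0)"
      using other by (subst sum.remove[OF finA c(1)]) (simp add: sum.neutral)
    moreover have "k \<in> arc_lo n ` A \<longleftrightarrow> arc_lo n c = k"
      using other c(1) by auto
    moreover have "arc_lo n c = k \<and> arc_hi n c \<noteq> k \<or> arc_hi n c = k \<and> arc_lo n c \<noteq> k"
      using ab c(2) p(2) by auto
    ultimately show ?thesis by auto
  qed
  have h: "height (dyck_path_of n A) k =
      (\<Sum>c\<in>A. (if arc_lo n c \<le> k then 1 else 0) - (if arc_hi n c \<le> k then 1 else 0))"
    if k: "k \<le> 2 * n" for k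
  proof -
    have "height (dyck_path_of n A) k =
        (\<Sum>i\<leftarrow>[1..<k + 1]. step_val (if i \<in> arc_lo n ` A then Up else Down))"
    proof -
      have "take k [1..<2 * n + 1] = [1..<k + 1]" using k take_upt[of 1 k "2 * n + 1"] by (simp only: add.commute)
      then show ?thesis
        unfolding height_def dyck_path_of_def by (simp only: take_map map_map o_def)
    qed
    also have "\<dots> = (\<Sum>i\<in>{1..k}. step_val (if i \<in> arc_lo n ` A then Up else Down))"
      by (simp only: interv_sum_list_conv_sum_set_nat set_upt atLeastLessThanSuc_atLeastAtMost
          Suc_eq_plus1[symmetric])
    also have "\<dots> = (\<Sum>i\<in>{1..k}. \<Sum>c\<in>A.
        (if arc_lo n c = i then 1 else 0) - (if arc_hi n c = i then 1 else 0))"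
      using k by (intro sum.cong refl val) auto
    also have "\<dots> = (\<Sum>c\<in>A. \<Sum>i\<in>{1..k}.
        (if arc_lo n c = i then 1 else 0) - (if arc_hi n c = i then 1 else 0))"
      by (rule sum.swap)
    also have "\<dots> = (\<Sum>c\<in>A. (if arc_lo n c \<le> k then 1 else 0) - (if arc_hi n c \<le> k then 1 else 0))"
    proof (rule sum.cong[OF refl])
      fix c assume "c \<in> A"
      then obtain a b where ab: "a \<in> points n" "b \<in> points n"
        "arc_lo n c = fold_pos n a" "arc_hi n c = fold_pos n b" using arc by blast
      then have "1 \<le> arc_lo n c" "1 \<le> arc_hi n c"
        using img by (metis atLeastAtMost_iff imageI)+
      then show "(\<Sum>i\<in>{1..k}. (if arc_lo n c = i then 1 else 0) - (if arc_hi n c = i then 1 else 0)) =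
          (if arc_lo n c \<le> k then 1 else 0) - (if arc_hi n c \<le> k then 1 else 0 :: int)"
        by (simp add: sum_subtractf sum.delta')
    qed
    finally show ?thesis .
  qed
  have lohi: "arc_lo n c < arc_hi n c" "arc_hi n c \<le> 2 * n" if "c \<in> A" for c
    using arc[OF that] img by (metis, metis atLeastAtMost_iff imageI)
  have "0 \<le> height (dyck_path_of n A) k" if "k \<le> 2 * n" for k
    unfolding h[OF that] by (intro sum_nonneg) (use lohi in force)
  moreover have "height (dyck_path_of n A) (2 * n) = 0"
    unfolding h[OF order_refl] by (intro sum.neutral) (use lohi in force)
  ultimately show ?thesis
    by (simp add: Dyck_def dyck_path_of_def)
qed


section \<open>Dyck tilings\<close>

text \<open>A unit box is represented by its center. The boxes making up \<open>R(\<mu>)\<close> have their vertices on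
  lattice points of the paths (those with even coordinate sum), so \<open>a + b\<close> is odd for their
  centers. Such a box with \<open>0 \<le> a \<le> 2n\<close> lies between \<open>\<mu>\<close> and \<open>U\<^sup>nR\<^sup>n\<close> iff its vertices
  \<open>(a, b - 1)\<close> and \<open>(a, b + 1)\<close> do, because both paths have slope \<open>\<plusminus>1\<close>.\<close>

type_synonym box = "int \<times> int"

definition region :: "nat \<Rightarrow> step list \<Rightarrow> box set" where
  "region n mu = {(a, b). 0 \<le> a \<and> a \<le> 2 * int n \<and> odd (a + b) \<and>
     height mu (nat a) \<le> b - 1 \<and>
     b + 1 \<le> height (replicate n Up @ replicate n Down) (nat a)}"

definition dyck_tile :: "nat \<Rightarrow> box set \<Rightarrow> bool" where
  "dyck_tile m d \<longleftrightarrow> (\<exists>c :: nat \<Rightarrow> box. d = c ` {..2 * m} \<and>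
     (\<forall>k < 2 * m. c (k + 1) - c k \<in> {(1, 1), (1, - 1)}) \<and>
     (\<forall>k \<le> 2 * m. snd (c 0) \<le> snd (c k)) \<and>
     snd (c (2 * m)) = snd (c 0))"

definition dyck_tiling :: "nat \<Rightarrow> step list \<Rightarrow> box set set \<Rightarrow> bool" where
  "dyck_tiling n mu T \<longleftrightarrow> partition_on (region n mu) T \<and> (\<forall>d\<in>T. \<exists>m. dyck_tile m d)"

definition shift_down :: "box set \<Rightarrow> box set" where
  "shift_down d = (\<lambda>(a, b). (a, b - 2)) ` d"

text \<open>A box whose upper edges lie on \<open>\<mu>\<close> counts as strictly below \<open>\<mu>\<close>.\<close>

definition below_path :: "step list \<Rightarrow> box set \<Rightarrow> bool" where
  "below_path mu d \<longleftrightarrow> (\<forall>(a, b)\<in>d. b + 1 \<le> height mu (nat a))"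

definition cover_inclusive :: "step list \<Rightarrow> box set set \<Rightarrow> bool" where
  "cover_inclusive mu T \<longleftrightarrow>
     (\<forall>d\<in>T. below_path mu (shift_down d) \<or> (\<exists>d'\<in>T. shift_down d \<subseteq> d'))"

definition ci_dyck_tilings :: "nat \<Rightarrow> step list \<Rightarrow> box set set set" where
  "ci_dyck_tilings n mu = {T. dyck_tiling n mu T \<and> cover_inclusive mu T}"

definition tile_height :: "box set \<Rightarrow> nat" where
  "tile_height d = nat (Min (snd ` d))"

definition lies_above :: "nat \<Rightarrow> arc \<Rightarrow> box set \<Rightarrow> bool" where
  "lies_above n c d \<longleftrightarrow> Min (fst ` d) = int (arc_lo n c) - 1 \<and> Max (fst ` d) = int (arc_hi n c)"

text \<open>A tiling contains the Dyck tile \<open>d\<close> if the boxes of \<open>d\<close> all belong to a single tile, which may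
  be larger than \<open>d\<close>. Requiring \<open>d\<close> itself to be a tile is not enough: take \<open>n = 4\<close>, the path
  \<open>URURURUR\<close> and a single dot, on the arc joining the folded points 3 and 4. The tiling consisting of
  the Dyck tile with centers \<open>(2,1), (3,2), (4,1), (5,2), (6,1)\<close> and the box \<open>(4,3)\<close> has to be left
  out of the sum for this diagram, and the Dyck tile of size 1 above the dotted arc is only a part
  of its lower tile.\<close>

definition contains_dyck_tile :: "box set set \<Rightarrow> box set \<Rightarrow> bool" where
  "contains_dyck_tile T d \<longleftrightarrow> (\<exists>d'\<in>T. d \<subseteq> d')"

definition admissible_tilings :: "nat \<Rightarrow> diagram \<Rightarrow> step list \<Rightarrow> box set set set" where
  "admissible_tilings n D mu = {T \<in> ci_dyck_tilings n mu. \<forall>c \<in> dotted D.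
     \<not> (\<exists>d. dyck_tile (arc_size n c) d \<and> lies_above n c d \<and> contains_dyck_tile T d)}"

end

theory Submission imports Defs
begin

text \<open>Modulo the defining relations \<open>Q\<^sup>(\<^sup>n\<^sup>)\<close> is killed by \<open>e\<^sub>0, \<dots>, e\<^bsub>n-1\<^esub>\<close>, and Wenzl's argument unrolls its
  recursion to \<open>[n+1]\<^sub>s Q\<^sup>(\<^sup>n\<^sup>+\<^sup>1\<^sup>) = (\<Sum>k\<le>n+1. [k]\<^sub>s e\<^sub>k \<cdots> e\<^sub>n) Q\<^sup>(\<^sup>n\<^sup>)\<close>. After folding, multiplying a diagram by
  \<open>e\<^sub>k \<cdots> e\<^sub>n\<close> inserts an undotted small arc at the points \<open>2n+2-k, 2n+3-k\<close> if \<open>k \<ge> 1\<close>, and a dotted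
  one at the last two points if \<open>k = 0\<close>. So \<open>[1]\<^sub>s \<cdots> [n]\<^sub>s\<close> times a coefficient of \<open>Q\<^sup>(\<^sup>n\<^sup>)\<close> is a sum over sequences of
  insertions, with weight the product of the \<open>[k]\<^sub>s\<close>. Recording \<open>k\<close> on the inserted arc turns the
  sequences into labellings of the arcs of the final diagram: the last insertion is recovered as the
  leftmost small arc with the largest label that its position permits.

  On the other side, in a cover-inclusive tiling every tile is a translate of a piece of the path, and
  the tiling is determined by the number \<open>g\<close> of layers in which the columns under an arc are glued
  together. The weight of the tiling by unit boxes telescopes from column to column, and the effect of
  the gluings on it telescopes over the layers; altogether a tiling has weight
  \<open>\<Prod>[a + 1 + 2 g]\<^sub>s / [1]\<^sub>s \<cdots> [n]\<^sub>s\<close>, the product over all arcs, where \<open>a\<close> is the height of the arc. The labels are \<open>k = a + 1 + 2 g\<close> on undotted arcs and \<open>0\<close> on dotted ones.\<close>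

section \<open>Type B Jones--Wenzl elements modulo the relations\<close>

text \<open>A coefficient is defined through all representatives in the free algebra, so the
  relations have to be verified on diagrams before anything can be computed. For this each generator
  acts from the left, one letter at a time, and diagrams are handled as involutions without fixed
  points: e_i only rewires two points and their mates.

  Labels come from the place of an insertion. The term with [k]_s, k \<ge> 1, inserts the arc at p =
  2n + 2 - k, so at that moment k is maximal for the right end p + 1, and later insertions never
  tighten this bound. In terms of k = a + 1 + 2g the bounds on labels say the same as the bounds on
  g by the number of boxes in a column. This is why labels and gluings can be matched arc by arc.

  Dotted arcs are outermost, so a = 0, and the excluded tiles force g = 0. Such an arc counts [1]_s
  on the side of the tilings and [0]_s = 1 on the side of the labels; this is the origin of the
  power of 1/[1]_s.\<close>

lemma q_var_nonzero: "q_var \<noteq> 0" and s_var_nonzero: "s_var \<noteq> 0"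
  by (simp_all add: q_var_def s_var_def Zero_fract_def eq_fract)

lemma q_var_power: "q_var ^ m = Fract [:[:0, 1:] ^ m:] 1"
  by (induction m) (simp_all add: One_fract_def q_var_def flip: one_pCons)

text \<open>Multiplying by q^(m-1) s clears the denominators and leaves q^(2m-2) s^2 + 1, a
  polynomial whose constant term in s is 1.\<close>

lemma qnum_s_nonzero: "qnum_s m \<noteq> 0"
proof (cases "m = 0")
  case False
  then obtain k where m: "m = Suc k" by (cases m) auto
  have "qnum_s m * (q_var ^ k * s_var) = q_var ^ (2 * k) * (s_var * s_var) + 1"
    using q_var_nonzero s_var_nonzero
    by (simp add: qnum_s_def m field_simps mult_2_right power_add)
  also have "\<dots> = Fract ([:0, 0, [:0, 1:] ^ (2 * k):] + 1) 1"
    by (simp add: q_var_power s_var_def One_fract_def)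
  also have "\<dots> \<noteq> 0"
  proof -
    have "poly.coeff ([:0, 0, [:0, 1:] ^ (2 * k):] + 1 :: complex poly poly) 0 \<noteq> 0" by simp
    then have "[:0, 0, [:0, 1:] ^ (2 * k):] + 1 \<noteq> (0 :: complex poly poly)" by (metis coeff_0)
    then show ?thesis by (simp add: Zero_fract_def eq_fract)
  qed
  finally show ?thesis by auto
qed (simp add: qnum_s_def)

lemma qnum_2: "qnum 2 = q_var + inverse q_var"
proof -
  have "q_var * q_var - 1 \<noteq> 0"
    by (simp add: q_var_def One_fract_def Zero_fract_def eq_fract one_pCons)
  then have "q_var - inverse q_var \<noteq> 0"
    using q_var_nonzero by (auto simp: field_simps)
  then show ?thesis
    by (simp add: qnum_def nonzero_divide_eq_eq algebra_simps power2_eq_square)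
qed

text \<open>The closed form q^(m-1) s + q^(1-m) s^(-1) satisfies this recursion for all integers m,
  but at m = 0 its value is \<open>dotted_loop\<close>, whereas [0]_s = 1 by convention. Hence the
  start at index 1; \<open>qnum_s_2\<close> is the instance that involves index 0.\<close>

lemma qnum_s_rec: "qnum_s (n + 3) = qnum 2 * qnum_s (n + 2) - qnum_s (n + 1)"
  using q_var_nonzero s_var_nonzero
  by (simp add: qnum_s_def qnum_2 field_simps)

lemma qnum_s_2: "qnum_s 2 = qnum 2 * qnum_s 1 - dotted_loop"
  using q_var_nonzero s_var_nonzero
  by (simp add: qnum_s_def qnum_2 dotted_loop_def field_simps)

section \<open>Calculus of the free algebra, monomial by monomial\<close>

lemma poly_mapping_single_induct [case_names zero add]:
  fixes x :: "'a \<Rightarrow>\<^sub>0 'b::comm_monoid_add"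
  assumes "P 0" "\<And>w c x. P x \<Longrightarrow> w \<notin> Poly_Mapping.keys x \<Longrightarrow> c \<noteq> 0 \<Longrightarrow> P (Poly_Mapping.single w c + x)"
  shows "P x"
proof -
  have "finite S \<Longrightarrow> Poly_Mapping.keys x \<subseteq> S \<Longrightarrow> P x" for S and x :: "'a \<Rightarrow>\<^sub>0 'b"
  proof (induction S arbitrary: x rule: finite_induct)
    case empty
    then show ?case using assms(1) by simp
  next
    case (insert w S)
    define y where "y = Poly_Mapping.update w 0 x"
    have ky: "Poly_Mapping.keys y = Poly_Mapping.keys x - {w}"
      by (auto simp: y_def keys_update)
    have eq: "x = Poly_Mapping.single w (Poly_Mapping.lookup x w) + y"
      by (rule poly_mapping_eqI) (auto simp: y_def lookup_add lookup_single lookup_update when_def)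
    have "P y" using insert ky by blast
    then show ?case
      using assms(2)[of y w "Poly_Mapping.lookup x w"] ky eq
      by (cases "Poly_Mapping.lookup x w = 0") (auto)
  qed
  then show ?thesis by (meson finite_keys order_refl)
qed

lemma single_mult_Word:
  "Poly_Mapping.single (Word u) c * Poly_Mapping.single (Word v) d
     = (Poly_Mapping.single (Word (u @ v)) (c * d) :: free_alg)"
  by (simp add: mult_single plus_word_def)

lemma scal_commute: "scal c * x = x * scal c"
  by (induction x rule: poly_mapping_single_induct)
    (simp_all add: distrib_left distrib_right scal_def mult_single mult.commute)

lemma scal_left_commute: "x * (scal c * y) = scal c * (x * y)"
  by (metis mult.assoc scal_commute)

lemma scal_add: "scal (c + d) = scal c + scal d"
  by (simp add: scal_def single_add)

lemma scal_mult: "scal (c * d) = scal c * scal d"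
  by (simp add: scal_def mult_single)

lemma scal_1: "scal 1 = 1" and scal_0: "scal 0 = 0"
  by (simp_all add: scal_def)

lemma scal_uminus: "scal (- c) = - scal c"
  by (simp add: scal_def single_uminus)

lemma scal_free: "scal c \<in> free_on n"
  by (auto simp: free_on_def scal_def zero_word_def)

lemma one_free: "1 \<in> free_on n"
  using scal_free[of 1 n] by (simp add: scal_1)

lemma gen_free: "i < n \<Longrightarrow> gen i \<in> free_on n"
  by (auto simp: free_on_def gen_def)

lemma add_free: "x \<in> free_on n \<Longrightarrow> y \<in> free_on n \<Longrightarrow> x + y \<in> free_on n"
  using Poly_Mapping.keys_add[of x y] by (auto simp: free_on_def)

lemma mult_free: "x \<in> free_on n \<Longrightarrow> y \<in> free_on n \<Longrightarrow> x * y \<in> free_on n"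
  using keys_mult[of x y] by (fastforce simp: free_on_def plus_word_def)

lemmas free_rules = scal_free one_free gen_free add_free mult_free

lemma Q_rep_free: "n \<le> m \<Longrightarrow> Q_rep n \<in> free_on m"
  by (induction n) (auto intro!: free_rules)

section \<open>Congruence modulo the defining relations\<close>

definition tlb_cong :: "nat \<Rightarrow> free_alg \<Rightarrow> free_alg \<Rightarrow> bool" where
  "tlb_cong n x y \<longleftrightarrow> x - y \<in> TLB_ideal n"

text \<open>Closure under negation is not among the rules of \<open>TLB_ideal\<close>; it comes from
  multiplication by the scalar -1, which lies in every \<open>free_on n\<close>.\<close>

lemma ideal_uminus: "x \<in> TLB_ideal n \<Longrightarrow> - x \<in> TLB_ideal n"
  using TLB_ideal.mult_left[OF _ scal_free, of x n "- 1"] by (simp add: scal_uminus scal_1)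

lemma cong_refl: "tlb_cong n x x"
  by (simp add: tlb_cong_def TLB_ideal.zero)

lemma cong_sym: "tlb_cong n x y \<Longrightarrow> tlb_cong n y x"
  using ideal_uminus[of "x - y" n] by (simp add: tlb_cong_def)

lemma cong_trans [trans]: "tlb_cong n x y \<Longrightarrow> tlb_cong n y z \<Longrightarrow> tlb_cong n x z"
  using TLB_ideal.add[of "x - y" n "y - z"] by (simp add: tlb_cong_def)

lemma cong_add: "tlb_cong n x x' \<Longrightarrow> tlb_cong n y y' \<Longrightarrow> tlb_cong n (x + y) (x' + y')"
  using TLB_ideal.add[of "x - x'" n "y - y'"] by (simp add: tlb_cong_def algebra_simps)

text \<open>The ideal absorbs factors from \<open>free_on n\<close>, and in the splitting xy - x'y'
  = (x - x')y + x'(y - y') the cofactors are y and x'. This explains the two membership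
  conditions.\<close>

lemma cong_mult:
  assumes "tlb_cong n x x'" "tlb_cong n y y'" "x' \<in> free_on n" "y \<in> free_on n"
  shows "tlb_cong n (x * y) (x' * y')"
proof -
  have "x * y - x' * y' = (x - x') * y + x' * (y - y')"
    by (simp add: algebra_simps)
  then show ?thesis
    using assms unfolding tlb_cong_def by (auto intro: TLB_ideal.intros(3-5))
qed

lemma cong_left: "tlb_cong n y y' \<Longrightarrow> x \<in> free_on n \<Longrightarrow> tlb_cong n (x * y) (x * y')"
  using TLB_ideal.mult_left[of "y - y'" n x] by (simp add: tlb_cong_def algebra_simps)

lemma cong_right: "tlb_cong n x x' \<Longrightarrow> y \<in> free_on n \<Longrightarrow> tlb_cong n (x * y) (x' * y)"
  using TLB_ideal.mult_right[of "x - x'" n y] by (simp add: tlb_cong_def algebra_simps)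

lemma cong_sq:
  assumes "1 \<le> i" "i < n"
  shows "tlb_cong n (gen i * gen i) (scal (- qnum 2) * gen i)"
proof -
  have "gen i * gen i + scal (qnum 2) * gen i \<in> {gen i * gen i + scal (qnum 2) * gen i | i. 1 \<le> i \<and> i < n}"
    using assms by auto
  then show ?thesis
    unfolding tlb_cong_def by (intro TLB_ideal.relator) (simp add: TLB_relators_def scal_uminus)
qed

lemma cong_sq0:
  assumes "0 < n"
  shows "tlb_cong n (gen 0 * gen 0) (scal (- qnum_s 1) * gen 0)"
  unfolding tlb_cong_def
  using assms by (intro TLB_ideal.relator) (simp add: TLB_relators_def scal_uminus)

lemma cong_braid:
  assumes "1 \<le> i" "i + 1 < n"
  shows "tlb_cong n (gen (i + 1) * gen i * gen (i + 1)) (gen (i + 1))"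
proof -
  have "gen (i + 1) * gen i * gen (i + 1) - gen (i + 1) \<in> {gen i * gen j * gen i - gen i | i j.
      1 \<le> i \<and> i < n \<and> 1 \<le> j \<and> j < n \<and> (j = i + 1 \<or> i = j + 1)}"
    using assms by (intro CollectI exI[of _ "i + 1"] exI[of _ i]) auto
  then show ?thesis
    unfolding tlb_cong_def TLB_relators_def by (intro TLB_ideal.relator) (simp only: TLB_relators_def Un_iff simp_thms)
qed

lemma cong_braid0:
  assumes "1 < n"
  shows "tlb_cong n (gen 1 * gen 0 * gen 1) (scal dotted_loop * gen 1)"
  unfolding tlb_cong_def
  using assms by (intro TLB_ideal.relator) (simp add: TLB_relators_def)

lemma cong_commute:
  assumes "i + 1 < j" "j < n"
  shows "tlb_cong n (gen i * gen j) (gen j * gen i)"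
proof (cases "i = 0")
  case True
  have "gen 0 * gen j - gen j * gen 0 \<in> {gen 0 * gen i - gen i * gen 0 | i. 2 \<le> i \<and> i < n}"
    using assms True by auto
  then show ?thesis
    unfolding tlb_cong_def True by (intro TLB_ideal.relator) (simp only: TLB_relators_def Un_iff simp_thms)
next
  case False
  have "gen i * gen j - gen j * gen i \<in> {gen i * gen j - gen j * gen i | i j.
        1 \<le> i \<and> i < n \<and> 1 \<le> j \<and> j < n \<and> \<bar>int i - int j\<bar> > 1}"
    using assms False by (intro CollectI exI[of _ i] exI[of _ j]) auto
  then show ?thesis
    unfolding tlb_cong_def by (intro TLB_ideal.relator) (simp only: TLB_relators_def Un_iff simp_thms)
qed

section \<open>Annihilation of Q by the generators\<close>

lemma Q_commute:
  assumes "n < m" "m < N"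
  shows "tlb_cong N (Q_rep n * gen m) (gen m * Q_rep n)"
  using assms
proof (induction n)
  case 0
  show ?case by (simp add: cong_refl)
next
  case (Suc n)
  let ?c = "qnum_s n / qnum_s (n + 1)" and ?Q = "Q_rep n" and ?e = "gen n" and ?x = "gen m"
  have IH: "tlb_cong N (?Q * ?x) (?x * ?Q)" using Suc by simp
  have F: "?Q \<in> free_on N" "?e \<in> free_on N" "?x \<in> free_on N"
    using Suc.prems by (auto intro!: free_rules Q_rep_free)
  have "tlb_cong N (?Q * ?e * ?Q * ?x) (?Q * ?e * (?x * ?Q))"
    unfolding mult.assoc[of "?Q * ?e" ?Q] by (intro cong_left IH free_rules F)
  also have "?Q * ?e * (?x * ?Q) = ?Q * ((?e * ?x) * ?Q)"
    by (simp add: mult.assoc)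
  also have "tlb_cong N \<dots> (?Q * ((?x * ?e) * ?Q))"
    using Suc.prems by (intro cong_left cong_right cong_commute free_rules F) auto
  also have "\<dots> = ?Q * ?x * (?e * ?Q)"
    by (simp add: mult.assoc)
  also have "tlb_cong N \<dots> (?x * ?Q * (?e * ?Q))"
    by (intro cong_right IH free_rules F)
  finally have *: "tlb_cong N (?Q * ?e * ?Q * ?x) (?x * (?Q * ?e * ?Q))"
    by (simp add: mult.assoc)
  have "Q_rep (Suc n) * ?x = ?Q * ?x + scal ?c * (?Q * ?e * ?Q * ?x)"
    by (simp add: distrib_right mult.assoc)
  also have "tlb_cong N \<dots> (?x * ?Q + scal ?c * (?x * (?Q * ?e * ?Q)))"
    by (intro cong_add cong_left IH * scal_free)
  also have "\<dots> = ?x * Q_rep (Suc n)"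
    by (simp add: distrib_left mult.assoc scal_left_commute)
  finally show ?case .
qed

text \<open>Expanding \<open>Q_rep m\<close> gives 1 plus multiples of words whose last letter meets
  y. Together with \<open>Q_annihilated\<close>, the case y = \<open>Q_rep n\<close> with m \<le> n
  yields Q^(m) Q^(n) = Q^(n).\<close>

lemma Q_absorb:
  assumes "m \<le> N" "y \<in> free_on N" "\<And>i. i < m \<Longrightarrow> tlb_cong N (gen i * y) 0"
  shows "tlb_cong N (Q_rep m * y) y"
  using assms
proof (induction m)
  case 0
  show ?case by (simp add: cong_refl)
next
  case (Suc m)
  let ?c = "qnum_s m / qnum_s (m + 1)" and ?Q = "Q_rep m"
  have F: "?Q \<in> free_on N" "gen m \<in> free_on N"
    using Suc.prems by (auto intro!: free_rules Q_rep_free)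
  have IH: "tlb_cong N (?Q * y) y" using Suc by simp
  have "Q_rep (Suc m) * y = ?Q * y + scal ?c * (?Q * (gen m * (?Q * y)))"
    by (simp add: distrib_right mult.assoc)
  also have "tlb_cong N \<dots> (y + scal ?c * (?Q * (gen m * y)))"
    by (intro cong_add cong_left IH free_rules F)
  also have "tlb_cong N \<dots> (y + scal ?c * (?Q * 0))"
    by (intro cong_add cong_refl cong_left free_rules F Suc.prems(3)) simp
  finally show ?case by simp
qed

lemma cong_scal_zero:
  assumes "c = 0" shows "tlb_cong N (scal c * x) 0"
  using assms by (simp add: scal_0 cong_refl)

text \<open>The old generators already kill the left factor of both terms of the recursion. For the
  new generator e the product e Q e Q is a multiple of e Q: the first Q is expanded once more, and
  the three-term recursion of the [m]_s makes this multiple cancel the term e Q.\<close>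

lemma Q_annihilated:
  assumes "n \<le> N" "i < n"
  shows "tlb_cong N (gen i * Q_rep n) 0"
  using assms
proof (induction n arbitrary: i rule: less_induct)
  case (less n')
  then obtain n where n': "n' = Suc n" by (cases n') auto
  let ?c = "qnum_s n / qnum_s (n + 1)" and ?Q = "Q_rep n"
  have F: "?Q \<in> free_on N" "gen i \<in> free_on N" "gen n \<in> free_on N"
    using less.prems n' by (auto intro!: free_rules Q_rep_free)
  have split: "gen i * Q_rep n' = gen i * ?Q + scal ?c * (gen i * ?Q * gen n * ?Q)"
    by (simp add: n' distrib_left mult.assoc scal_left_commute)
  show ?case
  proof (cases "i < n")
    case True
    then have IH: "tlb_cong N (gen i * ?Q) 0" using less n' by simp
    have "tlb_cong N (gen i * Q_rep n') (0 + scal ?c * (0 * gen n * ?Q))"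
      unfolding split by (intro cong_add cong_left cong_right IH free_rules F)
    then show ?thesis by simp
  next
    case False
    then have i: "i = n" using less.prems n' by simp
    have nz: "qnum_s n \<noteq> 0" "qnum_s (n + 1) \<noteq> 0" by (simp_all only: qnum_s_nonzero not_False_eq_True)
    show ?thesis
    proof (cases n)
      case 0
      \<comment> \<open>With [0]_s = 1 the coefficient of e_0^2 = -[1]_s e_0 is 1/[1]_s, so the two
        terms cancel.\<close>
      have "gen i * Q_rep n' = gen 0 + scal ?c * (gen 0 * gen 0)"
        using split 0 i by simp
      also have "tlb_cong N \<dots> (gen 0 + scal ?c * (scal (- qnum_s 1) * gen 0))"
        using less.prems by (intro cong_add cong_refl cong_left scal_free cong_sq0) simp
      also have "\<dots> = scal (1 + ?c * (- qnum_s 1)) * gen 0"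
        by (simp only: scal_add scal_1 scal_mult distrib_right mult.assoc mult_1_left)
      also have "tlb_cong N \<dots> 0"
        using nz 0 by (intro cong_scal_zero) (simp add: qnum_s_def[of 0])
      finally show ?thesis .
    next
      case (Suc m)
      let ?d = "qnum_s m / qnum_s (m + 1)" and ?P = "Q_rep m" and ?e = "gen n"
      have FP: "?P \<in> free_on N" "gen m \<in> free_on N"
        using less.prems n' Suc by (auto intro!: free_rules Q_rep_free)
      have comm: "tlb_cong N (?P * ?e) (?e * ?P)"
        using less.prems n' Suc by (intro Q_commute) auto
      have absorb: "tlb_cong N (?P * ?Q) ?Q"
      proof (intro Q_absorb F)
        show "tlb_cong N (gen j * ?Q) 0" if "j < m" for j
          using less.IH[of n j] that less.prems n' Suc by simp
      qed (use less.prems n' Suc in simp)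
      \<comment> \<open>The scalar in e_n e_(n-1) e_n = b e_n. The value of the dotted loop at n = 1
        is what the recursion for [2]_s requires next to [0]_s = 1.\<close>
      define b where "b = (if m = 0 then dotted_loop else 1)"
      have braid: "tlb_cong N (?e * gen m * ?e) (scal b * ?e)"
      proof (cases "m = 0")
        case True
        then show ?thesis using cong_braid0[of N] less.prems n' Suc by (simp add: b_def)
      next
        case False
        then show ?thesis using cong_braid[of m N] less.prems n' Suc by (simp add: b_def scal_1)
      qed
      have eP: "tlb_cong N (?e * ?P * ?e * ?Q) (scal (- qnum 2) * (?e * ?Q))"
      proof -
        have "?e * ?P * ?e * ?Q = ?e * (?P * ?e) * ?Q" by (simp add: mult.assoc)
        also have "tlb_cong N \<dots> (?e * (?e * ?P) * ?Q)"
          by (intro cong_left cong_right comm F)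
        also have "\<dots> = ?e * ?e * (?P * ?Q)" by (simp add: mult.assoc)
        also have "tlb_cong N \<dots> (scal (- qnum 2) * ?e * ?Q)"
          using less.prems n' Suc
          by (intro cong_mult cong_sq absorb free_rules F FP) auto
        finally show ?thesis by (simp add: mult.assoc)
      qed
      have ePeP: "tlb_cong N (?e * (?P * gen m * ?P) * ?e * ?Q) (scal b * (?e * ?Q))"
      proof -
        have "?e * (?P * gen m * ?P) * ?e * ?Q = (?e * ?P) * gen m * ((?P * ?e) * ?Q)"
          by (simp add: mult.assoc)
        also have "tlb_cong N \<dots> ((?P * ?e) * gen m * ((?e * ?P) * ?Q))"
          by (intro cong_mult cong_sym[OF comm] cong_refl comm free_rules F FP)
        also have "\<dots> = ?P * ((?e * gen m * ?e) * (?P * ?Q))"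
          by (simp add: mult.assoc)
        also have "tlb_cong N \<dots> (?P * ((scal b * ?e) * ?Q))"
          by (intro cong_left cong_mult braid absorb free_rules F FP)
        also have "\<dots> = scal b * (?P * ?e * ?Q)"
          by (simp add: mult.assoc scal_left_commute)
        also have "tlb_cong N \<dots> (scal b * (?e * ?P * ?Q))"
          by (intro cong_left cong_right comm free_rules F)
        also have "\<dots> = scal b * (?e * (?P * ?Q))" by (simp add: mult.assoc)
        also have "tlb_cong N \<dots> (scal b * (?e * ?Q))"
          by (intro cong_left absorb free_rules F)
        finally show ?thesis .
      qed
      have Q: "?Q = ?P + scal ?d * (?P * gen m * ?P)" by (simp add: Suc)
      have "?e * ?Q * ?e * z = ?e * ?P * ?e * z + scal ?d * (?e * (?P * gen m * ?P) * ?e * z)" for z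
        unfolding Q by (simp add: distrib_left distrib_right mult.assoc scal_left_commute)
      then have "?e * ?Q * ?e * ?Q = ?e * ?P * ?e * ?Q + scal ?d * (?e * (?P * gen m * ?P) * ?e * ?Q)" .
      also have "tlb_cong N \<dots> (scal (- qnum 2) * (?e * ?Q) + scal ?d * (scal b * (?e * ?Q)))"
        by (intro cong_add cong_left eP ePeP scal_free)
      finally have "tlb_cong N (?e * ?Q + scal ?c * (?e * ?Q * ?e * ?Q))
        (?e * ?Q + scal ?c * (scal (- qnum 2) * (?e * ?Q) + scal ?d * (scal b * (?e * ?Q))))"
        by (intro cong_add cong_refl cong_left scal_free)
      also have "\<dots> = scal (1 + ?c * (- qnum 2 + ?d * b)) * (?e * ?Q)"
        by (simp only: scal_add scal_1 scal_mult distrib_left distrib_right mult.assoc mult_1_left)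
      also have "tlb_cong N \<dots> 0"
      proof (rule cong_scal_zero)
        have rec: "qnum_s (n + 1) = qnum 2 * qnum_s n - qnum_s m * b"
        proof (cases m)
          case 0
          then show ?thesis using qnum_s_2 Suc by (simp add: b_def qnum_s_def[of 0] numeral_2_eq_2)
        next
          case (Suc m')
          then show ?thesis using qnum_s_rec[of m'] \<open>n = Suc m\<close> by (simp add: b_def eval_nat_numeral)
        qed
        have "?c * (- qnum 2 + ?d * b) = - (qnum 2 * qnum_s n - qnum_s m * b) / qnum_s (n + 1)"
          using nz Suc by (simp add: field_simps)
        then show "1 + ?c * (- qnum 2 + ?d * b) = 0"
          using nz(2) by (simp only: rec[symmetric] minus_divide_left[symmetric] divide_self) simp
      qed
      finally show ?thesis unfolding i split[unfolded i] .
    qed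
  qed
qed

text \<open>Unrolled, \<open>wenzl_chain (Suc n)\<close> is the sum over k \<le> n + 1 of ([k]_s /
  [n+1]_s) e_k ... e_n, with the empty product for k = n + 1: the quotients telescope along each
  product.\<close>

primrec wenzl_chain :: "nat \<Rightarrow> free_alg" where
  "wenzl_chain 0 = 1"
| "wenzl_chain (Suc n) = 1 + scal (qnum_s n / qnum_s (n + 1)) * (wenzl_chain n * gen n)"

lemma wenzl_chain_free: "n \<le> m \<Longrightarrow> wenzl_chain n \<in> free_on m"
  by (induction n) (auto intro!: free_rules)

text \<open>Of the two outer factors Q in the recursion the left one is rewritten by induction as a
  chain times the previous Q. That previous Q commutes past the new generator and is absorbed by the
  right factor, so only the chain stays on the left.\<close>

lemma Q_chain:
  assumes "n < N"
  shows "tlb_cong N (Q_rep (Suc n)) (wenzl_chain (Suc n) * Q_rep n)"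
  using assms
proof (induction n)
  case 0
  show ?case by (simp add: cong_refl)
next
  case (Suc n)
  let ?Q = "Q_rep (Suc n)" and ?P = "Q_rep n" and ?e = "gen (Suc n)" and ?X = "wenzl_chain (Suc n)"
  have F: "?Q \<in> free_on N" "?P \<in> free_on N" "?e \<in> free_on N" "?X \<in> free_on N"
    using Suc.prems by (auto intro!: gen_free Q_rep_free wenzl_chain_free simp del: Q_rep.simps wenzl_chain.simps)
  have IH: "tlb_cong N ?Q (?X * ?P)" using Suc by simp
  have "tlb_cong N (?Q * (?e * ?Q)) (?X * ?P * (?e * ?Q))"
    by (intro cong_right IH free_rules F)
  also have "\<dots> = ?X * ((?P * ?e) * ?Q)" by (simp only: mult.assoc)
  also have "tlb_cong N \<dots> (?X * ((?e * ?P) * ?Q))"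
    using Suc.prems by (intro cong_left cong_right Q_commute F) auto
  also have "\<dots> = ?X * ?e * (?P * ?Q)" by (simp only: mult.assoc)
  also have "tlb_cong N \<dots> (?X * ?e * ?Q)"
    using Suc.prems by (intro cong_left Q_absorb Q_annihilated free_rules F) auto
  finally have "tlb_cong N (?Q + scal (qnum_s (Suc n) / qnum_s (Suc n + 1)) * (?Q * (?e * ?Q)))
     (?Q + scal (qnum_s (Suc n) / qnum_s (Suc n + 1)) * (?X * ?e * ?Q))"
    by (intro cong_add cong_refl cong_left scal_free)
  then show ?case
    by (simp only: Q_rep.simps(2)[of "Suc n"] wenzl_chain.simps(2)[of "Suc n"] distrib_right mult.assoc mult_1)
qed

section \<open>Stacking a generator on a dotted matching\<close>

text \<open>\<open>f\<close> sends each point to the other end of its arc, and \<delta> marks the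
  points on dotted arcs. The relations are checked for all such dotted matchings at once, planar or
  not.\<close>

definition mating :: "nat \<Rightarrow> (point \<Rightarrow> point) \<Rightarrow> (point \<Rightarrow> bool) \<Rightarrow> bool" where
  "mating n f \<delta> \<longleftrightarrow> (\<forall>x \<in> points n. f x \<in> points n \<and> f x \<noteq> x \<and> f (f x) = x \<and> \<delta> (f x) = \<delta> x)"

definition mate_diagram :: "nat \<Rightarrow> (point \<Rightarrow> point) \<Rightarrow> (point \<Rightarrow> bool) \<Rightarrow> diagram" where
  "mate_diagram n f \<delta> = ((\<lambda>x. {x, f x}) ` points n, (\<lambda>x. {x, f x}) ` {x \<in> points n. \<delta> x})"

text \<open>The order of the updates matters. If p and q are mates, the first two updates hit p and
  q themselves and have to be overridden by the last two; the result is then f again, with one loop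
  split off.\<close>

definition contract :: "(point \<Rightarrow> point) \<Rightarrow> point \<Rightarrow> point \<Rightarrow> point \<Rightarrow> point" where
  "contract f p q = f(f p := f q, f q := f p, p := q, q := p)"

definition contract_dots ::
  "(point \<Rightarrow> point) \<Rightarrow> (point \<Rightarrow> bool) \<Rightarrow> point \<Rightarrow> point \<Rightarrow> point \<Rightarrow> bool" where
  "contract_dots f \<delta> p q = \<delta>(f p := \<delta> p \<or> \<delta> q, f q := \<delta> p \<or> \<delta> q, p := False, q := False)"

definition contract_factor ::
  "(point \<Rightarrow> point) \<Rightarrow> (point \<Rightarrow> bool) \<Rightarrow> point \<Rightarrow> point \<Rightarrow> qs_field" where
  "contract_factor f \<delta> p q =
     (if f p = q then (if \<delta> p then dotted_loop else - qnum 2)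
      else if \<delta> p \<and> \<delta> q then - qnum_s 1 else 1)"

lemma finite_points: "finite (points n)"
  by (simp add: points_def)

lemma Top_points [simp]: "Top k \<in> points n \<longleftrightarrow> 1 \<le> k \<and> k \<le> n"
  and Bot_points [simp]: "Bot k \<in> points n \<longleftrightarrow> 1 \<le> k \<and> k \<le> n"
  by (auto simp: points_def)

text \<open>A labelling \<open>cl\<close> that is constant along edges and whose labels are connected sets
  identifies the components.\<close>

lemma components_eq:
  fixes D D' :: diagram and cl :: "node \<Rightarrow> node set"
  defines "R \<equiv> {(x, y). \<exists>b \<in> glue_edges D D'. x \<in> b \<and> y \<in> b}"
  assumes self: "\<And>v. v \<in> \<Union> (glue_edges D D') \<Longrightarrow> v \<in> cl v"
    and edge: "\<And>b x y. b \<in> glue_edges D D' \<Longrightarrow> x \<in> b \<Longrightarrow> y \<in> b \<Longrightarrow> cl x = cl y"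
    and conn: "\<And>v y. v \<in> \<Union> (glue_edges D D') \<Longrightarrow> y \<in> cl v \<Longrightarrow> (v, y) \<in> R\<^sup>*"
  shows "components D D' = cl ` \<Union> (glue_edges D D')"
proof -
  have "R\<^sup>* `` {v} = cl v" if v: "v \<in> \<Union> (glue_edges D D')" for v
  proof
    show "R\<^sup>* `` {v} \<subseteq> cl v"
    proof
      fix y assume "y \<in> R\<^sup>* `` {v}"
      then have "(v, y) \<in> R\<^sup>*" by simp
      then have "cl y = cl v \<and> y \<in> \<Union> (glue_edges D D')"
      proof (induction rule: rtrancl_induct)
        case (step y z)
        then obtain b where "b \<in> glue_edges D D'" "y \<in> b" "z \<in> b" by (auto simp: R_def)
        then show ?case using step.IH edge[of b y z] by auto
      qed (use v in simp)
      then show "y \<in> cl v" using self by blast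
    qed
  next
    show "cl v \<subseteq> R\<^sup>* `` {v}" using conn[OF v] by blast
  qed
  then show ?thesis
    unfolding components_def R_def by (intro image_cong refl) blast
qed

lemma glue_edges_Union:
  assumes m: "mating n f \<delta>" and U: "\<Union> (arcs D) = points n"
  shows "\<Union> (glue_edges D (mate_diagram n f \<delta>)) = Upper ` {1..n} \<union> Middle ` {1..n} \<union> Lower ` {1..n}"
proof -
  have V: "\<Union> (arcs (mate_diagram n f \<delta>)) = points n"
    using m unfolding mate_diagram_def mating_def fst_conv by blast
  have "\<Union> (glue_edges D (mate_diagram n f \<delta>)) = node_first ` points n \<union> node_second ` points n"
    unfolding glue_edges_def Union_Un_distrib image_Union[symmetric] U V ..
  also have "\<dots> = Upper ` {1..n} \<union> Middle ` {1..n} \<union> Lower ` {1..n}"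
    unfolding points_def image_Un image_image by (simp add: Un_ac)
  finally show ?thesis .
qed

lemma gen_arcs_Union:
  assumes "i < n"
  shows "\<Union> (arcs (gen_diagram n i)) = points n"
proof (cases "i = 0")
  case False
  have "{1..n} = ({1..n} - {i, i + 1}) \<union> {i, i + 1}" using assms False by auto
  then have "points n = Top ` (({1..n} - {i, i + 1}) \<union> {i, i + 1}) \<union> Bot ` (({1..n} - {i, i + 1}) \<union> {i, i + 1})"
    unfolding points_def by simp
  then show ?thesis using False by (simp add: gen_diagram_def image_Un) blast
qed (simp add: gen_diagram_def id_diagram_def points_def, blast)

section \<open>Components of e_i stacked on a matching, for i \<ge> 1\<close>

context
  fixes n i :: nat and f :: "point \<Rightarrow> point" and \<delta> :: "point \<Rightarrow> bool"
  assumes mate: "mating n f \<delta>" and i: "1 \<le> i" "i < n"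
begin

private abbreviation "p \<equiv> Top i"
private abbreviation "q \<equiv> Top (i + 1)"
private abbreviation "G \<equiv> gen_diagram n i"
private abbreviation "D \<equiv> mate_diagram n f \<delta>"

text \<open>The nodes hanging on the point x of the lower diagram: its own node and, if x is a top
  point below a vertical strand of e_i, the upper end of that strand. At p and q the lower arc of
  e_i sits instead of a strand.\<close>

private definition fibre :: "point \<Rightarrow> node set" where
  "fibre x = insert (node_second x) (if x \<in> {p, q} then {} else {outer_node x})"

text \<open>The points of the lower diagram in the component of x: the lower arc of e_i merges the
  arc at p with the arc at q, and all other arcs stay alone.\<close>

private definition strand :: "point \<Rightarrow> point set" where
  "strand x = (if x \<in> {p, q, f p, f q} then {p, q, f p, f q} else {x, f x})"

private definition comp :: "point \<Rightarrow> node set" where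
  "comp x = \<Union> (fibre ` strand x)"

private definition cap :: "node set" where
  "cap = {Upper i, Upper (i + 1)}"

private primrec label :: "node \<Rightarrow> node set" where
  "label (Upper k) = (if k \<in> {i, i + 1} then cap else comp (Top k))"
| "label (Middle k) = comp (Top k)"
| "label (Lower k) = comp (Bot k)"

private lemma pq: "p \<in> points n" "q \<in> points n"
  using i by auto

private lemma f: "x \<in> points n \<Longrightarrow> f x \<in> points n" "x \<in> points n \<Longrightarrow> f x \<noteq> x"
    "x \<in> points n \<Longrightarrow> f (f x) = x" "x \<in> points n \<Longrightarrow> \<delta> (f x) = \<delta> x"
  using mate by (auto simp: mating_def)

private lemma strand_self: "x \<in> strand x"
  by (simp add: strand_def)

private lemma strand_mate: "x \<in> points n \<Longrightarrow> strand (f x) = strand x"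
  unfolding strand_def using f pq
  by (smt (verit, best) insert_commute insert_iff singletonD)

private lemma comp_eq: "strand x = strand y \<Longrightarrow> comp x = comp y"
  by (simp add: comp_def)

private lemma G_edges: "arcs G = (\<lambda>k. {Top k, Bot k}) ` ({1..n} - {i, i + 1}) \<union> {{p, q}, {Bot i, Bot (i + 1)}}"
  using i by (simp add: gen_diagram_def)

private lemma glue_edges_gen:
  "glue_edges G D = (\<lambda>k. {Upper k, Middle k}) ` ({1..n} - {i, i + 1}) \<union>
     {cap, {Middle i, Middle (i + 1)}} \<union> (\<lambda>x. {node_second x, node_second (f x)}) ` points n"
  unfolding glue_edges_def G_edges mate_diagram_def cap_def fst_conv image_Un image_image
  by simp

private lemma edge_cases:
  assumes "b \<in> glue_edges G D"
  obtains (strand) k where "k \<in> {1..n} - {i, i + 1}" "b = {Upper k, Middle k}"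
  | (cap) "b = cap"
  | (cup) "b = {Middle i, Middle (i + 1)}"
  | (arc) x where "x \<in> points n" "b = {node_second x, node_second (f x)}"
  using assms unfolding glue_edges_gen by blast

private lemma label_second: "label (node_second x) = comp x"
  by (cases x) auto

private lemma label_edge:
  assumes "b \<in> glue_edges G D" "u \<in> b" "v \<in> b"
  shows "label u = label v"
  using assms(1)
proof (cases rule: edge_cases)
  case (cup)
  have "comp p = comp q" by (intro comp_eq) (simp add: strand_def)
  with cup assms(2,3) show ?thesis by auto
next
  case (arc x)
  have "comp x = comp (f x)" using arc by (intro comp_eq) (simp add: strand_mate)
  with arc assms(2,3) show ?thesis by (auto simp: label_second)
qed (use assms(2,3) in \<open>auto simp: cap_def\<close>)

private definition R where "R = {(x, y). \<exists>b \<in> glue_edges G D. x \<in> b \<and> y \<in> b}"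

private lemma R_sym: "(u, v) \<in> R\<^sup>* \<Longrightarrow> (v, u) \<in> R\<^sup>*"
proof -
  have "sym R" unfolding R_def sym_def by blast
  then show "(u, v) \<in> R\<^sup>* \<Longrightarrow> (v, u) \<in> R\<^sup>*" using sym_rtrancl symD by metis
qed

private lemma R_edge: "b \<in> glue_edges G D \<Longrightarrow> u \<in> b \<Longrightarrow> v \<in> b \<Longrightarrow> (u, v) \<in> R\<^sup>*"
  by (rule r_into_rtrancl) (simp add: R_def, blast)

private lemma R_arc: "x \<in> points n \<Longrightarrow> (node_second x, node_second (f x)) \<in> R\<^sup>*"
  by (rule R_edge[of "{node_second x, node_second (f x)}"]) (simp_all add: glue_edges_gen)

private lemma R_cup: "(node_second p, node_second q) \<in> R\<^sup>*"
  by (rule R_edge[of "{Middle i, Middle (i + 1)}"]) (simp_all add: glue_edges_gen)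

private lemma R_cap: "u \<in> cap \<Longrightarrow> v \<in> cap \<Longrightarrow> (u, v) \<in> R\<^sup>*"
  by (rule R_edge[of cap]) (simp_all add: glue_edges_gen)

private lemma R_strand: "k \<in> {1..n} - {i, i + 1} \<Longrightarrow> (Upper k, Middle k) \<in> R\<^sup>*"
  by (rule R_edge[of "{Upper k, Middle k}"]) (simp_all add: glue_edges_gen)

private lemma R_fibre: "x \<in> points n \<Longrightarrow> u \<in> fibre x \<Longrightarrow> (u, node_second x) \<in> R\<^sup>*"
  using R_strand by (cases x) (auto simp: fibre_def split: if_splits)

private lemma strand_points: "x \<in> points n \<Longrightarrow> y \<in> strand x \<Longrightarrow> y \<in> points n"
  using f pq by (auto simp: strand_def split: if_splits)

private lemma R_strands: "x \<in> points n \<Longrightarrow> y \<in> strand x \<Longrightarrow> (node_second y, node_second x) \<in> R\<^sup>*"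
proof -
  assume x: "x \<in> points n" and y: "y \<in> strand x"
  have *: "(node_second z, node_second p) \<in> R\<^sup>*" if "z \<in> {p, q, f p, f q}" for z
    using that R_arc[OF pq(1)] R_arc[OF pq(2)] R_cup R_sym by (auto intro: rtrancl_trans)
  show ?thesis
  proof (cases "x \<in> {p, q, f p, f q}")
    case True
    then show ?thesis using * y R_sym by (auto simp: strand_def intro: rtrancl_trans)
  next
    case False
    then show ?thesis using y R_arc[OF x] R_sym by (auto simp: strand_def)
  qed
qed

private lemma R_comp:
  assumes x: "x \<in> points n" and "u \<in> comp x"
  shows "(u, node_second x) \<in> R\<^sup>*"
proof -
  obtain y where y: "y \<in> strand x" "u \<in> fibre y" using assms(2) unfolding comp_def by blast
  show ?thesis
    by (rule rtrancl_trans[OF R_fibre[OF strand_points[OF x y(1)] y(2)] R_strands[OF x y(1)]])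
qed

private lemma node_cases:
  assumes "v \<in> Upper ` {1..n} \<union> Middle ` {1..n} \<union> Lower ` {1..n}"
  obtains "v \<in> cap" "label v = cap" | x where "x \<in> points n" "v \<in> fibre x" "label v = comp x"
proof -
  consider (U) k where "k \<in> {1..n}" "v = Upper k" | (M) k where "k \<in> {1..n}" "v = Middle k"
    | (L) k where "k \<in> {1..n}" "v = Lower k"
    using assms by blast
  then show ?thesis
  proof cases
    case (U k)
    show ?thesis
    proof (cases "k \<in> {i, i + 1}")
      case True
      with U have "v \<in> cap" "label v = cap" by (auto simp: cap_def)
      then show ?thesis by (rule that(1))
    next
      case False
      with U have "Top k \<in> points n" "v \<in> fibre (Top k)" "label v = comp (Top k)"
        by (auto simp: fibre_def)
      then show ?thesis by (rule that(2))
    qed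
  next
    case (M k)
    then have "Top k \<in> points n" "v \<in> fibre (Top k)" "label v = comp (Top k)"
      by (auto simp: fibre_def)
    then show ?thesis by (rule that(2))
  next
    case (L k)
    then have "Bot k \<in> points n" "v \<in> fibre (Bot k)" "label v = comp (Bot k)"
      by (auto simp: fibre_def)
    then show ?thesis by (rule that(2))
  qed
qed

private lemma components_gen: "components G D = insert cap (comp ` points n)"
proof -
  have U: "\<Union> (glue_edges G D) = Upper ` {1..n} \<union> Middle ` {1..n} \<union> Lower ` {1..n}"
    using i by (intro glue_edges_Union[OF mate] gen_arcs_Union)
  have "components G D = label ` \<Union> (glue_edges G D)"
  proof (rule components_eq)
    fix v assume "v \<in> \<Union> (glue_edges G D)"
    then have v: "v \<in> Upper ` {1..n} \<union> Middle ` {1..n} \<union> Lower ` {1..n}" using U by simp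
    show "v \<in> label v"
      using v by (cases rule: node_cases) (use strand_self in \<open>auto simp: comp_def\<close>)
    fix y assume "y \<in> label v"
    with v have "(v, y) \<in> R\<^sup>*"
    proof (cases rule: node_cases)
      case (2 x)
      have "v \<in> comp x" using 2 strand_self by (auto simp: comp_def)
      have "y \<in> comp x" using 2 \<open>y \<in> label v\<close> by simp
      show ?thesis
        by (rule rtrancl_trans[OF R_comp[OF 2(1) \<open>v \<in> comp x\<close>] R_sym[OF R_comp[OF 2(1) \<open>y \<in> comp x\<close>]]])
    next
      case 1
      then show ?thesis using R_cap \<open>y \<in> label v\<close> by simp
    qed
    then show "(v, y) \<in> {(x, y). \<exists>b\<in>glue_edges G D. x \<in> b \<and> y \<in> b}\<^sup>*"
      by (simp add: R_def)
  qed (use label_edge in blast)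
  also have "\<dots> = insert cap (comp ` points n)"
  proof
    show "label ` \<Union> (glue_edges G D) \<subseteq> insert cap (comp ` points n)"
    proof (rule image_subsetI)
      fix v assume "v \<in> \<Union> (glue_edges G D)"
      then show "label v \<in> insert cap (comp ` points n)"
        unfolding U by (cases rule: node_cases) simp_all
    qed
    have "label (Upper i) = cap" "Upper i \<in> \<Union> (glue_edges G D)"
      using U i by auto
    moreover have "comp x \<in> label ` \<Union> (glue_edges G D)" if "x \<in> points n" for x
    proof -
      have "node_second x \<in> \<Union> (glue_edges G D)" using that unfolding U points_def by auto
      then show ?thesis using label_second by (metis image_eqI)
    qed
    ultimately show "insert cap (comp ` points n) \<subseteq> label ` \<Union> (glue_edges G D)"
      by (metis (no_types, lifting) image_eqI image_subset_iff insert_subset)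
  qed
  finally show ?thesis .
qed

private lemma endpoints_comp: "endpoints (comp x) = strand x - {p, q}"
proof -
  have "outer_node y \<in> fibre x \<longleftrightarrow> x = y \<and> x \<notin> {p, q}" for x y
    by (cases x; cases y) (auto simp: fibre_def)
  then show ?thesis by (auto simp: endpoints_def comp_def)
qed

private lemma endpoints_cap: "endpoints cap = {p, q}"
  unfolding endpoints_def cap_def by (auto elim!: outer_node.elims)

private lemma second_in_comp: "node_second ` c \<subseteq> comp x \<longleftrightarrow> c \<subseteq> strand x"
proof -
  have "node_second y \<in> fibre x \<longleftrightarrow> x = y" for x y
    by (cases x; cases y) (auto simp: fibre_def)
  then show ?thesis by (auto simp: comp_def)
qed

private lemma dots_cap: "dots_on G D cap = 0"
proof -
  have "{c \<in> dotted D. node_second ` c \<subseteq> cap} = {}"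
    by (auto simp: mate_diagram_def cap_def elim!: node_second.elims)
  then have "card {c \<in> dotted D. node_second ` c \<subseteq> cap} = 0" by (simp only: card.empty)
  then show ?thesis using i by (simp add: dots_on_def gen_diagram_def)
qed

private lemma dots_comp:
  assumes x: "x \<in> points n"
  shows "dots_on G D (comp x) = card ((\<lambda>y. {y, f y}) ` {y \<in> points n. \<delta> y \<and> y \<in> strand x})"
proof -
  have "{c \<in> dotted D. node_second ` c \<subseteq> comp x} = (\<lambda>y. {y, f y}) ` {y \<in> points n. \<delta> y \<and> y \<in> strand x}"
  proof -
    have "f y \<in> strand x" if "y \<in> points n" "y \<in> strand x" for y
      using that f pq x by (auto simp: strand_def split: if_splits)
    then show ?thesis unfolding second_in_comp mate_diagram_def by auto
  qed
  then show ?thesis using i by (simp add: dots_on_def gen_diagram_def)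
qed

private lemma dots_other:
  assumes "x \<in> points n" "x \<notin> {p, q, f p, f q}"
  shows "dots_on G D (comp x) = (if \<delta> x then 1 else 0)"
proof -
  have "{y \<in> points n. \<delta> y \<and> y \<in> strand x} = (if \<delta> x then {x, f x} else {})"
    using assms f by (auto simp: strand_def)
  then show ?thesis unfolding dots_comp[OF assms(1)] using f(3)[OF assms(1)] by (simp add: insert_commute)
qed

private lemma dots_special:
  "dots_on G D (comp p) = (if f p = q then (if \<delta> p then 1 else 0)
     else (if \<delta> p then 1 else 0) + (if \<delta> q then 1 else 0))"
proof -
  have "{y \<in> points n. \<delta> y \<and> y \<in> strand p} = (if \<delta> p then {p, f p} else {}) \<union> (if \<delta> q then {q, f q} else {})"
    using pq f by (auto simp: strand_def)
  moreover have "{q, f q} \<noteq> {p, f p}" if "f p \<noteq> q"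
    using that by (auto simp: doubleton_eq_iff)
  moreover have "\<delta> q = \<delta> p" "f q = p" if "f p = q" using that f pq by metis+
  ultimately show ?thesis unfolding dots_comp[OF pq(1)] using f(3)[OF pq(1)] f(3)[OF pq(2)]
    by (auto simp: insert_commute)
qed

private lemma comp_special: "x \<in> {p, q, f p, f q} \<Longrightarrow> comp x = comp p"
  by (intro comp_eq) (simp add: strand_def)

text \<open>Only the component through p can contribute. The cap carries no dot, and every other
  component is a single arc of the matching, which has end points and at most one dot.\<close>

lemma stack_factor_gen: "stack_factor G D = contract_factor f \<delta> p q"
proof -
  let ?v = "\<lambda>C. (if dots_on G D C = 0 then (if endpoints C = {} then - qnum 2 else 1)
         else (- qnum_s 1) ^ (dots_on G D C - 1) * (if endpoints C = {} then dotted_loop else 1))"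
  have "?v C = 1" if C: "C \<in> components G D - {comp p}" for C
  proof -
    consider "C = cap" | x where "x \<in> points n" "C = comp x" "x \<notin> {p, q, f p, f q}"
      using C comp_special unfolding components_gen by (metis DiffE imageE insertE singletonI)
    then show ?thesis
    proof cases
      case 2
      then have "endpoints C \<noteq> {}" using strand_self by (auto simp: endpoints_comp)
      then show ?thesis using dots_other[OF 2(1,3)] 2 by simp
    qed (simp add: dots_cap endpoints_cap)
  qed
  moreover have "comp p \<in> components G D" "finite (components G D)"
    unfolding components_gen using pq by (auto simp: finite_points)
  ultimately have "stack_factor G D = ?v (comp p)"
    unfolding stack_factor_def by (subst prod.remove) (auto intro!: prod.neutral)
  moreover have "endpoints (comp p) = {} \<longleftrightarrow> f p = q"
    using f(2)[OF pq(1)] f(3)[OF pq(1)] by (auto simp: endpoints_comp strand_def)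
  ultimately show ?thesis
    unfolding contract_factor_def dots_special by auto
qed

lemma stack_gen: "stack G D = mate_diagram n (contract f p q) (contract_dots f \<delta> p q)"
proof -
  let ?f = "contract f p q" and ?d = "contract_dots f \<delta> p q"
  have arc: "{x, ?f x} = (if x \<in> {p, q} then {p, q} else if x \<in> {f p, f q} then {f p, f q} else {x, f x})"
    if "x \<in> points n" for x
    using that by (auto simp: contract_def)
  \<comment> \<open>A mate of p or q outside these two points shows that the component of p is not a
    closed loop.\<close>
  have nontriv: "f p \<notin> {p, q} \<and> f q \<notin> {p, q}" if "x \<in> {f p, f q}" "x \<notin> {p, q}" for x
    using that f(2)[OF pq(1)] f(2)[OF pq(2)] f(3)[OF pq(1)] f(3)[OF pq(2)] by auto
  have ends: "endpoints (comp x) = (if x \<in> {p, q} then {f p, f q} - {p, q} else {x, ?f x})"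
    if x: "x \<in> points n" for x
  proof -
    consider "x \<in> {p, q}" | "x \<notin> {p, q}" "x \<in> {f p, f q}" | "x \<notin> {p, q}" "x \<notin> {f p, f q}"
      by blast
    then show ?thesis
    proof cases
      case 1
      then have "strand x = {p, q, f p, f q}" by (auto simp: strand_def)
      with 1 show ?thesis unfolding endpoints_comp by auto
    next
      case 2
      then have "strand x = {p, q, f p, f q}" by (auto simp: strand_def)
      moreover have "{x, ?f x} = {f p, f q}" using arc[OF x] 2 by simp
      ultimately show ?thesis using 2 nontriv[OF 2(2,1)] unfolding endpoints_comp by auto
    next
      case 3
      then have "strand x = {x, f x}" by (auto simp: strand_def)
      moreover have "{x, ?f x} = {x, f x}" using arc[OF x] 3 by simp
      moreover have "f x \<notin> {p, q}" using 3 f(3)[OF x] by auto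
      ultimately show ?thesis using 3 unfolding endpoints_comp by auto
    qed
  qed
  \<comment> \<open>Apart from the cap, every component with end points contains a point of
    \<open>P\<close>; a component whose points are only p and q is a closed loop and disappears from
    the product.\<close>
  define P where "P = points n - {p, q}"
  have comps: "C \<in> components G D \<and> endpoints C \<noteq> {} \<longleftrightarrow> C = cap \<or> C \<in> comp ` P" for C
  proof -
    have "comp x \<in> comp ` P" if x: "x \<in> points n" "endpoints (comp x) \<noteq> {}" for x
    proof (cases "x \<in> {p, q}")
      case True
      then have "{f p, f q} - {p, q} \<noteq> {}" using x(2) ends[OF x(1)] by simp
      then obtain y where y: "y \<in> {f p, f q}" "y \<notin> {p, q}" by blast
      then have "comp y = comp x" using comp_special[of y] comp_special[of x] True by auto
      moreover have "y \<in> P" using y f(1)[OF pq(1)] f(1)[OF pq(2)] by (auto simp: P_def)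
      ultimately show ?thesis by (metis imageI)
    qed (use x in \<open>simp add: P_def\<close>)
    moreover have "endpoints (comp x) \<noteq> {}" if "x \<in> P" for x
      using that ends[of x] by (simp add: P_def)
    moreover have "P \<subseteq> points n" by (auto simp: P_def)
    ultimately show ?thesis
      unfolding components_gen using endpoints_cap by blast
  qed
  have fst_eq: "fst (stack G D) = fst (mate_diagram n ?f ?d)"
  proof -
    have "fst (stack G D) = insert {p, q} ((\<lambda>x. endpoints (comp x)) ` P)"
    proof -
      have "{C. C \<in> components G D \<and> endpoints C \<noteq> {}} = insert cap (comp ` P)"
        by (rule set_eqI) (simp only: mem_Collect_eq comps insert_iff)
      then have "{endpoints C | C. C \<in> components G D \<and> endpoints C \<noteq> {}} = endpoints ` (insert cap (comp ` P))"
        by (simp only: setcompr_eq_image)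
      then show ?thesis unfolding stack_def fst_conv by (simp add: endpoints_cap image_image)
    qed
    also have "(\<lambda>x. endpoints (comp x)) ` P = (\<lambda>x. {x, ?f x}) ` P"
      using ends by (intro image_cong refl) (simp add: P_def)
    also have "insert {p, q} \<dots> = (\<lambda>x. {x, ?f x}) ` (insert p (insert q P))"
      using pq arc by auto
    also have "insert p (insert q P) = points n" using pq by (auto simp: P_def)
    finally show ?thesis by (simp add: mate_diagram_def)
  qed
  have dots: "dots_on G D (comp x) > 0 \<longleftrightarrow> ?d x" if "x \<in> P" for x
  proof (cases "x \<in> {p, q, f p, f q}")
    case True
    then have x: "x \<in> {f p, f q}" "x \<notin> {p, q}" using that by (auto simp: P_def)
    then have "f p \<noteq> q" using nontriv by blast
    then show ?thesis using comp_special[OF True] x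
      by (auto simp: dots_special contract_dots_def)
  next
    case False
    then show ?thesis using dots_other[of x] that by (auto simp: P_def contract_dots_def)
  qed
  have "snd (stack G D) = (\<lambda>x. endpoints (comp x)) ` {x \<in> P. ?d x}"
  proof -
    have "{C. C \<in> components G D \<and> endpoints C \<noteq> {} \<and> dots_on G D C > 0}
        = {C. (C = cap \<or> C \<in> comp ` P) \<and> dots_on G D C > 0}"
      unfolding comps[symmetric] by (simp only: conj_assoc)
    also have "\<dots> = {C \<in> comp ` P. dots_on G D C > 0}"
      using dots_cap by (metis (no_types) less_irrefl)
    also have "\<dots> = comp ` {x \<in> P. dots_on G D (comp x) > 0}"
      by blast
    also have "\<dots> = comp ` {x \<in> P. ?d x}"
      using dots by (simp cong: conj_cong)
    finally have "{C. C \<in> components G D \<and> endpoints C \<noteq> {} \<and> dots_on G D C > 0} = comp ` {x \<in> P. ?d x}" .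
    then show ?thesis unfolding stack_def snd_conv by (simp only: setcompr_eq_image image_image)
  qed
  also have "\<dots> = (\<lambda>x. {x, ?f x}) ` {x \<in> P. ?d x}"
    using ends by (intro image_cong refl) (simp add: P_def)
  also have "{x \<in> P. ?d x} = {x \<in> points n. ?d x}"
    by (auto simp: P_def contract_dots_def)
  finally have "snd (stack G D) = snd (mate_diagram n ?f ?d)" by (simp add: mate_diagram_def)
  with fst_eq show ?thesis by (rule prod_eqI)
qed

end

lemma Collect_mem_singleton: "{c \<in> {a}. P c} = (if P a then {a} else {})"
  by auto

section \<open>Components of e_0 stacked on a matching\<close>

context
  fixes n :: nat and f :: "point \<Rightarrow> point" and \<delta> :: "point \<Rightarrow> bool"
  assumes mate: "mating n f \<delta>" and n: "1 \<le> n"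
begin

private abbreviation "G0 \<equiv> gen_diagram n 0"
private abbreviation "D0 \<equiv> mate_diagram n f \<delta>"

text \<open>All strands of e_0 are vertical, so a component is one arc of the matching with its top
  points prolonged upward, and no loop arises.\<close>

private definition comp0 :: "point \<Rightarrow> node set" where
  "comp0 x = {node_second x, outer_node x, node_second (f x), outer_node (f x)}"

private primrec label0 :: "node \<Rightarrow> node set" where
  "label0 (Upper k) = comp0 (Top k)"
| "label0 (Middle k) = comp0 (Top k)"
| "label0 (Lower k) = comp0 (Bot k)"

private lemma top1: "Top 1 \<in> points n"
  using n by simp

private lemma f0: "x \<in> points n \<Longrightarrow> f x \<in> points n" "x \<in> points n \<Longrightarrow> f x \<noteq> x"
    "x \<in> points n \<Longrightarrow> f (f x) = x" "x \<in> points n \<Longrightarrow> \<delta> (f x) = \<delta> x"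
  using mate by (auto simp: mating_def)

private lemma comp0_mate: "x \<in> points n \<Longrightarrow> comp0 (f x) = comp0 x"
  by (auto simp: comp0_def f0(3))

private lemma glue_edges_gen0:
  "glue_edges G0 D0 = (\<lambda>k. {Upper k, Middle k}) ` {1..n} \<union> (\<lambda>x. {node_second x, node_second (f x)}) ` points n"
  unfolding glue_edges_def gen_diagram_def id_diagram_def mate_diagram_def
  by (simp add: image_image)

private lemma label0_node: "label0 (node_second x) = comp0 x" "label0 (outer_node x) = comp0 x"
  by (cases x; simp)+

private lemma label0_edge:
  assumes "b \<in> glue_edges G0 D0" "u \<in> b" "v \<in> b"
  shows "label0 u = label0 v"
proof -
  consider k where "b = {Upper k, Middle k}"
    | x where "x \<in> points n" "b = {node_second x, node_second (f x)}"
    using assms(1) unfolding glue_edges_gen0 by blast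
  then show ?thesis
  proof cases
    case (2 x)
    then show ?thesis using assms(2,3) comp0_mate[of x] by (auto simp: label0_node)
  qed (use assms(2,3) in auto)
qed

private definition R0 where "R0 = {(x, y). \<exists>b \<in> glue_edges G0 D0. x \<in> b \<and> y \<in> b}"

private lemma R0_sym: "(u, v) \<in> R0\<^sup>* \<Longrightarrow> (v, u) \<in> R0\<^sup>*"
proof -
  have "sym R0" unfolding R0_def sym_def by blast
  then show "(u, v) \<in> R0\<^sup>* \<Longrightarrow> (v, u) \<in> R0\<^sup>*" using sym_rtrancl symD by metis
qed

private lemma R0_edge: "b \<in> glue_edges G0 D0 \<Longrightarrow> u \<in> b \<Longrightarrow> v \<in> b \<Longrightarrow> (u, v) \<in> R0\<^sup>*"
  by (rule r_into_rtrancl) (simp add: R0_def, blast)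

private lemma R0_outer: "x \<in> points n \<Longrightarrow> (outer_node x, node_second x) \<in> R0\<^sup>*"
proof (cases x)
  case (Top k)
  then show "x \<in> points n \<Longrightarrow> ?thesis"
    by (intro R0_edge[of "{Upper k, Middle k}"]) (simp_all add: glue_edges_gen0)
qed simp

private lemma R0_arc: "x \<in> points n \<Longrightarrow> (node_second (f x), node_second x) \<in> R0\<^sup>*"
  by (rule R0_edge[of "{node_second x, node_second (f x)}"]) (simp_all add: glue_edges_gen0)

private lemma R0_comp: "x \<in> points n \<Longrightarrow> u \<in> comp0 x \<Longrightarrow> (u, node_second x) \<in> R0\<^sup>*"
  using R0_outer[of x] R0_arc[of x] rtrancl_trans[OF R0_outer[of "f x"] R0_arc[of x]] f0(1)[of x]
  by (auto simp: comp0_def)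

private lemma node_cases0:
  assumes "v \<in> Upper ` {1..n} \<union> Middle ` {1..n} \<union> Lower ` {1..n}"
  obtains x where "x \<in> points n" "v \<in> comp0 x" "label0 v = comp0 x"
proof -
  consider k where "k \<in> {1..n}" "v = outer_node (Top k)" | k where "k \<in> {1..n}" "v = node_second (Top k)"
    | k where "k \<in> {1..n}" "v = outer_node (Bot k)"
    using assms by auto
  then obtain x where "x \<in> points n" "v = outer_node x \<or> v = node_second x"
    by cases (metis Top_points Bot_points atLeastAtMost_iff)+
  then have "x \<in> points n" "v \<in> comp0 x" "label0 v = comp0 x"
    using label0_node by (auto simp: comp0_def)
  then show ?thesis by (rule that)
qed

private lemma components_gen0: "components G0 D0 = comp0 ` points n"
proof -
  have U: "\<Union> (glue_edges G0 D0) = Upper ` {1..n} \<union> Middle ` {1..n} \<union> Lower ` {1..n}"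
    using n by (intro glue_edges_Union[OF mate] gen_arcs_Union) simp
  have "components G0 D0 = label0 ` \<Union> (glue_edges G0 D0)"
  proof (rule components_eq)
    fix v assume "v \<in> \<Union> (glue_edges G0 D0)"
    then have "v \<in> Upper ` {1..n} \<union> Middle ` {1..n} \<union> Lower ` {1..n}" using U by simp
    then obtain x where x: "x \<in> points n" "v \<in> comp0 x" "label0 v = comp0 x" by (rule node_cases0)
    then show "v \<in> label0 v" by simp
    fix y assume "y \<in> label0 v"
    then have "(v, y) \<in> R0\<^sup>*"
      using x by (intro rtrancl_trans[OF R0_comp[of x v] R0_sym[OF R0_comp[of x y]]]) simp_all
    then show "(v, y) \<in> {(x, y). \<exists>b\<in>glue_edges G0 D0. x \<in> b \<and> y \<in> b}\<^sup>*"
      by (simp add: R0_def)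
  qed (rule label0_edge)
  also have "\<dots> = comp0 ` points n"
  proof
    show "label0 ` \<Union> (glue_edges G0 D0) \<subseteq> comp0 ` points n"
    proof (rule image_subsetI)
      fix v assume "v \<in> \<Union> (glue_edges G0 D0)"
      then show "label0 v \<in> comp0 ` points n"
        unfolding U by (rule node_cases0) simp
    qed
    show "comp0 ` points n \<subseteq> label0 ` \<Union> (glue_edges G0 D0)"
    proof (rule image_subsetI)
      fix x assume "x \<in> points n"
      then have "node_second x \<in> \<Union> (glue_edges G0 D0)" unfolding U points_def by auto
      then show "comp0 x \<in> label0 ` \<Union> (glue_edges G0 D0)" using label0_node(1) by (metis image_eqI)
    qed
  qed
  finally show ?thesis .
qed

private lemma endpoints_comp0: "endpoints (comp0 x) = {x, f x}"
proof -
  have "outer_node y \<in> {node_second x, outer_node x} \<longleftrightarrow> y = x" for x y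
    by (cases x; cases y) auto
  then show ?thesis unfolding endpoints_def comp0_def by blast
qed

private lemma second_in_comp0: "node_second ` c \<subseteq> comp0 x \<longleftrightarrow> c \<subseteq> {x, f x}"
proof -
  have "node_second y \<in> {node_second x, outer_node x} \<longleftrightarrow> y = x" for x y
    by (cases x; cases y) auto
  then show ?thesis unfolding comp0_def by blast
qed

private lemma first_in_comp0: "node_first ` {Top k, Bot k} \<subseteq> comp0 x \<longleftrightarrow> Top k \<in> {x, f x}"
proof -
  have "Upper k \<in> {node_second x, outer_node x} \<longleftrightarrow> Top k = x" "Middle k \<in> {node_second x, outer_node x} \<longleftrightarrow> Top k = x" for x
    by (cases x; auto)+
  then show ?thesis unfolding comp0_def by auto
qed

private lemma dots_comp0:
  assumes x: "x \<in> points n"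
  shows "dots_on G0 D0 (comp0 x) = (if Top 1 \<in> {x, f x} then 1 else 0) + (if \<delta> x then 1 else 0)"
proof -
  have "{c \<in> dotted G0. node_first ` c \<subseteq> comp0 x} = (if Top 1 \<in> {x, f x} then {{Top 1, Bot 1}} else {})"
  proof -
    have "dotted G0 = {{Top 1, Bot 1}}" by (simp add: gen_diagram_def)
    then show ?thesis by (simp only: Collect_mem_singleton first_in_comp0)
  qed
  moreover have "{c \<in> dotted D0. node_second ` c \<subseteq> comp0 x} = (if \<delta> x then {{x, f x}} else {})"
  proof -
    have "{c \<in> dotted D0. node_second ` c \<subseteq> comp0 x} = (\<lambda>y. {y, f y}) ` {y \<in> points n. \<delta> y \<and> {y, f y} \<subseteq> {x, f x}}"
      unfolding second_in_comp0 mate_diagram_def snd_conv by blast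
    also have "{y \<in> points n. \<delta> y \<and> {y, f y} \<subseteq> {x, f x}} = (if \<delta> x then {x, f x} else {})"
      using f0[OF x] x by (auto split: if_splits)
    finally show ?thesis using f0(3)[OF x] by (simp add: insert_commute)
  qed
  ultimately show ?thesis unfolding dots_on_def by simp
qed

text \<open>The dot of e_0 meets the arc through \<open>Top 1\<close>; only there can two dots
  merge.\<close>

lemma stack_factor_gen0: "stack_factor G0 D0 = (if \<delta> (Top 1) then - qnum_s 1 else 1)"
proof -
  let ?v = "\<lambda>C. (if dots_on G0 D0 C = 0 then (if endpoints C = {} then - qnum 2 else 1)
         else (- qnum_s 1) ^ (dots_on G0 D0 C - 1) * (if endpoints C = {} then dotted_loop else 1))"
  have v: "?v (comp0 x) = (if Top 1 \<in> {x, f x} \<and> \<delta> x then - qnum_s 1 else 1)" if "x \<in> points n" for x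
    using that by (simp add: dots_comp0 endpoints_comp0)
  have "?v C = 1" if C: "C \<in> components G0 D0 - {comp0 (Top 1)}" for C
  proof -
    obtain x where x: "x \<in> points n" "C = comp0 x" using C unfolding components_gen0 by blast
    then have "Top 1 \<notin> {x, f x}" using C comp0_mate by auto
    then show ?thesis unfolding x(2) v[OF x(1)] by simp
  qed
  moreover have "comp0 (Top 1) \<in> components G0 D0" "finite (components G0 D0)"
    unfolding components_gen0 using top1 by (simp_all add: finite_points)
  ultimately have "stack_factor G0 D0 = ?v (comp0 (Top 1))"
    unfolding stack_factor_def by (subst prod.remove) (auto intro!: prod.neutral)
  then show ?thesis unfolding v[OF top1] by simp
qed

lemma stack_gen0:
  "stack G0 D0 = mate_diagram n f (\<delta>(Top 1 := True, f (Top 1) := True))"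
proof -
  let ?d = "\<delta>(Top 1 := True, f (Top 1) := True)"
  have d: "dots_on G0 D0 (comp0 x) > 0 \<longleftrightarrow> ?d x" if "x \<in> points n" for x
    using that f0(3)[of x] f0(3)[OF top1] by (auto simp: dots_comp0)
  have "{C. C \<in> components G0 D0 \<and> endpoints C \<noteq> {}} = comp0 ` points n"
    unfolding components_gen0 using endpoints_comp0 by blast
  then have 1: "fst (stack G0 D0) = endpoints ` comp0 ` points n"
    unfolding stack_def fst_conv by blast
  have "{C. C \<in> components G0 D0 \<and> endpoints C \<noteq> {} \<and> dots_on G0 D0 C > 0} = comp0 ` {x \<in> points n. ?d x}"
    unfolding components_gen0 using endpoints_comp0 d by blast
  then have 2: "snd (stack G0 D0) = endpoints ` comp0 ` {x \<in> points n. ?d x}"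
    unfolding stack_def snd_conv by blast
  show ?thesis
  proof (rule prod_eqI)
    show "fst (stack G0 D0) = fst (mate_diagram n f ?d)"
      unfolding 1 by (simp only: mate_diagram_def image_image endpoints_comp0 fst_conv)
    show "snd (stack G0 D0) = snd (mate_diagram n f ?d)"
      unfolding 2 by (simp only: mate_diagram_def image_image endpoints_comp0 snd_conv)
  qed
qed

end

section \<open>The relations hold on dotted matchings\<close>

lemma contract_mating:
  assumes "mating n f \<delta>" "p \<in> points n" "q \<in> points n" "p \<noteq> q"
  shows "mating n (contract f p q) (contract_dots f \<delta> p q)"
proof -
  have f: "f x \<in> points n" "f x \<noteq> x" "f (f x) = x" "\<delta> (f x) = \<delta> x" if "x \<in> points n" for x
    using that assms(1) by (auto simp: mating_def)
  note fp = f[OF assms(2)] and fq = f[OF assms(3)]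
  show ?thesis
    unfolding mating_def
  proof
    fix x assume x: "x \<in> points n"
    consider "x \<in> {p, q}" | "x \<notin> {p, q}" "x \<in> {f p, f q}" | "x \<notin> {p, q, f p, f q}" by blast
    then show "contract f p q x \<in> points n \<and> contract f p q x \<noteq> x \<and> contract f p q (contract f p q x) = x
      \<and> contract_dots f \<delta> p q (contract f p q x) = contract_dots f \<delta> p q x"
    proof cases
      case 1
      have "contract f p q p = q" "contract f p q q = p"
        "contract_dots f \<delta> p q p = False" "contract_dots f \<delta> p q q = False"
        using assms(4) by (simp_all add: contract_def contract_dots_def)
      then show ?thesis using 1 assms(2-4) by auto
    next
      case 2
      then have "f p \<noteq> q" "f q \<noteq> p" "f p \<noteq> f q" using fp fq assms(4) by auto
      then show ?thesis using 2 fp fq assms by (auto simp: contract_def contract_dots_def)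
    next
      case 3
      then have "f x \<notin> {p, q, f p, f q}" using f[OF x] fp fq by auto
      then show ?thesis using 3 f[OF x] by (auto simp: contract_def contract_dots_def)
    qed
  qed
qed

text \<open>\<open>gen_op\<close> names the point with the smaller index first,
  \<open>contract_braid\<close> the point shared by the two contractions; this lemma reconciles the
  two orders.\<close>

lemma contract_sym:
  assumes "f p \<noteq> f q" "p \<noteq> q" "f p \<noteq> p" "f q \<noteq> q" "f (f p) = p" "f (f q) = q" "\<delta> (f p) = \<delta> p"
  shows "contract f p q = contract f q p" "contract_dots f \<delta> p q = contract_dots f \<delta> q p"
    "contract_factor f \<delta> p q = contract_factor f \<delta> q p"
  using assms by (auto simp: contract_def contract_dots_def contract_factor_def fun_eq_iff)

lemma contract_idem:
  assumes "f p = q" "f q = p" "\<not> \<delta> p" "\<not> \<delta> q" "p \<noteq> q"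
  shows "contract f p q = f" "contract_dots f \<delta> p q = \<delta>" "contract_factor f \<delta> p q = - qnum 2"
  using assms by (auto simp: contract_def contract_dots_def contract_factor_def fun_eq_iff)

text \<open>A zigzag is pulled straight. Starting from the arc pq, contracting q with r leaves the
  arc qr and joins p to the former mate of r; contracting q with p undoes this, and neither
  contraction closes a loop or merges dots.\<close>

lemma contract_braid:
  assumes "f p = q" "f q = p" "\<not> \<delta> p" "\<not> \<delta> q" "p \<noteq> q" "r \<noteq> p" "r \<noteq> q"
    "f (f r) = r" "f r \<noteq> r" "\<delta> (f r) = \<delta> r"
  shows "contract (contract f q r) q p = f"
    "contract_dots (contract f q r) (contract_dots f \<delta> q r) q p = \<delta>"
    "contract_factor f \<delta> q r * contract_factor (contract f q r) (contract_dots f \<delta> q r) q p = 1"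
proof -
  have "f r \<noteq> p" "f r \<noteq> q" using assms by metis+
  then show "contract (contract f q r) q p = f"
    "contract_dots (contract f q r) (contract_dots f \<delta> q r) q p = \<delta>"
    "contract_factor f \<delta> q r * contract_factor (contract f q r) (contract_dots f \<delta> q r) q p = 1"
    using assms by (auto simp: contract_def contract_dots_def contract_factor_def fun_eq_iff)
qed

text \<open>The ten partial matchings of four points: three perfect ones, six single pairs and the
  empty one. The letters \<open>A\<close>, \<open>B\<close>, \<open>C\<close>, \<open>E\<close>,
  \<open>F\<close>, \<open>G\<close> stand for the pairs pq, pr, ps, qr, qs, rs, and the assumptions
  say that pairs sharing a point exclude each other.\<close>

lemma matching_cases:
  assumes "\<not> (A \<and> B)" "\<not> (A \<and> C)" "\<not> (B \<and> C)" "\<not> (E \<and> F)" "\<not> (A \<and> E)" "\<not> (A \<and> F)"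
    "\<not> (B \<and> E)" "\<not> (B \<and> G)" "\<not> (E \<and> G)" "\<not> (C \<and> F)" "\<not> (C \<and> G)" "\<not> (F \<and> G)"
  shows "(A \<and> G)
    \<or> (A \<and> \<not> (B \<or> C \<or> E \<or> F \<or> G))
    \<or> (G \<and> \<not> (A \<or> B \<or> C \<or> E \<or> F))
    \<or> (\<not> (A \<or> B \<or> C \<or> E \<or> F \<or> G))
    \<or> (B \<and> F)
    \<or> (C \<and> E)
    \<or> (B \<and> \<not> (A \<or> C \<or> E \<or> F \<or> G))
    \<or> (C \<and> \<not> (A \<or> B \<or> E \<or> F \<or> G))
    \<or> (E \<and> \<not> (A \<or> B \<or> C \<or> F \<or> G))
    \<or> (F \<and> \<not> (A \<or> B \<or> C \<or> E \<or> G))"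
  using assms by argo

text \<open>How the two contractions interact depends only on which of the four points are mated to
  each other, which leaves the cases of \<open>matching_cases\<close>. If p and q are mated
  crosswise to r and s, the second contraction closes a loop, in either order.\<close>

lemma contract_commute:
  assumes "distinct [p, q, r, s]"
    and inj: "\<And>x y. x \<in> {p, q, r, s} \<Longrightarrow> y \<in> {p, q, r, s} \<Longrightarrow> f x = f y \<Longrightarrow> x = y"
    and f: "\<And>x. x \<in> {p, q, r, s} \<Longrightarrow> f x \<noteq> x \<and> f (f x) = x \<and> \<delta> (f x) = \<delta> x"
  shows "contract (contract f p q) r s = contract (contract f r s) p q"
    and "contract_dots (contract f p q) (contract_dots f \<delta> p q) r s
       = contract_dots (contract f r s) (contract_dots f \<delta> r s) p q"
    and "contract_factor f \<delta> p q * contract_factor (contract f p q) (contract_dots f \<delta> p q) r s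
       = contract_factor f \<delta> r s * contract_factor (contract f r s) (contract_dots f \<delta> r s) p q"
proof -
  let ?X = "{p, q, r, s}"
  have dist: "p \<noteq> q" "p \<noteq> r" "p \<noteq> s" "q \<noteq> r" "q \<noteq> s" "r \<noteq> s"
    "q \<noteq> p" "r \<noteq> p" "s \<noteq> p" "r \<noteq> q" "s \<noteq> q" "s \<noteq> r"
    using assms(1) by auto
  have n: "f p \<noteq> f q" "f p \<noteq> f r" "f p \<noteq> f s" "f q \<noteq> f r" "f q \<noteq> f s" "f r \<noteq> f s"
    "f q \<noteq> f p" "f r \<noteq> f p" "f s \<noteq> f p" "f r \<noteq> f q" "f s \<noteq> f q" "f s \<noteq> f r"
    using inj dist by (metis insert_iff)+
  have m: "f p \<noteq> p" "f q \<noteq> q" "f r \<noteq> r" "f s \<noteq> s"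
     "f (f p) = p" "f (f q) = q" "f (f r) = r" "f (f s) = s"
     "\<delta> (f p) = \<delta> p" "\<delta> (f q) = \<delta> q" "\<delta> (f r) = \<delta> r" "\<delta> (f s) = \<delta> s"
    using f by simp_all
  consider "f p = q" "f q = p" "f r = s" "f s = r"
    | "f p = q" "f q = p" "f r \<notin> ?X" "f s \<notin> ?X"
    | "f r = s" "f s = r" "f p \<notin> ?X" "f q \<notin> ?X"
    | "f p \<notin> ?X" "f q \<notin> ?X" "f r \<notin> ?X" "f s \<notin> ?X"
    | "f p = r" "f r = p" "f q = s" "f s = q"
    | "f p = s" "f s = p" "f q = r" "f r = q"
    | "f p = r" "f r = p" "f q \<notin> ?X" "f s \<notin> ?X"
    | "f p = s" "f s = p" "f q \<notin> ?X" "f r \<notin> ?X"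
    | "f q = r" "f r = q" "f p \<notin> ?X" "f s \<notin> ?X"
    | "f q = s" "f s = q" "f p \<notin> ?X" "f r \<notin> ?X"
  proof -
    have e: "f p = q \<longleftrightarrow> f q = p" "f p = r \<longleftrightarrow> f r = p" "f p = s \<longleftrightarrow> f s = p"
      "f q = r \<longleftrightarrow> f r = q" "f q = s \<longleftrightarrow> f s = q" "f r = s \<longleftrightarrow> f s = r"
      using m(5-8) by metis+
    have y: "\<not> (f p = q \<and> f p = r)" "\<not> (f p = q \<and> f p = s)" "\<not> (f p = r \<and> f p = s)"
      "\<not> (f q = r \<and> f q = s)" "\<not> (f p = q \<and> f q = r)" "\<not> (f p = q \<and> f q = s)"
      "\<not> (f p = r \<and> f q = r)" "\<not> (f p = r \<and> f r = s)" "\<not> (f q = r \<and> f r = s)"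
      "\<not> (f p = s \<and> f q = s)" "\<not> (f p = s \<and> f r = s)" "\<not> (f q = s \<and> f r = s)"
      using dist n e by auto
    from matching_cases[OF y] show thesis
    proof (elim disjE)
      assume h: "f p = q \<and> f r = s"
      show thesis by (rule that(1)) (use h m(1-4) dist in \<open>simp_all add: e[symmetric]\<close>)
    next
      assume h: "f p = q \<and> \<not> (f p = r \<or> f p = s \<or> f q = r \<or> f q = s \<or> f r = s)"
      show thesis by (rule that(2)) (use h m(1-4) dist in \<open>simp_all add: e[symmetric]\<close>)
    next
      assume h: "f r = s \<and> \<not> (f p = q \<or> f p = r \<or> f p = s \<or> f q = r \<or> f q = s)"
      show thesis by (rule that(3)) (use h m(1-4) dist in \<open>simp_all add: e[symmetric]\<close>)
    next
      assume h: "\<not> (f p = q \<or> f p = r \<or> f p = s \<or> f q = r \<or> f q = s \<or> f r = s)"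
      show thesis by (rule that(4)) (use h m(1-4) dist in \<open>simp_all add: e[symmetric]\<close>)
    next
      assume h: "f p = r \<and> f q = s"
      show thesis by (rule that(5)) (use h m(1-4) dist in \<open>simp_all add: e[symmetric]\<close>)
    next
      assume h: "f p = s \<and> f q = r"
      show thesis by (rule that(6)) (use h m(1-4) dist in \<open>simp_all add: e[symmetric]\<close>)
    next
      assume h: "f p = r \<and> \<not> (f p = q \<or> f p = s \<or> f q = r \<or> f q = s \<or> f r = s)"
      show thesis by (rule that(7)) (use h m(1-4) dist in \<open>simp_all add: e[symmetric]\<close>)
    next
      assume h: "f p = s \<and> \<not> (f p = q \<or> f p = r \<or> f q = r \<or> f q = s \<or> f r = s)"
      show thesis by (rule that(8)) (use h m(1-4) dist in \<open>simp_all add: e[symmetric]\<close>)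
    next
      assume h: "f q = r \<and> \<not> (f p = q \<or> f p = r \<or> f p = s \<or> f q = s \<or> f r = s)"
      show thesis by (rule that(9)) (use h m(1-4) dist in \<open>simp_all add: e[symmetric]\<close>)
    next
      assume h: "f q = s \<and> \<not> (f p = q \<or> f p = r \<or> f p = s \<or> f q = r \<or> f r = s)"
      show thesis by (rule that(10)) (use h m(1-4) dist in \<open>simp_all add: e[symmetric]\<close>)
    qed
  qed
  then have "contract (contract f p q) r s = contract (contract f r s) p q \<and>
    contract_dots (contract f p q) (contract_dots f \<delta> p q) r s
       = contract_dots (contract f r s) (contract_dots f \<delta> r s) p q \<and>
    contract_factor f \<delta> p q * contract_factor (contract f p q) (contract_dots f \<delta> p q) r s
       = contract_factor f \<delta> r s * contract_factor (contract f r s) (contract_dots f \<delta> r s) p q"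
  proof cases
    case 1
    then show ?thesis using dist m(9-) by (auto simp: contract_def contract_dots_def contract_factor_def fun_eq_iff)
  next
    case 2
    then show ?thesis using dist m n by (auto simp: contract_def contract_dots_def contract_factor_def fun_eq_iff)
  next
    case 3
    then show ?thesis using dist m n by (auto simp: contract_def contract_dots_def contract_factor_def fun_eq_iff)
  next
    \<comment> \<open>No two of the four points are mated, so eight distinct points are rewired;
      both sides are compared at each of them.\<close>
    case 4
    then have o: "f p \<noteq> q" "f p \<noteq> r" "f p \<noteq> s" "f q \<noteq> p" "f q \<noteq> r" "f q \<noteq> s"
      "f r \<noteq> p" "f r \<noteq> q" "f r \<noteq> s" "f s \<noteq> p" "f s \<noteq> q" "f s \<noteq> r"
      by auto
    note o' = o[symmetric] m(1-4)[symmetric]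
    note all = dist n m o o'
    show ?thesis
    proof (intro conjI ext)
      fix x
      consider "x = p" | "x = q" | "x = r" | "x = s" | "x = f p" | "x = f q" | "x = f r" | "x = f s"
        | "x \<noteq> p" "x \<noteq> q" "x \<noteq> r" "x \<noteq> s" "x \<noteq> f p" "x \<noteq> f q" "x \<noteq> f r" "x \<noteq> f s"
        by argo
      note cs = this
      show "contract (contract f p q) r s x = contract (contract f r s) p q x"
        using cs by cases (simp_all add: contract_def all)
      show "contract_dots (contract f p q) (contract_dots f \<delta> p q) r s x
         = contract_dots (contract f r s) (contract_dots f \<delta> r s) p q x"
        using cs by cases (simp_all add: contract_def contract_dots_def all)
    qed (simp add: contract_def contract_dots_def contract_factor_def all)
  next
    case 5
    then show ?thesis using dist m by (auto simp: contract_def contract_dots_def contract_factor_def fun_eq_iff)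
  next
    case 6
    then show ?thesis using dist m by (auto simp: contract_def contract_dots_def contract_factor_def fun_eq_iff)
  next
    case 7
    then show ?thesis using dist m n by (auto simp: contract_def contract_dots_def contract_factor_def fun_eq_iff)
  next
    case 8
    then show ?thesis using dist m n by (auto simp: contract_def contract_dots_def contract_factor_def fun_eq_iff)
  next
    case 9
    then show ?thesis using dist m n by (auto simp: contract_def contract_dots_def contract_factor_def fun_eq_iff)
  next
    case 10
    then show ?thesis using dist m n by (auto simp: contract_def contract_dots_def contract_factor_def fun_eq_iff)
  qed
  then show "contract (contract f p q) r s = contract (contract f r s) p q"
    and "contract_dots (contract f p q) (contract_dots f \<delta> p q) r s
       = contract_dots (contract f r s) (contract_dots f \<delta> r s) p q"
    and "contract_factor f \<delta> p q * contract_factor (contract f p q) (contract_dots f \<delta> p q) r s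
       = contract_factor f \<delta> r s * contract_factor (contract f r s) (contract_dots f \<delta> r s) p q"
    by blast+
qed

section \<open>Generators as operators on functions of diagrams\<close>

lemma mating_point:
  assumes "mating n f \<delta>" "x \<in> points n"
  shows "f x \<in> points n" "f x \<noteq> x" "f (f x) = x" "\<delta> (f x) = \<delta> x"
  using assms by (auto simp: mating_def)

definition dotted_matching :: "nat \<Rightarrow> diagram \<Rightarrow> bool" where
  "dotted_matching n D \<longleftrightarrow> (\<exists>f \<delta>. mating n f \<delta> \<and> D = mate_diagram n f \<delta>)"

text \<open>The transpose of left multiplication by e_i: a test function is pulled back along D
  \<mapsto> e_i D. Composition reverses the letters, so
  \<open>gen_op n i (gen_op n j \<phi>)\<close> evaluates \<phi> at e_j e_i D.\<close>

definition gen_op :: "nat \<Rightarrow> nat \<Rightarrow> (diagram \<Rightarrow> qs_field) \<Rightarrow> diagram \<Rightarrow> qs_field" where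
  "gen_op n i \<phi> D = stack_factor (gen_diagram n i) D * \<phi> (stack (gen_diagram n i) D)"

lemma gen_op_pos:
  assumes "mating n f \<delta>" "1 \<le> i" "i < n"
  shows "gen_op n i \<phi> (mate_diagram n f \<delta>) = contract_factor f \<delta> (Top i) (Top (i + 1)) *
    \<phi> (mate_diagram n (contract f (Top i) (Top (i + 1))) (contract_dots f \<delta> (Top i) (Top (i + 1))))"
  using stack_gen[OF assms] stack_factor_gen[OF assms] by (simp add: gen_op_def)

lemma gen_op_0:
  assumes "mating n f \<delta>" "1 \<le> n"
  shows "gen_op n 0 \<phi> (mate_diagram n f \<delta>) = (if \<delta> (Top 1) then - qnum_s 1 else 1) *
    \<phi> (mate_diagram n f (\<delta>(Top 1 := True, f (Top 1) := True)))"
  using stack_gen0[OF assms] stack_factor_gen0[OF assms] by (simp add: gen_op_def)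

lemma contract_mating_Top:
  assumes "mating n f \<delta>" "1 \<le> i" "i < n"
  shows "mating n (contract f (Top i) (Top (i + 1))) (contract_dots f \<delta> (Top i) (Top (i + 1)))"
  using assms by (intro contract_mating) auto

lemma dot_mating:
  assumes "mating n f \<delta>" "1 \<le> n"
  shows "mating n f (\<delta>(Top 1 := True, f (Top 1) := True))"
proof -
  have "Top 1 \<in> points n" using assms by simp
  note t = mating_point[OF assms(1) this]
  show ?thesis
    unfolding mating_def
  proof (intro ballI conjI)
    fix x assume x: "x \<in> points n"
    show "f x \<in> points n" "f x \<noteq> x" "f (f x) = x" by (rule mating_point[OF assms(1) x])+
    have "f x = Top 1 \<longleftrightarrow> x = f (Top 1)" "f x = f (Top 1) \<longleftrightarrow> x = Top 1"
      using t mating_point[OF assms(1) x] by metis+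
    then show "(\<delta>(Top 1 := True, f (Top 1) := True)) (f x) = (\<delta>(Top 1 := True, f (Top 1) := True)) x"
      using mating_point(4)[OF assms(1) x] t by auto
  qed
qed

lemma dotted_matching_gen:
  assumes "dotted_matching n D" "i < n"
  shows "dotted_matching n (stack (gen_diagram n i) D)"
proof -
  obtain f \<delta> where m: "mating n f \<delta>" "D = mate_diagram n f \<delta>"
    using assms(1) by (auto simp: dotted_matching_def)
  show ?thesis
  proof (cases "i = 0")
    case True
    then show ?thesis
      using stack_gen0[OF m(1)] dot_mating[OF m(1)] assms(2) m(2) unfolding dotted_matching_def
      by (metis One_nat_def Suc_leI)
  next
    case False
    then show ?thesis
      using stack_gen[OF m(1), of i] contract_mating_Top[OF m(1), of i] assms(2) m(2)
      unfolding dotted_matching_def by (metis One_nat_def Suc_leI neq0_conv)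
  qed
qed

lemma contract_arc:
  assumes "p \<noteq> q"
  shows "contract f p q p = q" "contract f p q q = p"
    "\<not> contract_dots f \<delta> p q p" "\<not> contract_dots f \<delta> p q q"
  using assms by (simp_all add: contract_def contract_dots_def)

lemma gen_op_sq:
  assumes D: "dotted_matching n D" and i: "1 \<le> i" "i < n"
  shows "gen_op n i (gen_op n i \<phi>) D = - qnum 2 * gen_op n i \<phi> D"
proof -
  obtain f \<delta> where m: "mating n f \<delta>" "D = mate_diagram n f \<delta>"
    using D by (auto simp: dotted_matching_def)
  let ?p = "Top i" and ?q = "Top (i + 1)"
  have "?p \<noteq> ?q" by simp
  note c = contract_idem[OF contract_arc(1,2)[OF this, of f] contract_arc(3,4)[OF this, of f \<delta>] this]
  show ?thesis
    unfolding m(2) gen_op_pos[OF m(1) i] gen_op_pos[OF contract_mating_Top[OF m(1) i] i]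
    by (simp only: c mult_ac)
qed

text \<open>After the first e_i its two top points form an undotted arc, which is the situation of
  \<open>contract_braid\<close>. The neighbours j = i + 1 and j = i - 1 differ in the end of this
  arc that the middle contraction uses.\<close>

lemma gen_op_braid:
  assumes D: "dotted_matching n D" and i: "1 \<le> i" "i < n" and j: "1 \<le> j" "j < n" and ij: "j = i + 1 \<or> i = j + 1"
  shows "gen_op n i (gen_op n j (gen_op n i \<phi>)) D = gen_op n i \<phi> D"
proof -
  obtain f \<delta> where m: "mating n f \<delta>" "D = mate_diagram n f \<delta>"
    using D by (auto simp: dotted_matching_def)
  define g where "g = contract f (Top i) (Top (i + 1))"
  define \<epsilon> where "\<epsilon> = contract_dots f \<delta> (Top i) (Top (i + 1))"
  have m': "mating n g \<epsilon>" unfolding g_def \<epsilon>_def by (rule contract_mating_Top[OF m(1) i])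
  have arc: "g (Top i) = Top (i + 1)" "g (Top (i + 1)) = Top i" "\<not> \<epsilon> (Top i)" "\<not> \<epsilon> (Top (i + 1))"
    unfolding g_def \<epsilon>_def by (intro contract_arc, simp)+
  have main: "gen_op n j (gen_op n i \<phi>) (mate_diagram n g \<epsilon>) = \<phi> (mate_diagram n g \<epsilon>)"
    using ij
  proof
    assume j': "j = i + 1"
    let ?p = "Top i" and ?q = "Top (i + 1)" and ?r = "Top (i + 2)"
    have r: "?r \<in> points n" "?q \<in> points n" "?p \<in> points n" using i j j' by auto
    note b = contract_braid[of g ?p ?q \<epsilon> ?r, OF arc _ _ _ mating_point(3,2,4)[OF m' r(1)]]
    let ?g = "contract g ?q ?r" and ?e = "contract_dots g \<epsilon> ?q ?r"
    have mm: "mating n ?g ?e" using contract_mating_Top[OF m' j] by (simp add: j')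
    have s: "contract ?g ?p ?q = contract ?g ?q ?p" "contract_dots ?g ?e ?p ?q = contract_dots ?g ?e ?q ?p"
      "contract_factor ?g ?e ?p ?q = contract_factor ?g ?e ?q ?p"
    proof -
      have "?g ?p \<noteq> ?g ?q" using mating_point(3)[OF mm r(2)] mating_point(3)[OF mm r(3)] by auto
      note c = contract_sym[of ?g ?p ?q ?e, OF this _ mating_point(2)[OF mm r(3)] mating_point(2)[OF mm r(2)]
          mating_point(3)[OF mm r(3)] mating_point(3)[OF mm r(2)] mating_point(4)[OF mm r(3)]]
      show "contract ?g ?p ?q = contract ?g ?q ?p" "contract_dots ?g ?e ?p ?q = contract_dots ?g ?e ?q ?p"
      "contract_factor ?g ?e ?p ?q = contract_factor ?g ?e ?q ?p" by (rule c, simp)+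
    qed
    have "gen_op n j (gen_op n i \<phi>) (mate_diagram n g \<epsilon>) =
      contract_factor g \<epsilon> ?q ?r * (contract_factor ?g ?e ?p ?q *
       \<phi> (mate_diagram n (contract ?g ?p ?q) (contract_dots ?g ?e ?p ?q)))"
      using gen_op_pos[OF m' j] gen_op_pos[OF mm i] by (simp add: j')
    then show ?thesis unfolding s using b by (simp add: mult.assoc[symmetric])
  next
    assume i': "i = j + 1"
    let ?r = "Top j" and ?q = "Top (j + 1)" and ?p = "Top (j + 2)"
    have r: "?r \<in> points n" "?q \<in> points n" using j by auto
    have arc': "g ?p = ?q" "g ?q = ?p" "\<not> \<epsilon> ?p" "\<not> \<epsilon> ?q" using arc i' by auto
    note b = contract_braid[of g ?p ?q \<epsilon> ?r, OF arc' _ _ _ mating_point(3,2,4)[OF m' r(1)]]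
    let ?g = "contract g ?q ?r" and ?e = "contract_dots g \<epsilon> ?q ?r"
    have s: "contract g ?r ?q = ?g" "contract_dots g \<epsilon> ?r ?q = ?e"
      "contract_factor g \<epsilon> ?r ?q = contract_factor g \<epsilon> ?q ?r"
    proof -
      have "g ?r \<noteq> g ?q" using mating_point(3)[OF m' r(2)] mating_point(3)[OF m' r(1)] by auto
      note c = contract_sym[of g ?r ?q \<epsilon>, OF this _ mating_point(2)[OF m' r(1)] mating_point(2)[OF m' r(2)]
          mating_point(3)[OF m' r(1)] mating_point(3)[OF m' r(2)] mating_point(4)[OF m' r(1)]]
      show "contract g ?r ?q = ?g" "contract_dots g \<epsilon> ?r ?q = ?e"
      "contract_factor g \<epsilon> ?r ?q = contract_factor g \<epsilon> ?q ?r" by (rule c, simp)+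
    qed
    have mm: "mating n ?g ?e" using contract_mating_Top[OF m' j] by (simp add: s[simplified])
    have "gen_op n j (gen_op n i \<phi>) (mate_diagram n g \<epsilon>) =
      contract_factor g \<epsilon> ?r ?q * (contract_factor ?g ?e ?q ?p *
       \<phi> (mate_diagram n (contract ?g ?q ?p) (contract_dots ?g ?e ?q ?p)))"
      using gen_op_pos[OF m' j] gen_op_pos[OF mm i] by (simp add: i' s[simplified])
    then show ?thesis unfolding s using b by (simp add: mult.assoc[symmetric])
  qed
  show ?thesis
    unfolding m(2) gen_op_pos[OF m(1) i] g_def[symmetric] \<epsilon>_def[symmetric] main ..
qed

lemma gen_op_commute:
  assumes D: "dotted_matching n D" and i: "1 \<le> i" "i < n" and j: "1 \<le> j" "j < n" and ij: "\<bar>int i - int j\<bar> > 1"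
  shows "gen_op n i (gen_op n j \<phi>) D = gen_op n j (gen_op n i \<phi>) D"
proof -
  obtain f \<delta> where m: "mating n f \<delta>" "D = mate_diagram n f \<delta>"
    using D by (auto simp: dotted_matching_def)
  let ?p = "Top i" and ?q = "Top (i + 1)" and ?r = "Top j" and ?s = "Top (j + 1)"
  have dist: "distinct [?p, ?q, ?r, ?s]" using ij by auto
  have pts: "x \<in> points n" if "x \<in> {?p, ?q, ?r, ?s}" for x using that i j by auto
  have c1: "x = y" if "x \<in> {?p, ?q, ?r, ?s}" "y \<in> {?p, ?q, ?r, ?s}" "f x = f y" for x y
  proof -
    have "f (f x) = f (f y)" using that(3) by (rule arg_cong)
    then show ?thesis
      by (simp only: mating_point(3)[OF m(1) pts[OF that(1)]] mating_point(3)[OF m(1) pts[OF that(2)]])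
  qed
  have c2: "f x \<noteq> x \<and> f (f x) = x \<and> \<delta> (f x) = \<delta> x" if "x \<in> {?p, ?q, ?r, ?s}" for x
    using mating_point[OF m(1) pts[OF that]] by simp
  note c = contract_commute[OF dist c1 c2]
  have L: "gen_op n i (gen_op n j \<phi>) D = (contract_factor f \<delta> ?p ?q * contract_factor (contract f ?p ?q) (contract_dots f \<delta> ?p ?q) ?r ?s)
    * \<phi> (mate_diagram n (contract (contract f ?p ?q) ?r ?s) (contract_dots (contract f ?p ?q) (contract_dots f \<delta> ?p ?q) ?r ?s))"
    unfolding m(2) gen_op_pos[OF m(1) i] gen_op_pos[OF contract_mating_Top[OF m(1) i] j] by (simp only: mult.assoc)
  have R: "gen_op n j (gen_op n i \<phi>) D = (contract_factor f \<delta> ?r ?s * contract_factor (contract f ?r ?s) (contract_dots f \<delta> ?r ?s) ?p ?q)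
    * \<phi> (mate_diagram n (contract (contract f ?r ?s) ?p ?q) (contract_dots (contract f ?r ?s) (contract_dots f \<delta> ?r ?s) ?p ?q))"
    unfolding m(2) gen_op_pos[OF m(1) j] gen_op_pos[OF contract_mating_Top[OF m(1) j] i] by (simp only: mult.assoc)
  show ?thesis unfolding L R by (simp only: c)
qed

lemma gen_op_sq0:
  assumes D: "dotted_matching n D" and n: "1 \<le> n"
  shows "gen_op n 0 (gen_op n 0 \<phi>) D = - qnum_s 1 * gen_op n 0 \<phi> D"
proof -
  obtain f \<delta> where m: "mating n f \<delta>" "D = mate_diagram n f \<delta>"
    using D by (auto simp: dotted_matching_def)
  show ?thesis
    unfolding m(2) gen_op_0[OF m(1) n] gen_op_0[OF dot_mating[OF m(1) n] n]
    by simp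
qed

text \<open>The small arc made by the first e_1 receives the dot of e_0, and the second e_1 closes
  it to a dotted loop.\<close>

lemma gen_op_braid0:
  assumes D: "dotted_matching n D" and n: "2 \<le> n"
  shows "gen_op n 1 (gen_op n 0 (gen_op n 1 \<phi>)) D = dotted_loop * gen_op n 1 \<phi> D"
proof -
  obtain f \<delta> where m: "mating n f \<delta>" "D = mate_diagram n f \<delta>"
    using D by (auto simp: dotted_matching_def)
  have n': "1 \<le> n" "(1::nat) \<le> 1" "1 < n" using n by auto
  let ?p = "Top 1" and ?q = "Top (1 + 1)"
  define g where "g = contract f ?p ?q"
  define \<epsilon> where "\<epsilon> = contract_dots f \<delta> ?p ?q"
  have m': "mating n g \<epsilon>" unfolding g_def \<epsilon>_def by (rule contract_mating_Top[OF m(1) n'(2,3)])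
  have arc: "g ?p = ?q" "g ?q = ?p" "\<not> \<epsilon> ?p" "\<not> \<epsilon> ?q"
    unfolding g_def \<epsilon>_def by (intro contract_arc, simp)+
  let ?e = "\<epsilon>(?p := True, ?q := True)"
  have mm: "mating n g ?e" using dot_mating[OF m' n'(1)] unfolding arc .
  have "contract g ?p ?q = g" "contract_dots g ?e ?p ?q = \<epsilon>" "contract_factor g ?e ?p ?q = dotted_loop"
    using arc by (auto simp: contract_def contract_dots_def contract_factor_def fun_eq_iff)
  then have "gen_op n 0 (gen_op n 1 \<phi>) (mate_diagram n g \<epsilon>) = dotted_loop * \<phi> (mate_diagram n g \<epsilon>)"
    unfolding gen_op_0[OF m' n'(1)] unfolding arc(1) gen_op_pos[OF mm n'(2,3)] using arc(3) by simp
  then show ?thesis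
    unfolding m(2) gen_op_pos[OF m(1) n'(2,3)] g_def[symmetric] \<epsilon>_def[symmetric] by (simp only: mult_ac)
qed

text \<open>Here t is \<open>Top 1\<close>, away from p and q. The contraction may carry the arc of
  t along, which is why the dot is set at the new mate of t on one side and at the old mate on the
  other.\<close>

lemma contract_dot_commute:
  assumes "t \<notin> {p, q}" "p \<noteq> q" and f: "\<And>x. x \<in> {p, q, t} \<Longrightarrow> f x \<noteq> x \<and> f (f x) = x \<and> \<delta> (f x) = \<delta> x"
  defines "\<epsilon> \<equiv> \<delta>(t := True, f t := True)"
  shows "(contract_dots f \<delta> p q)(t := True, contract f p q t := True) = contract_dots f \<epsilon> p q"
    and "contract_factor f \<delta> p q * (if contract_dots f \<delta> p q t then - qnum_s 1 else 1)
      = (if \<delta> t then - qnum_s 1 else 1) * contract_factor f \<epsilon> p q"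
proof -
  have d: "t \<noteq> p" "t \<noteq> q" "p \<noteq> t" "q \<noteq> t" "p \<noteq> q" "q \<noteq> p" using assms by auto
  have m: "f p \<noteq> p" "f q \<noteq> q" "f t \<noteq> t" "f (f p) = p" "f (f q) = q" "f (f t) = t"
     "\<delta> (f p) = \<delta> p" "\<delta> (f q) = \<delta> q" "\<delta> (f t) = \<delta> t"
    using f by simp_all
  have n: "f p \<noteq> f q" "f p \<noteq> f t" "f q \<noteq> f t" using m d by metis+
  have "(contract_dots f \<delta> p q)(t := True, contract f p q t := True) = contract_dots f \<epsilon> p q \<and>
     contract_factor f \<delta> p q * (if contract_dots f \<delta> p q t then - qnum_s 1 else 1)
      = (if \<delta> t then - qnum_s 1 else 1) * contract_factor f \<epsilon> p q"
  proof -
    consider "f p = q" "f q = p" "f t \<noteq> p" "f t \<noteq> q" | "f p = t" "f t = p" "f q \<noteq> p" "f q \<noteq> t"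
      | "f q = t" "f t = q" "f p \<noteq> q" "f p \<noteq> t"
      | "f p \<noteq> q" "f p \<noteq> t" "f q \<noteq> p" "f q \<noteq> t" "f t \<noteq> p" "f t \<noteq> q"
      using m d by metis
    then show ?thesis
    proof cases
      case 1
      then show ?thesis using d m n by (auto simp: \<epsilon>_def contract_def contract_dots_def contract_factor_def fun_eq_iff)
    next
      case 2
      then show ?thesis using d m n by (auto simp: \<epsilon>_def contract_def contract_dots_def contract_factor_def fun_eq_iff)
    next
      case 3
      then show ?thesis using d m n by (auto simp: \<epsilon>_def contract_def contract_dots_def contract_factor_def fun_eq_iff)
    next
      case 4
      then show ?thesis using d m n by (auto simp: \<epsilon>_def contract_def contract_dots_def contract_factor_def fun_eq_iff)
    qed
  qed
  then show "(contract_dots f \<delta> p q)(t := True, contract f p q t := True) = contract_dots f \<epsilon> p q"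
    and "contract_factor f \<delta> p q * (if contract_dots f \<delta> p q t then - qnum_s 1 else 1)
      = (if \<delta> t then - qnum_s 1 else 1) * contract_factor f \<epsilon> p q"
    by simp_all
qed

lemma gen_op_commute0:
  assumes D: "dotted_matching n D" and i: "2 \<le> i" "i < n"
  shows "gen_op n 0 (gen_op n i \<phi>) D = gen_op n i (gen_op n 0 \<phi>) D"
proof -
  obtain f \<delta> where m: "mating n f \<delta>" "D = mate_diagram n f \<delta>"
    using D by (auto simp: dotted_matching_def)
  have n': "1 \<le> n" "1 \<le> i" using i by auto
  let ?p = "Top i" and ?q = "Top (i + 1)" and ?t = "Top 1"
  let ?e = "\<delta>(?t := True, f ?t := True)"
  have pts: "x \<in> points n" if "x \<in> {?p, ?q, ?t}" for x using that i by auto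
  have c2: "f x \<noteq> x \<and> f (f x) = x \<and> \<delta> (f x) = \<delta> x" if "x \<in> {?p, ?q, ?t}" for x
    using mating_point[OF m(1) pts[OF that]] by simp
  have dist: "?t \<notin> {?p, ?q}" "?p \<noteq> ?q" using i by auto
  note c = contract_dot_commute[of ?t ?p ?q f \<delta>, OF dist c2]
  have L: "gen_op n 0 (gen_op n i \<phi>) D = ((if \<delta> ?t then - qnum_s 1 else 1) * contract_factor f ?e ?p ?q)
    * \<phi> (mate_diagram n (contract f ?p ?q) (contract_dots f ?e ?p ?q))"
    unfolding m(2) gen_op_0[OF m(1) n'(1)] gen_op_pos[OF dot_mating[OF m(1) n'(1)] n'(2) i(2)] by (simp only: mult.assoc)
  have R: "gen_op n i (gen_op n 0 \<phi>) D = (contract_factor f \<delta> ?p ?q * (if contract_dots f \<delta> ?p ?q ?t then - qnum_s 1 else 1))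
    * \<phi> (mate_diagram n (contract f ?p ?q) ((contract_dots f \<delta> ?p ?q)(?t := True, contract f ?p ?q ?t := True)))"
    unfolding m(2) gen_op_pos[OF m(1) n'(2) i(2)] gen_op_0[OF contract_mating_Top[OF m(1) n'(2) i(2)] n'(1)]
    by (simp only: mult.assoc)
  show ?thesis unfolding L R by (simp only: c)
qed

section \<open>Coefficients do not depend on the representative\<close>

lemma dotted_matching_id: "dotted_matching n (id_diagram n)"
proof -
  define f where "f = (\<lambda>x. case x of Top k \<Rightarrow> Bot k | Bot k \<Rightarrow> Top k)"
  have "mating n f (\<lambda>_. False)"
    by (auto simp: mating_def f_def split: point.splits)
  moreover have "id_diagram n = mate_diagram n f (\<lambda>_. False)"
  proof -
    have "(\<lambda>x. {x, f x}) ` points n = (\<lambda>k. {Top k, Bot k}) ` {1..n}"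
      unfolding points_def image_Un image_image f_def by (simp add: insert_commute)
    then show ?thesis by (simp add: id_diagram_def mate_diagram_def)
  qed
  ultimately show ?thesis unfolding dotted_matching_def by blast
qed

lemma dotted_matching_word: "set u \<subseteq> {..<n} \<Longrightarrow> dotted_matching n (word_diagram n u)"
  by (induction u) (simp_all add: dotted_matching_id dotted_matching_gen)

text \<open>A function \<phi> on diagrams, extended linearly to the free algebra by evaluating words
  as diagrams. Keeping \<phi> arbitrary allows letters to be moved from the element to the test
  function (\<open>diag_sum_gen\<close>); the indicator function of a diagram recovers
  \<open>rep_coeff\<close>.\<close>

definition diag_sum :: "nat \<Rightarrow> free_alg \<Rightarrow> (diagram \<Rightarrow> qs_field) \<Rightarrow> qs_field" where
  "diag_sum n x \<phi> = (\<Sum>w \<in> Poly_Mapping.keys x.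
     Poly_Mapping.lookup x w * word_factor n (letters w) * \<phi> (word_diagram n (letters w)))"

lemma diag_sum_superset:
  assumes "finite S" "Poly_Mapping.keys x \<subseteq> S"
  shows "diag_sum n x \<phi> = (\<Sum>w \<in> S.
     Poly_Mapping.lookup x w * word_factor n (letters w) * \<phi> (word_diagram n (letters w)))"
  unfolding diag_sum_def using assms
  by (intro sum.mono_neutral_left) (auto simp: in_keys_iff)

lemma diag_sum_add: "diag_sum n (x + y) \<phi> = diag_sum n x \<phi> + diag_sum n y \<phi>"
proof -
  let ?S = "Poly_Mapping.keys x \<union> Poly_Mapping.keys y"
  have S: "finite ?S" by simp
  show ?thesis
    using diag_sum_superset[OF S, of "x + y"] diag_sum_superset[OF S, of x] diag_sum_superset[OF S, of y]
      Poly_Mapping.keys_add[of x y]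
    by (simp add: lookup_add distrib_right sum.distrib)
qed

lemma diag_sum_0: "diag_sum n 0 \<phi> = 0"
  by (simp add: diag_sum_def)

lemma diag_sum_single:
  "diag_sum n (Poly_Mapping.single w c) \<phi> = c * word_factor n (letters w) * \<phi> (word_diagram n (letters w))"
  using diag_sum_superset[of "{w}" "Poly_Mapping.single w c" n \<phi>] by simp

lemma diag_sum_scal: "diag_sum n (scal c * x) \<phi> = c * diag_sum n x \<phi>"
proof (induction x rule: poly_mapping_single_induct)
  case (add w d x)
  have "scal c * Poly_Mapping.single w d = Poly_Mapping.single w (c * d)"
    by (simp add: scal_def mult_single)
  with add.IH show ?case by (simp add: distrib_left diag_sum_add diag_sum_single)
qed (simp add: diag_sum_0)

lemma diag_sum_diff: "diag_sum n (x - y) \<phi> = diag_sum n x \<phi> - diag_sum n y \<phi>"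
proof -
  have "x - y = x + scal (- 1) * y" by (simp add: scal_uminus scal_1)
  then show ?thesis by (simp only: diag_sum_add diag_sum_scal) simp
qed

lemma diag_sum_gen: "diag_sum n (gen i * x) \<phi> = diag_sum n x (gen_op n i \<phi>)"
proof (induction x rule: poly_mapping_single_induct)
  case (add w d x)
  have "gen i * Poly_Mapping.single w d = Poly_Mapping.single (Word (i # letters w)) d"
    by (cases w) (simp add: gen_def single_mult_Word)
  with add.IH show ?case by (simp add: distrib_left diag_sum_add diag_sum_single gen_op_def mult_ac)
qed (simp add: diag_sum_0)

lemma diag_sum_cong:
  assumes "x \<in> free_on n" "\<And>D. dotted_matching n D \<Longrightarrow> \<phi> D = \<psi> D"
  shows "diag_sum n x \<phi> = diag_sum n x \<psi>"
  unfolding diag_sum_def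
proof (rule sum.cong[OF refl])
  fix w assume "w \<in> Poly_Mapping.keys x"
  then have "set (letters w) \<subseteq> {..<n}" using assms(1) by (simp add: free_on_def)
  then show "Poly_Mapping.lookup x w * word_factor n (letters w) * \<phi> (word_diagram n (letters w)) =
      Poly_Mapping.lookup x w * word_factor n (letters w) * \<psi> (word_diagram n (letters w))"
    using assms(2)[OF dotted_matching_word] by simp
qed

lemma diag_sum_cmult: "diag_sum n x (\<lambda>D. c * \<phi> D) = c * diag_sum n x \<phi>"
  by (simp add: diag_sum_def sum_distrib_left mult_ac)

text \<open>Each letter of a is moved into the test function, so the hypothesis has to hold for all
  \<phi> and not just for the one in the conclusion.\<close>

lemma diag_sum_mult_zero:
  assumes "\<And>\<phi>. diag_sum n y \<phi> = 0"
  shows "diag_sum n (a * y) \<phi> = 0"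
proof (induction a rule: poly_mapping_single_induct)
  case (add w c a)
  have "diag_sum n (Poly_Mapping.single (Word u) c * y) \<phi> = 0" for u \<phi>
  proof (induction u arbitrary: \<phi>)
    case Nil
    then show ?case using assms diag_sum_scal[of n c y] by (simp add: scal_def zero_word_def)
  next
    case (Cons i u)
    have "Poly_Mapping.single (Word (i # u)) c = gen i * Poly_Mapping.single (Word u) c"
      by (simp add: gen_def single_mult_Word)
    then show ?case using Cons by (simp add: mult.assoc diag_sum_gen)
  qed
  from this[of "letters w"] add.IH show ?case by (simp add: distrib_right diag_sum_add)
qed (simp add: diag_sum_0)

lemma diag_sum_relator:
  assumes r: "r \<in> TLB_relators n" and b: "b \<in> free_on n"
  shows "diag_sum n (r * b) \<phi> = 0"
proof -
  consider (sq) i where "r = gen i * gen i + scal (qnum 2) * gen i" "1 \<le> i" "i < n"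
    | (braid) i j where "r = gen i * gen j * gen i - gen i" "1 \<le> i" "i < n" "1 \<le> j" "j < n" "j = i + 1 \<or> i = j + 1"
    | (comm) i j where "r = gen i * gen j - gen j * gen i" "1 \<le> i" "i < n" "1 \<le> j" "j < n" "\<bar>int i - int j\<bar> > 1"
    | (sq0) "r = gen 0 * gen 0 + scal (qnum_s 1) * gen 0" "1 \<le> n"
    | (braid0) "r = gen 1 * gen 0 * gen 1 - scal dotted_loop * gen 1" "2 \<le> n"
    | (comm0) i where "r = gen 0 * gen i - gen i * gen 0" "2 \<le> i" "i < n"
    using r unfolding TLB_relators_def Un_iff mem_Collect_eq by blast
  then show ?thesis
  proof cases
    case (sq i)
    have "diag_sum n (r * b) \<phi> = diag_sum n b (gen_op n i (gen_op n i \<phi>)) + qnum 2 * diag_sum n b (gen_op n i \<phi>)"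
      unfolding sq(1) by (simp only: distrib_right mult.assoc diag_sum_add diag_sum_scal diag_sum_gen)
    also have "diag_sum n b (gen_op n i (gen_op n i \<phi>)) = diag_sum n b (\<lambda>D. - qnum 2 * gen_op n i \<phi> D)"
      using sq by (intro diag_sum_cong b gen_op_sq)
    finally show ?thesis by (simp only: diag_sum_cmult) simp
  next
    case (braid i j)
    have "diag_sum n (r * b) \<phi> = diag_sum n b (gen_op n i (gen_op n j (gen_op n i \<phi>))) - diag_sum n b (gen_op n i \<phi>)"
      unfolding braid(1) by (simp only: left_diff_distrib mult.assoc diag_sum_diff diag_sum_gen)
    also have "diag_sum n b (gen_op n i (gen_op n j (gen_op n i \<phi>))) = diag_sum n b (gen_op n i \<phi>)"
      using braid by (intro diag_sum_cong b gen_op_braid)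
    finally show ?thesis by simp
  next
    case (comm i j)
    have "diag_sum n (r * b) \<phi> = diag_sum n b (gen_op n j (gen_op n i \<phi>)) - diag_sum n b (gen_op n i (gen_op n j \<phi>))"
      unfolding comm(1) by (simp only: left_diff_distrib mult.assoc diag_sum_diff diag_sum_gen)
    also have "diag_sum n b (gen_op n j (gen_op n i \<phi>)) = diag_sum n b (gen_op n i (gen_op n j \<phi>))"
      using comm by (intro diag_sum_cong b gen_op_commute) auto
    finally show ?thesis by simp
  next
    case sq0
    have "diag_sum n (r * b) \<phi> = diag_sum n b (gen_op n 0 (gen_op n 0 \<phi>)) + qnum_s 1 * diag_sum n b (gen_op n 0 \<phi>)"
      unfolding sq0(1) by (simp only: distrib_right mult.assoc diag_sum_add diag_sum_scal diag_sum_gen)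
    also have "diag_sum n b (gen_op n 0 (gen_op n 0 \<phi>)) = diag_sum n b (\<lambda>D. - qnum_s 1 * gen_op n 0 \<phi> D)"
      using sq0 by (intro diag_sum_cong b gen_op_sq0)
    finally show ?thesis by (simp only: diag_sum_cmult) simp
  next
    case braid0
    have "diag_sum n (r * b) \<phi> = diag_sum n b (gen_op n 1 (gen_op n 0 (gen_op n 1 \<phi>))) - dotted_loop * diag_sum n b (gen_op n 1 \<phi>)"
      unfolding braid0(1) by (simp only: left_diff_distrib mult.assoc diag_sum_diff diag_sum_gen diag_sum_scal)
    also have "diag_sum n b (gen_op n 1 (gen_op n 0 (gen_op n 1 \<phi>))) = diag_sum n b (\<lambda>D. dotted_loop * gen_op n 1 \<phi> D)"
      using braid0 by (intro diag_sum_cong b gen_op_braid0)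
    finally show ?thesis by (simp only: diag_sum_cmult) simp
  next
    case (comm0 i)
    have "diag_sum n (r * b) \<phi> = diag_sum n b (gen_op n i (gen_op n 0 \<phi>)) - diag_sum n b (gen_op n 0 (gen_op n i \<phi>))"
      unfolding comm0(1) by (simp only: left_diff_distrib mult.assoc diag_sum_diff diag_sum_gen)
    also have "diag_sum n b (gen_op n 0 (gen_op n i \<phi>)) = diag_sum n b (gen_op n i (gen_op n 0 \<phi>))"
      using comm0 by (intro diag_sum_cong b gen_op_commute0)
    finally show ?thesis by simp
  qed
qed

text \<open>With an arbitrary right factor b in the statement, the rule \<open>mult_right\<close>
  just replaces b by ab. A relator then acts on the diagrams of b, where the operator identities for
  \<open>gen_op\<close> apply.\<close>

lemma diag_sum_ideal_mult:
  assumes "x \<in> TLB_ideal n" "b \<in> free_on n"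
  shows "diag_sum n (x * b) \<phi> = 0"
  using assms
proof (induction arbitrary: b \<phi> rule: TLB_ideal.induct)
  case (mult_left x a)
  then show ?case by (simp add: mult.assoc diag_sum_mult_zero)
next
  case (mult_right x a)
  then show ?case by (simp add: mult.assoc mult_free)
qed (simp_all add: diag_sum_0 diag_sum_relator distrib_right diag_sum_add)

lemma diag_sum_tlb_cong:
  assumes "tlb_cong n x y"
  shows "diag_sum n x \<phi> = diag_sum n y \<phi>"
  using diag_sum_ideal_mult[of "x - y" n 1 \<phi>] assms one_free[of n]
  by (simp add: tlb_cong_def diag_sum_diff)

text \<open>The definite description has a value because all representatives agree by
  \<open>diag_sum_tlb_cong\<close> and \<open>Q_rep n\<close> is one of them.\<close>

lemma Coeff_B_eq: "Coeff_B n h = diag_sum n (Q_rep n) (\<lambda>D. if D = h then 1 else 0)"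
proof -
  let ?d = "\<lambda>D. if D = h then 1 else 0 :: qs_field"
  have rep: "rep_coeff n x h = diag_sum n x ?d" for x
    unfolding rep_coeff_def diag_sum_def by (intro sum.cong) auto
  have "rep_coeff n x h = diag_sum n (Q_rep n) ?d" if "x \<in> Q_elem n" for x
    using that unfolding rep Q_elem_def TLB_class_def
    by (intro diag_sum_tlb_cong) (simp add: tlb_cong_def)
  moreover have "Q_rep n \<in> Q_elem n"
    by (simp add: Q_elem_def TLB_class_def Q_rep_free TLB_ideal.zero)
  ultimately show ?thesis
    unfolding Coeff_B_def TLB_coeff_def by (intro the_equality) auto
qed

section \<open>Inserting a small arc\<close>

definition unfold_pos :: "nat \<Rightarrow> nat \<Rightarrow> point" where
  "unfold_pos n x = (if x \<le> n then Bot x else Top (2 * n + 1 - x))"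

definition shift :: "nat \<Rightarrow> nat \<Rightarrow> nat" where
  "shift p x = (if x < p then x else x + 2)"

definition unshift :: "nat \<Rightarrow> nat \<Rightarrow> nat" where
  "unshift p x = (if x < p then x else x - 2)"

definition relabel :: "nat \<Rightarrow> nat \<Rightarrow> point \<Rightarrow> point" where
  "relabel n p x = unfold_pos (n + 1) (shift p (fold_pos n x))"

definition new_arc :: "nat \<Rightarrow> nat \<Rightarrow> arc" where
  "new_arc n p = {unfold_pos (n + 1) p, unfold_pos (n + 1) (p + 1)}"

definition insert_arc :: "nat \<Rightarrow> nat \<Rightarrow> bool \<Rightarrow> diagram \<Rightarrow> diagram" where
  "insert_arc n p d D =
     (insert (new_arc n p) ((`) (relabel n p) ` arcs D),
      (if d then {new_arc n p} else {}) \<union> (`) (relabel n p) ` dotted D)"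

lemma shift_not_new: "shift p x \<noteq> p" "shift p x \<noteq> p + 1"
  by (auto simp: shift_def)

lemma unshift_shift: "unshift p (shift p x) = x"
  by (auto simp: unshift_def shift_def)

lemma fold_unfold: "1 \<le> x \<Longrightarrow> x \<le> 2 * n \<Longrightarrow> fold_pos n (unfold_pos n x) = x"
  by (auto simp: unfold_pos_def)

lemma unfold_fold: "y \<in> points n \<Longrightarrow> unfold_pos n (fold_pos n y) = y"
  by (cases y) (auto simp: unfold_pos_def)

lemma fold_pos_range: "y \<in> points n \<Longrightarrow> 1 \<le> fold_pos n y \<and> fold_pos n y \<le> 2 * n"
  by (cases y) auto

lemma unfold_pos_points: "1 \<le> x \<Longrightarrow> x \<le> 2 * n \<Longrightarrow> unfold_pos n x \<in> points n"
  by (auto simp: unfold_pos_def)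

lemma unfold_pos_inj: "1 \<le> x \<Longrightarrow> x \<le> 2 * n \<Longrightarrow> 1 \<le> y \<Longrightarrow> y \<le> 2 * n \<Longrightarrow>
    unfold_pos n x = unfold_pos n y \<longleftrightarrow> x = y"
  using fold_unfold by metis

lemma points_unfold: "points n = unfold_pos n ` {1..2 * n}"
proof
  show "points n \<subseteq> unfold_pos n ` {1..2 * n}"
    using unfold_fold fold_pos_range by (metis atLeastAtMost_iff image_eqI subsetI)
qed (auto simp: unfold_pos_points)

definition insert_mate :: "nat \<Rightarrow> nat \<Rightarrow> (point \<Rightarrow> point) \<Rightarrow> point \<Rightarrow> point" where
  "insert_mate n p f y = (let x = fold_pos (n + 1) y in
     if x = p then unfold_pos (n + 1) (p + 1) else if x = p + 1 then unfold_pos (n + 1) p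
     else relabel n p (f (unfold_pos n (unshift p x))))"

definition insert_dots :: "nat \<Rightarrow> nat \<Rightarrow> bool \<Rightarrow> (point \<Rightarrow> bool) \<Rightarrow> point \<Rightarrow> bool" where
  "insert_dots n p d \<delta> y = (let x = fold_pos (n + 1) y in
     if x \<in> {p, p + 1} then d else \<delta> (unfold_pos n (unshift p x)))"

context
  fixes n p :: nat and f :: "point \<Rightarrow> point" and \<delta> :: "point \<Rightarrow> bool"
  assumes m: "mating n f \<delta>" and p: "1 \<le> p" "p \<le> 2 * n + 1"
begin

lemma insert_mate_new:
  "insert_mate n p f (unfold_pos (n + 1) p) = unfold_pos (n + 1) (p + 1)"
  "insert_mate n p f (unfold_pos (n + 1) (p + 1)) = unfold_pos (n + 1) p"
  "insert_dots n p d \<delta> (unfold_pos (n + 1) p) = d"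
  "insert_dots n p d \<delta> (unfold_pos (n + 1) (p + 1)) = d"
  using fold_unfold[of p "n + 1"] fold_unfold[of "p + 1" "n + 1"] p
  by (simp_all add: insert_mate_def insert_dots_def)

lemma fold_relabel:
  assumes "y \<in> points n"
  shows "fold_pos (n + 1) (relabel n p y) = shift p (fold_pos n y)"
  using fold_pos_range[OF assms] unfolding relabel_def by (intro fold_unfold) (auto simp: shift_def)

lemma insert_mate_relabel:
  assumes "y \<in> points n"
  shows "insert_mate n p f (relabel n p y) = relabel n p (f y)"
    "insert_dots n p d \<delta> (relabel n p y) = \<delta> y"
  using shift_not_new[of p "fold_pos n y"]
  unfolding insert_mate_def insert_dots_def Let_def fold_relabel[OF assms]
  by (simp_all add: unshift_shift unfold_fold[OF assms])

lemma points_insert: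
  "points (n + 1) = insert (unfold_pos (n + 1) p) (insert (unfold_pos (n + 1) (p + 1)) (relabel n p ` points n))"
proof -
  have "{1..2 * (n + 1)} = insert p (insert (p + 1) (shift p ` {1..2 * n}))"
  proof
    show "{1..2 * (n + 1)} \<subseteq> insert p (insert (p + 1) (shift p ` {1..2 * n}))"
    proof
      fix x assume x: "x \<in> {1..2 * (n + 1)}"
      show "x \<in> insert p (insert (p + 1) (shift p ` {1..2 * n}))"
      proof (cases "x = p \<or> x = p + 1")
        case False
        then have "x = shift p (unshift p x)" "unshift p x \<in> {1..2 * n}"
          using x p by (auto simp: shift_def unshift_def)
        then show ?thesis by blast
      qed auto
    qed
  qed (use p in \<open>auto simp: shift_def\<close>)
  moreover have "relabel n p ` points n = unfold_pos (n + 1) ` shift p ` {1..2 * n}"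
    unfolding points_unfold[of n] image_image relabel_def by (intro image_cong refl) (simp add: fold_unfold)
  ultimately show ?thesis unfolding points_unfold[of "n + 1"] by simp
qed

lemma insert_mating: "mating (n + 1) (insert_mate n p f) (insert_dots n p d \<delta>)"
  unfolding mating_def
proof
  fix y assume "y \<in> points (n + 1)"
  then consider "y = unfold_pos (n + 1) p" | "y = unfold_pos (n + 1) (p + 1)"
    | z where "z \<in> points n" "y = relabel n p z"
    unfolding points_insert by blast
  then show "insert_mate n p f y \<in> points (n + 1) \<and> insert_mate n p f y \<noteq> y \<and>
      insert_mate n p f (insert_mate n p f y) = y \<and> insert_dots n p d \<delta> (insert_mate n p f y) = insert_dots n p d \<delta> y"
  proof cases
    case 1
    then show ?thesis
      unfolding 1 insert_mate_new points_insert using unfold_pos_inj[of p "n + 1" "p + 1"] p by simp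
  next
    case 2
    then show ?thesis
      unfolding 2 insert_mate_new points_insert using unfold_pos_inj[of p "n + 1" "p + 1"] p by simp
  next
    case (3 z)
    note f = mating_point[OF m 3(1)]
    have "relabel n p (f z) \<noteq> relabel n p z"
    proof
      assume "relabel n p (f z) = relabel n p z"
      then have "shift p (fold_pos n (f z)) = shift p (fold_pos n z)"
        using fold_relabel[OF f(1)] fold_relabel[OF 3(1)] by simp
      then have "fold_pos n (f z) = fold_pos n z" by (metis unshift_shift)
      then show False using f(2) unfold_fold[OF f(1)] unfold_fold[OF 3(1)] by simp
    qed
    then show ?thesis
      unfolding 3(2) insert_mate_relabel[OF 3(1)] insert_mate_relabel[OF f(1)] f(3,4) points_insert
      using f(1) by blast
  qed
qed

lemma insert_mate_diagram:
  "insert_arc n p d (mate_diagram n f \<delta>) = mate_diagram (n + 1) (insert_mate n p f) (insert_dots n p d \<delta>)"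
proof (rule prod_eqI)
  let ?f = "insert_mate n p f" and ?d = "insert_dots n p d \<delta>"
  let ?a = "unfold_pos (n + 1) p" and ?b = "unfold_pos (n + 1) (p + 1)"
  let ?g = "\<lambda>y. {y, ?f y}"
  have new: "?g ?a = new_arc n p" "?g ?b = new_arc n p"
    unfolding insert_mate_new new_arc_def by auto
  have old: "?g (relabel n p y) = relabel n p ` {y, f y}" if "y \<in> points n" for y
    using insert_mate_relabel[OF that] by simp
  have "?g ` points (n + 1) = insert (new_arc n p) (?g ` relabel n p ` points n)"
    unfolding points_insert image_insert new by simp
  also have "?g ` relabel n p ` points n = (`) (relabel n p) ` (\<lambda>y. {y, f y}) ` points n"
    unfolding image_image[of "(`) (relabel n p)"] image_image[of ?g] using old by (intro image_cong refl)
  finally show "fst (insert_arc n p d (mate_diagram n f \<delta>)) = fst (mate_diagram (n + 1) ?f ?d)"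
    by (simp only: insert_arc_def mate_diagram_def fst_conv)
  have "{y \<in> points (n + 1). ?d y} = (if d then {?a, ?b} else {}) \<union> relabel n p ` {y \<in> points n. \<delta> y}"
    unfolding points_insert using insert_mate_new(3,4) insert_mate_relabel(2) by auto
  then have "?g ` {y \<in> points (n + 1). ?d y} = ?g ` (if d then {?a, ?b} else {}) \<union> ?g ` relabel n p ` {y \<in> points n. \<delta> y}"
    by (simp only: image_Un)
  also have "?g ` relabel n p ` {y \<in> points n. \<delta> y} = (`) (relabel n p) ` (\<lambda>y. {y, f y}) ` {y \<in> points n. \<delta> y}"
    unfolding image_image[of "(`) (relabel n p)"] image_image[of ?g] using old by (intro image_cong refl) simp
  also have "?g ` (if d then {?a, ?b} else {}) = (if d then {new_arc n p} else {})"
    using new by auto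
  finally show "snd (insert_arc n p d (mate_diagram n f \<delta>)) = snd (mate_diagram (n + 1) ?f ?d)"
    by (simp only: insert_arc_def mate_diagram_def snd_conv)
qed

end

lemma mate_diagram_cong:
  assumes "\<And>y. y \<in> points n \<Longrightarrow> f y = g y" "\<And>y. y \<in> points n \<Longrightarrow> \<delta> y = \<epsilon> y"
  shows "mate_diagram n f \<delta> = mate_diagram n g \<epsilon>"
proof -
  have "{x \<in> points n. \<delta> x} = {x \<in> points n. \<epsilon> x}" using assms(2) by auto
  moreover have "(\<lambda>x. {x, f x}) ` A = (\<lambda>x. {x, g x}) ` A" if "A \<subseteq> points n" for A
    using assms(1) that by (intro image_cong refl) auto
  ultimately show ?thesis unfolding mate_diagram_def by auto
qed

lemma shift_Suc: "x \<noteq> p \<Longrightarrow> shift (p + 1) x = shift p x"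
  by (auto simp: shift_def)

text \<open>With k = 2n + 1 - p the points \<open>Top k\<close> and \<open>Top (k + 1)\<close> sit
  at the folded positions p + 2 and p + 1. Contracting them turns the small arc p, p + 1 into the
  small arc p + 1, p + 2 and hands the old mate of p + 2 over to p. So e_k moves the small arc one
  position to the right, with scalar 1.\<close>

lemma gen_op_insert:
  assumes D: "dotted_matching n D" and p: "n + 1 \<le> p" "p \<le> 2 * n"
  shows "gen_op (n + 1) (2 * n + 1 - p) \<phi> (insert_arc n p False D) = \<phi> (insert_arc n (p + 1) False D)"
proof -
  obtain f \<delta> where m: "mating n f \<delta>" "D = mate_diagram n f \<delta>"
    using D by (auto simp: dotted_matching_def)
  define k where "k = 2 * n + 1 - p"
  have k: "1 \<le> k" "k < n + 1" using p by (auto simp: k_def)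
  have p1: "1 \<le> p" "p \<le> 2 * n + 1" and p2: "1 \<le> p + 1" "p + 1 \<le> 2 * n + 1" using p by auto
  let ?u = "unfold_pos (n + 1)" and ?v = "unfold_pos n p"
  let ?f = "insert_mate n p f" and ?d = "insert_dots n p False \<delta>"
  let ?f' = "insert_mate n (p + 1) f" and ?d' = "insert_dots n (p + 1) False \<delta>"
  have tops: "Top k = ?u (p + 2)" "Top (k + 1) = ?u (p + 1)"
    using p by (auto simp: k_def unfold_pos_def)
  have inj: "?u p \<noteq> ?u (p + 1)" "?u p \<noteq> ?u (p + 2)" "?u (p + 1) \<noteq> ?u (p + 2)"
    using p unfold_pos_inj[of _ "n + 1"] by auto
  have v: "?v \<in> points n" "fold_pos n ?v = p"
    using p by (auto intro!: unfold_pos_points simp: fold_unfold)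
  note w = mating_point[OF m(1) v(1)]
  \<comment> \<open>The old point at position p is the only one that the two insertions place
    differently: it lies to the right of a small arc at p and to the left of one at p + 1.\<close>
  have rv: "relabel n p ?v = ?u (p + 2)" "relabel n (p + 1) ?v = ?u p"
    unfolding relabel_def v(2) by (simp_all add: shift_def)
  have same: "relabel n (p + 1) y = relabel n p y" if "y \<in> points n" "y \<noteq> ?v" for y
  proof -
    have "fold_pos n y \<noteq> p" using unfold_fold[OF that(1)] that(2) by auto
    from shift_Suc[OF this] show ?thesis unfolding relabel_def by simp
  qed
  have fv: "relabel n (p + 1) (f ?v) = relabel n p (f ?v)" by (rule same[OF w(1,2)])
  note new = insert_mate_new(1,2)[OF m(1) p1] insert_mate_new(3,4)[OF m(1) p1, of False]
  note new' = insert_mate_new(1,2)[OF m(1) p2] insert_mate_new(3,4)[OF m(1) p2, of False]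
  note old = insert_mate_relabel[OF m(1) p1] and old' = insert_mate_relabel[OF m(1) p2]
  have f_at: "?f (Top k) = relabel n p (f ?v)" "?f (Top (k + 1)) = ?u p"
    "?d (Top k) = \<delta> ?v" "\<not> ?d (Top (k + 1))"
    unfolding tops using new old[OF v(1)] rv(1) by auto
  have mm: "mating (n + 1) ?f ?d" by (rule insert_mating[OF m(1) p1])
  have notnew: "relabel n p y \<noteq> ?u p" "relabel n p y \<noteq> ?u (p + 1)" if "y \<in> points n" for y
    using fold_relabel[OF m(1) p1 that] shift_not_new[of p "fold_pos n y"] p
      fold_unfold[of p "n + 1"] fold_unfold[of "p + 1" "n + 1"] by auto
  have rinj: "relabel n p y = relabel n p z \<longleftrightarrow> y = z" if "y \<in> points n" "z \<in> points n" for y z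
    using fold_relabel[OF m(1) p1 that(1)] fold_relabel[OF m(1) p1 that(2)] unshift_shift[of p]
      unfold_fold[OF that(1)] unfold_fold[OF that(2)] by metis
  have fact: "contract_factor ?f ?d (Top k) (Top (k + 1)) = 1"
  proof -
    have "?f (Top k) \<noteq> Top (k + 1)" unfolding f_at tops(2) by (rule notnew(2)[OF w(1)])
    then show ?thesis using f_at(4) by (simp add: contract_factor_def)
  qed
  let ?c = "contract ?f (Top k) (Top (k + 1))" and ?e = "contract_dots ?f ?d (Top k) (Top (k + 1))"
  have ev: "?c = ?f(relabel n p (f ?v) := ?u p, ?u p := relabel n p (f ?v), ?u (p + 2) := ?u (p + 1), ?u (p + 1) := ?u (p + 2))"
    "?e = ?d(relabel n p (f ?v) := \<delta> ?v, ?u p := \<delta> ?v, ?u (p + 2) := False, ?u (p + 1) := False)"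
    unfolding contract_def contract_dots_def f_at using f_at(4) tops by auto
  have agree: "?c y = ?f' y \<and> ?e y = ?d' y" if y: "y \<in> points (n + 1)" for y
  proof -
    have "p + 1 + 1 = p + 2" by simp
    consider "y = ?u p" | "y = ?u (p + 1)" | "y = ?u (p + 2)" | "y = relabel n p (f ?v)"
      | z where "z \<in> points n" "y = relabel n p z" "z \<noteq> ?v" "z \<noteq> f ?v"
      using y rv(1) unfolding points_insert[OF m(1) p1] by blast
    then show ?thesis
    proof cases
      case 1
      have "?c y = relabel n p (f ?v) \<and> ?e y = \<delta> ?v"
        unfolding ev 1 using inj by simp
      moreover have "?f' y = relabel n p (f ?v) \<and> ?d' y = \<delta> ?v"
        unfolding 1 rv(2)[symmetric] old'[OF v(1)] fv by simp
      ultimately show ?thesis by simp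
    next
      case 2
      then show ?thesis unfolding ev 2 using inj new' \<open>p + 1 + 1 = p + 2\<close> by simp
    next
      case 3
      then show ?thesis unfolding ev 3 using inj new' \<open>p + 1 + 1 = p + 2\<close> by simp
    next
      case 4
      have "relabel n p (f ?v) \<noteq> ?u (p + 2)" unfolding rv(1)[symmetric] using rinj[OF w(1) v(1)] w(2) by simp
      then have "?c y = ?u p \<and> ?e y = \<delta> ?v"
        unfolding ev 4 using notnew[OF w(1)] by simp
      moreover have "?f' y = ?u p \<and> ?d' y = \<delta> ?v"
        unfolding 4 fv[symmetric] old'[OF w(1)] w(3,4) rv(2) by simp
      ultimately show ?thesis by simp
    next
      case (5 z)
      have "y \<noteq> ?u (p + 2)" unfolding rv(1)[symmetric] 5(2) using rinj[OF 5(1) v(1)] 5(3) by simp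
      moreover have "y \<noteq> relabel n p (f ?v)" unfolding 5(2) using rinj[OF 5(1) w(1)] 5(4) by simp
      ultimately have "?c y = ?f y \<and> ?e y = ?d y"
        unfolding ev using notnew[OF 5(1)] 5(2) by simp
      moreover have "?f y = relabel n p (f z)" "?d y = \<delta> z"
        unfolding 5(2) using old[OF 5(1)] by simp_all
      moreover have "?f' y = relabel n (p + 1) (f z)" "?d' y = \<delta> z"
        unfolding 5(2) same[OF 5(1,3), symmetric] using old'[OF 5(1)] by simp_all
      moreover have "relabel n (p + 1) (f z) = relabel n p (f z)"
        using mating_point[OF m(1) 5(1)] 5(4) by (intro same) auto
      ultimately show ?thesis by simp
    qed
  qed
  have "gen_op (n + 1) k \<phi> (insert_arc n p False D) = \<phi> (mate_diagram (n + 1) ?c ?e)"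
    unfolding m(2) insert_mate_diagram[OF m(1) p1] gen_op_pos[OF mm k] fact by simp
  also have "mate_diagram (n + 1) ?c ?e = insert_arc n (p + 1) False D"
    unfolding m(2) insert_mate_diagram[OF m(1) p2] using agree by (intro mate_diagram_cong) auto
  finally show ?thesis unfolding k_def .
qed

text \<open>At the last two positions the small arc contains \<open>Top 1\<close>, so the dot of e_0
  lands on it; it carried none before, hence the scalar 1.\<close>

lemma gen_op_insert0:
  assumes D: "dotted_matching n D"
  shows "gen_op (n + 1) 0 \<phi> (insert_arc n (2 * n + 1) False D) = \<phi> (insert_arc n (2 * n + 1) True D)"
proof -
  obtain f \<delta> where m: "mating n f \<delta>" "D = mate_diagram n f \<delta>"
    using D by (auto simp: dotted_matching_def)
  let ?p = "2 * n + 1"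
  have p: "1 \<le> ?p" "?p \<le> 2 * n + 1" by auto
  let ?f = "insert_mate n ?p f" and ?d = "insert_dots n ?p False \<delta>" and ?d' = "insert_dots n ?p True \<delta>"
  let ?u = "unfold_pos (n + 1)"
  have top: "Top 1 = ?u (?p + 1)" by (auto simp: unfold_pos_def)
  note new = insert_mate_new(1,2)[OF m(1) p] insert_mate_new(3,4)[OF m(1) p, of False] insert_mate_new(3,4)[OF m(1) p, of True]
  have at: "?f (Top 1) = ?u ?p" "\<not> ?d (Top 1)" unfolding top using new by simp_all
  have mm: "mating (n + 1) ?f ?d" by (rule insert_mating[OF m(1) p])
  have "(?d(Top 1 := True, ?f (Top 1) := True)) y = ?d' y" if y: "y \<in> points (n + 1)" for y
  proof -
    consider "y = ?u ?p" | "y = ?u (?p + 1)" | z where "z \<in> points n" "y = relabel n ?p z"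
      using y unfolding points_insert[OF m(1) p] by blast
    then show ?thesis
    proof cases
      case (3 z)
      have "y \<noteq> ?u ?p \<and> y \<noteq> ?u (?p + 1)"
        unfolding 3(2) using fold_relabel[OF m(1) p 3(1)] shift_not_new[of ?p "fold_pos n z"]
        fold_unfold[of ?p "n + 1"] fold_unfold[of "?p + 1" "n + 1"] by auto
      moreover have "?d y = ?d' y"
        unfolding 3(2) insert_mate_relabel(2)[OF m(1) p 3(1)] ..
      ultimately show ?thesis unfolding at(1) unfolding top by simp
    qed (unfold at(1), unfold top, simp_all only: fun_upd_apply new simp_thms if_True if_cancel)
  qed
  then have "mate_diagram (n + 1) ?f (?d(Top 1 := True, ?f (Top 1) := True)) = insert_arc n ?p True D"
    unfolding m(2) insert_mate_diagram[OF m(1) p] by (intro mate_diagram_cong) auto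
  then show ?thesis
    unfolding m(2) insert_mate_diagram[OF m(1) p] using gen_op_0[OF mm] at(2) by simp
qed

section \<open>Adding a strand\<close>

text \<open>The natural inclusion adds a vertical strand on the right. Its two ends are neighbours
  in the middle of the folded list, so it is an insertion of a small arc, too.\<close>

abbreviation extend :: "nat \<Rightarrow> diagram \<Rightarrow> diagram" where
  "extend n \<equiv> insert_arc n (n + 1) False"

lemma relabel_extend: "y \<in> points n \<Longrightarrow> relabel n (n + 1) y = y"
  by (cases y) (auto simp: relabel_def shift_def unfold_pos_def)

lemma new_arc_extend: "new_arc n (n + 1) = {Top (n + 1), Bot (n + 1)}"
  by (auto simp: new_arc_def unfold_pos_def)

lemma points_Suc: "points (n + 1) = insert (Top (n + 1)) (insert (Bot (n + 1)) (points n))"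
proof -
  have "{1..n + 1} = insert (n + 1) {1..n}" by auto
  then show ?thesis unfolding points_def by auto
qed

lemma insert_mate_extend:
  assumes "mating n f \<delta>" "y \<in> points n"
  shows "insert_mate n (n + 1) f y = f y" "insert_dots n (n + 1) False \<delta> y = \<delta> y"
proof -
  have p: "1 \<le> n + 1" "n + 1 \<le> 2 * n + 1" by auto
  show "insert_mate n (n + 1) f y = f y" "insert_dots n (n + 1) False \<delta> y = \<delta> y"
    using insert_mate_relabel(1)[OF assms(1) p assms(2)] insert_mate_relabel(2)[OF assms(1) p assms(2), of False]
    unfolding relabel_extend[OF assms(2)] relabel_extend[OF mating_point(1)[OF assms]] by simp_all
qed

text \<open>For i < n the generator does not touch the ends of the new strand, and these are mated
  to each other.\<close>

lemma extend_gen: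
  assumes D: "dotted_matching n D" and i: "i < n"
  shows "stack (gen_diagram (n + 1) i) (extend n D) = extend n (stack (gen_diagram n i) D)"
    "stack_factor (gen_diagram (n + 1) i) (extend n D) = stack_factor (gen_diagram n i) D"
proof -
  obtain f \<delta> where m: "mating n f \<delta>" "D = mate_diagram n f \<delta>"
    using D by (auto simp: dotted_matching_def)
  have p: "1 \<le> n + 1" "n + 1 \<le> 2 * n + 1" by auto
  let ?I = "insert_mate n (n + 1)" and ?J = "insert_dots n (n + 1) False"
  have mm: "mating (n + 1) (?I f) (?J \<delta>)" by (rule insert_mating[OF m(1) p])
  have at: "?I g y = g y" "?J \<epsilon> y = \<epsilon> y" if "mating n g \<epsilon>" "y \<in> points n" for g \<epsilon> y
    using insert_mate_extend[OF that] by simp_all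
  have new: "?I g y = ?I h y \<and> ?I g y \<notin> points n \<and> \<not> ?J \<epsilon> y" if "y \<in> {Top (n + 1), Bot (n + 1)}" for g h \<epsilon> y
    using that by (auto simp: insert_mate_def insert_dots_def unfold_pos_def)
  have "stack (gen_diagram (n + 1) i) (extend n D) = extend n (stack (gen_diagram n i) D) \<and>
    stack_factor (gen_diagram (n + 1) i) (extend n D) = stack_factor (gen_diagram n i) D"
  proof (cases "i = 0")
    case True
    have n: "1 \<le> n" "1 \<le> n + 1" using i by auto
    have t: "Top 1 \<in> points n" using n by simp
    note ft = mating_point(1)[OF m(1) t]
    let ?d = "\<delta>(Top 1 := True, f (Top 1) := True)"
    have m2: "mating n f ?d" by (rule dot_mating[OF m(1) n(1)])
    have eq: "?J ?d y = ((?J \<delta>)(Top 1 := True, ?I f (Top 1) := True)) y" if "y \<in> points (n + 1)" for y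
    proof (cases "y \<in> points n")
      case True
      then show ?thesis using at[OF m(1) True] at[OF m2 True] at[OF m(1) t] by simp
    next
      case False
      then have "y \<in> {Top (n + 1), Bot (n + 1)}" using that unfolding points_Suc by blast
      moreover have "y \<noteq> Top 1" "y \<noteq> f (Top 1)" using False t ft by metis+
      ultimately show ?thesis using new[of y f f] at[OF m(1) t] by simp
    qed
    show ?thesis
      unfolding True m(2) insert_mate_diagram[OF m(1) p] stack_gen0[OF m(1) n(1)] stack_gen0[OF mm n(2)]
        stack_factor_gen0[OF m(1) n(1)] stack_factor_gen0[OF mm n(2)] insert_mate_diagram[OF m2 p]
      using eq at[OF m(1) t] by (auto intro!: mate_diagram_cong)
  next
    case False
    then have i': "1 \<le> i" "i < n" "i < n + 1" using i by auto
    let ?p = "Top i" and ?q = "Top (i + 1)"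
    have pq: "?p \<in> points n" "?q \<in> points n" using i' by auto
    note fp = mating_point(1)[OF m(1) pq(1)] mating_point(1)[OF m(1) pq(2)]
    note at' = at[OF m(1) pq(1)] at[OF m(1) pq(2)]
    let ?f = "contract f ?p ?q" and ?d = "contract_dots f \<delta> ?p ?q"
    have m2: "mating n ?f ?d" by (rule contract_mating_Top[OF m(1) i'(1,2)])
    have eq: "?I ?f y = contract (?I f) ?p ?q y \<and> ?J ?d y = contract_dots (?I f) (?J \<delta>) ?p ?q y"
      if "y \<in> points (n + 1)" for y
    proof (cases "y \<in> points n")
      case True
      show ?thesis unfolding at[OF m2 True] using at[OF m(1) True] at'
        by (simp add: contract_def contract_dots_def)
    next
      case False
      then have "y \<in> {Top (n + 1), Bot (n + 1)}" using that unfolding points_Suc by blast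
      moreover have "y \<noteq> ?p" "y \<noteq> ?q" "y \<noteq> f ?p" "y \<noteq> f ?q" using False pq fp by metis+
      ultimately show ?thesis
        unfolding contract_def[of "?I f"] contract_dots_def[of "?I f"] at'
        using new[of y f ?f] new[of y f f ?d] new[of y f f \<delta>] by simp
    qed
    have "contract_factor (?I f) (?J \<delta>) ?p ?q = contract_factor f \<delta> ?p ?q"
      using at' by (simp add: contract_factor_def)
    then show ?thesis
      unfolding m(2) insert_mate_diagram[OF m(1) p] stack_gen[OF m(1) i'(1,2)] stack_gen[OF mm i'(1,3)]
        stack_factor_gen[OF m(1) i'(1,2)] stack_factor_gen[OF mm i'(1,3)] insert_mate_diagram[OF m2 p]
      using eq by (auto intro!: mate_diagram_cong)
  qed
  then show "stack (gen_diagram (n + 1) i) (extend n D) = extend n (stack (gen_diagram n i) D)"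
    "stack_factor (gen_diagram (n + 1) i) (extend n D) = stack_factor (gen_diagram n i) D" by simp_all
qed

lemma extend_id: "extend n (id_diagram n) = id_diagram (n + 1)"
proof -
  have "(`) (relabel n (n + 1)) ` arcs (id_diagram n) = arcs (id_diagram n)"
    unfolding id_diagram_def fst_conv image_image
    by (intro image_cong refl) (simp add: relabel_extend[simplified])
  moreover have "{1..n + 1} = insert (n + 1) {1..n}" by auto
  ultimately show ?thesis
    unfolding insert_arc_def new_arc_extend by (simp add: id_diagram_def)
qed

lemma extend_word:
  assumes "set u \<subseteq> {..<n}"
  shows "word_diagram (n + 1) u = extend n (word_diagram n u) \<and> word_factor (n + 1) u = word_factor n u"
  using assms
proof (induction u)
  case Nil
  then show ?case using extend_id by simp
next
  case (Cons i u)
  then have i: "i < n" and "set u \<subseteq> {..<n}" by auto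
  then show ?case
    using Cons.IH extend_gen[OF dotted_matching_word[of u n] i] by simp
qed

lemma diag_sum_extend:
  assumes "x \<in> free_on n"
  shows "diag_sum (n + 1) x \<phi> = diag_sum n x (\<lambda>D. \<phi> (extend n D))"
  unfolding diag_sum_def
proof (rule sum.cong[OF refl])
  fix w assume "w \<in> Poly_Mapping.keys x"
  then have "set (letters w) \<subseteq> {..<n}" using assms by (simp add: free_on_def)
  then show "Poly_Mapping.lookup x w * word_factor (n + 1) (letters w) * \<phi> (word_diagram (n + 1) (letters w)) =
      Poly_Mapping.lookup x w * word_factor n (letters w) * \<phi> (extend n (word_diagram n (letters w)))"
    using extend_word by simp
qed

definition descent :: "nat \<Rightarrow> nat \<Rightarrow> free_alg" where
  "descent n k = foldr (\<lambda>i x. gen i * x) [k..<n + 1] (Q_rep n)"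

lemma descent_top: "descent n (n + 1) = Q_rep n"
  by (simp add: descent_def)

lemma descent_step: "k \<le> n \<Longrightarrow> descent n k = gen k * descent n (k + 1)"
  by (simp add: descent_def upt_conv_Cons del: upt_Suc)

text \<open>Over n + 1 strands the last strand of Q^(n) is vertical, a small arc at position n + 1.
  Each of e_n, e_(n-1), ... then moves it one position further by
  \<open>gen_op_insert\<close>.\<close>

lemma diag_sum_descent:
  assumes "j \<le> n"
  shows "diag_sum (n + 1) (descent n (n + 1 - j)) \<phi> = diag_sum n (Q_rep n) (\<lambda>D. \<phi> (insert_arc n (n + 1 + j) False D))"
  using assms
proof (induction j arbitrary: \<phi>)
  case 0
  then show ?case using diag_sum_extend[OF Q_rep_free[OF order_refl]] by (simp add: descent_top[simplified])
next
  case (Suc j)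
  let ?k = "n + 1 - Suc j"
  have k: "descent n ?k = gen ?k * descent n (n + 1 - j)"
    using descent_step[of ?k n] Suc.prems by (simp add: Suc_diff_le)
  have "diag_sum (n + 1) (descent n ?k) \<phi> = diag_sum (n + 1) (descent n (n + 1 - j)) (gen_op (n + 1) ?k \<phi>)"
    unfolding k diag_sum_gen ..
  also have "\<dots> = diag_sum n (Q_rep n) (\<lambda>D. gen_op (n + 1) ?k \<phi> (insert_arc n (n + 1 + j) False D))"
    using Suc by simp
  also have "\<dots> = diag_sum n (Q_rep n) (\<lambda>D. \<phi> (insert_arc n (n + 1 + Suc j) False D))"
  proof (intro diag_sum_cong Q_rep_free order_refl)
    fix D assume "dotted_matching n D"
    from gen_op_insert[OF this, of "n + 1 + j" \<phi>]
    show "gen_op (n + 1) ?k \<phi> (insert_arc n (n + 1 + j) False D) = \<phi> (insert_arc n (n + 1 + Suc j) False D)"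
      using Suc.prems by simp
  qed
  finally show ?case .
qed

lemma diag_sum_descent0:
  "diag_sum (n + 1) (descent n 0) \<phi> = diag_sum n (Q_rep n) (\<lambda>D. \<phi> (insert_arc n (2 * n + 1) True D))"
proof -
  have "diag_sum (n + 1) (descent n 0) \<phi> = diag_sum (n + 1) (descent n 1) (gen_op (n + 1) 0 \<phi>)"
    using descent_step[of 0 n] by (simp add: diag_sum_gen)
  also have "\<dots> = diag_sum n (Q_rep n) (\<lambda>D. gen_op (n + 1) 0 \<phi> (insert_arc n (2 * n + 1) False D))"
    using diag_sum_descent[of n n] by (simp add: mult_2)
  also have "\<dots> = diag_sum n (Q_rep n) (\<lambda>D. \<phi> (insert_arc n (2 * n + 1) True D))"
    by (intro diag_sum_cong Q_rep_free order_refl gen_op_insert0)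
  finally show ?thesis .
qed

text \<open>The induction needs every m \<le> n + 1, because the last letter of the chain passes
  over to the descent: e_m times \<open>descent n (m + 1)\<close> is
  \<open>descent n m\<close>.\<close>

lemma diag_sum_chain:
  assumes "m \<le> n + 1"
  shows "diag_sum (n + 1) (wenzl_chain m * descent n m) \<phi> =
    (\<Sum>k\<le>m. qnum_s k / qnum_s m * diag_sum (n + 1) (descent n k) \<phi>)"
  using assms
proof (induction m)
  case 0
  then show ?case by (simp add: qnum_s_def)
next
  case (Suc m)
  have "wenzl_chain (Suc m) * descent n (Suc m) = descent n (Suc m) +
      scal (qnum_s m / qnum_s (m + 1)) * (wenzl_chain m * descent n m)"
    using Suc.prems descent_step[of m n] by (simp add: distrib_right mult.assoc)
  then have "diag_sum (n + 1) (wenzl_chain (Suc m) * descent n (Suc m)) \<phi> = diag_sum (n + 1) (descent n (Suc m)) \<phi> +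
      qnum_s m / qnum_s (m + 1) * (\<Sum>k\<le>m. qnum_s k / qnum_s m * diag_sum (n + 1) (descent n k) \<phi>)"
    using Suc by (simp add: diag_sum_add diag_sum_scal)
  also have "\<dots> = (\<Sum>k\<le>Suc m. qnum_s k / qnum_s (Suc m) * diag_sum (n + 1) (descent n k) \<phi>)"
    using qnum_s_nonzero by (simp add: sum_distrib_left field_simps)
  finally show ?case .
qed

text \<open>The unrolled recursion in terms of insertions, with p = 2n + 2 - k for k \<ge> 1. The
  first summand is the term k = 0, whose coefficient [0]_s is 1.\<close>

lemma diag_sum_Q_Suc:
  "qnum_s (n + 1) * diag_sum (n + 1) (Q_rep (n + 1)) \<phi> =
     diag_sum n (Q_rep n) (\<lambda>D. \<phi> (insert_arc n (2 * n + 1) True D)) +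
     (\<Sum>p = n + 1..2 * n + 1. qnum_s (2 * n + 2 - p) * diag_sum n (Q_rep n) (\<lambda>D. \<phi> (insert_arc n p False D)))"
proof -
  let ?d = "\<lambda>k. diag_sum (n + 1) (descent n k) \<phi>"
  have "diag_sum (n + 1) (Q_rep (n + 1)) \<phi> = diag_sum (n + 1) (wenzl_chain (n + 1) * descent n (n + 1)) \<phi>"
    using diag_sum_tlb_cong[OF Q_chain[of n "n + 1"]] by (simp add: descent_top[simplified])
  also have "\<dots> = (\<Sum>k\<le>n + 1. qnum_s k / qnum_s (n + 1) * ?d k)"
    by (rule diag_sum_chain) simp
  also have "\<dots> = (\<Sum>k\<le>n + 1. qnum_s k * ?d k) / qnum_s (n + 1)"
    unfolding sum_divide_distrib by (intro sum.cong refl) simp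
  finally have "qnum_s (n + 1) * diag_sum (n + 1) (Q_rep (n + 1)) \<phi> = (\<Sum>k\<le>n + 1. qnum_s k * ?d k)"
    using qnum_s_nonzero[of "n + 1"] by (simp only: nonzero_mult_div_cancel_left times_divide_eq_right simp_thms not_False_eq_True)
  also have "\<dots> = ?d 0 + (\<Sum>k = 1..n + 1. qnum_s k * ?d k)"
    by (simp add: sum.atMost_shift atLeast0AtMost[symmetric] sum.atLeast_Suc_atMost qnum_s_def[of 0])
  also have "(\<Sum>k = 1..n + 1. qnum_s k * ?d k) =
     (\<Sum>p = n + 1..2 * n + 1. qnum_s (2 * n + 2 - p) * diag_sum n (Q_rep n) (\<lambda>D. \<phi> (insert_arc n p False D)))"
  proof (rule sum.reindex_bij_witness[of _ "\<lambda>p. 2 * n + 2 - p" "\<lambda>k. 2 * n + 2 - k"])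
    fix k assume "k \<in> {1..n + 1}"
    then have k: "1 \<le> k" "k \<le> n + 1" by auto
    have "n + 1 - (n + 1 - k) = k" "n + 1 + (n + 1 - k) = 2 * n + 2 - k" "n + 1 - k \<le> n" using k by auto
    then have "?d k = diag_sum n (Q_rep n) (\<lambda>D. \<phi> (insert_arc n (2 * n + 2 - k) False D))"
      using diag_sum_descent[of "n + 1 - k" n \<phi>] by metis
    then show "qnum_s (2 * n + 2 - (2 * n + 2 - k)) * diag_sum n (Q_rep n) (\<lambda>D. \<phi> (insert_arc n (2 * n + 2 - k) False D)) = qnum_s k * ?d k"
      using k by simp
  qed auto
  finally show ?thesis unfolding diag_sum_descent0 .
qed

section \<open>Labelled arcs\<close>

type_synonym labelled_arcs = "(nat \<times> nat \<times> nat) set"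

text \<open>A triple \<open>(i, j, k)\<close> is an arc joining the folded points \<open>i < j\<close> with label \<open>k\<close>; the label \<open>0\<close>
  encodes a dot. An undotted arc nested inside \<open>a\<close> others that will carry \<open>g\<close> joined tile layers
  has label \<open>a + 1 + 2 g\<close>.\<close>

definition labelling :: "nat \<Rightarrow> labelled_arcs \<Rightarrow> bool" where
  "labelling n C \<longleftrightarrow>
     (\<forall>i j k. (i, j, k) \<in> C \<longrightarrow>
        1 \<le> i \<and> i < j \<and> j \<le> 2 * n \<and> odd (i + j) \<and> k \<le> i \<and> k + j \<le> 2 * n + 1 \<and> (k = 0 \<or> even (i + k))) \<and>
     (\<forall>i j k i' j' k'. (i, j, k) \<in> C \<longrightarrow> (i', j', k') \<in> C \<longrightarrow>
        (i, j, k) = (i', j', k') \<or> {i, j} \<inter> {i', j'} = {}) \<and>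
     (\<forall>i j k i' j' k'. (i, j, k) \<in> C \<longrightarrow> (i', j', k') \<in> C \<longrightarrow> i < i' \<longrightarrow> i' < j \<longrightarrow> j' < j \<and> k < k') \<and>
     (\<forall>x. 1 \<le> x \<longrightarrow> x \<le> 2 * n \<longrightarrow> (\<exists>i j k. (i, j, k) \<in> C \<and> x \<in> {i, j}))"

definition shift_label :: "nat \<Rightarrow> nat \<times> nat \<times> nat \<Rightarrow> nat \<times> nat \<times> nat" where
  "shift_label p = (\<lambda>(i, j, k). (shift p i, shift p j, k))"

definition insert_label :: "nat \<times> nat \<Rightarrow> labelled_arcs \<Rightarrow> labelled_arcs" where
  "insert_label = (\<lambda>(p, k) C. insert (p, p + 1, k) (shift_label p ` C))"

text \<open>Position 2n + 1 occurs twice, for the labels 1 and 0: e_0 adds a dot and leaves the arc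
  in its place.\<close>

definition moves :: "nat \<Rightarrow> (nat \<times> nat) set" where
  "moves n = insert (2 * n + 1, 0) ((\<lambda>p. (p, 2 * n + 2 - p)) ` {n + 1..2 * n + 1})"

lemma labellingD:
  assumes "labelling n C"
  shows "(i, j, k) \<in> C \<Longrightarrow> 1 \<le> i \<and> i < j \<and> j \<le> 2 * n \<and> odd (i + j) \<and> k \<le> i \<and> k + j \<le> 2 * n + 1 \<and> (k = 0 \<or> even (i + k))"
    and "(i, j, k) \<in> C \<Longrightarrow> (i', j', k') \<in> C \<Longrightarrow> (i, j, k) = (i', j', k') \<or> {i, j} \<inter> {i', j'} = {}"
    and "(i, j, k) \<in> C \<Longrightarrow> (i', j', k') \<in> C \<Longrightarrow> i < i' \<Longrightarrow> i' < j \<Longrightarrow> j' < j \<and> k < k'"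
    and "1 \<le> x \<Longrightarrow> x \<le> 2 * n \<Longrightarrow> \<exists>i j k. (i, j, k) \<in> C \<and> x \<in> {i, j}"
proof -
  note * = assms[unfolded labelling_def]
  show "(i, j, k) \<in> C \<Longrightarrow> 1 \<le> i \<and> i < j \<and> j \<le> 2 * n \<and> odd (i + j) \<and> k \<le> i \<and> k + j \<le> 2 * n + 1 \<and> (k = 0 \<or> even (i + k))"
    using conjunct1[OF *] by blast
  show "(i, j, k) \<in> C \<Longrightarrow> (i', j', k') \<in> C \<Longrightarrow> (i, j, k) = (i', j', k') \<or> {i, j} \<inter> {i', j'} = {}"
    using conjunct1[OF conjunct2[OF *]] by blast
  show "(i, j, k) \<in> C \<Longrightarrow> (i', j', k') \<in> C \<Longrightarrow> i < i' \<Longrightarrow> i' < j \<Longrightarrow> j' < j \<and> k < k'"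
    using conjunct1[OF conjunct2[OF conjunct2[OF *]]] by blast
  show "1 \<le> x \<Longrightarrow> x \<le> 2 * n \<Longrightarrow> \<exists>i j k. (i, j, k) \<in> C \<and> x \<in> {i, j}"
    using conjunct2[OF conjunct2[OF conjunct2[OF *]]] by blast
qed

lemma shift_less_iff: "shift p x < shift p y \<longleftrightarrow> x < y"
  by (auto simp: shift_def)

lemma shift_eq_iff: "shift p x = shift p y \<longleftrightarrow> x = y"
  by (auto simp: shift_def)

lemma even_shift: "even (shift p x) \<longleftrightarrow> even x"
  by (auto simp: shift_def)

lemma shift_surj: "x \<noteq> p \<Longrightarrow> x \<noteq> p + 1 \<Longrightarrow> \<exists>y. x = shift p y"
  by (intro exI[of _ "unshift p x"]) (auto simp: shift_def unshift_def)

lemma moves_iff: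
  "(p, k) \<in> moves n \<longleftrightarrow> n + 1 \<le> p \<and> p \<le> 2 * n + 1 \<and> (k = 2 * n + 2 - p \<or> k = 0 \<and> p = 2 * n + 1)"
  by (auto simp: moves_def)

lemma insert_label_cases:
  assumes "c \<in> insert_label (p, k) C"
  obtains "c = (p, p + 1, k)" | i j l where "(i, j, l) \<in> C" "c = (shift p i, shift p j, l)"
  using assms by (auto simp: insert_label_def shift_label_def)

text \<open>At its insertion an undotted arc has k + (p + 1) = 2n + 3, the largest value allowed for
  n + 1 strands, and p \<ge> n + 1 gives k \<le> p. Later the bound 2n + 1 grows by two with each
  insertion while right ends grow by at most two, so both inequalities persist.\<close>

lemma labelling_insert:
  assumes C: "labelling n C" and p: "(p, k) \<in> moves n"
  shows "labelling (n + 1) (insert_label (p, k) C)"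
  unfolding labelling_def
proof (intro conjI allI impI)
  note p = p[unfolded moves_iff]
  note D = labellingD[OF C]
  { fix i j l assume "(i, j, l) \<in> insert_label (p, k) C"
    then have "1 \<le> i \<and> i < j \<and> j \<le> 2 * (n + 1) \<and> odd (i + j) \<and> l \<le> i \<and> l + j \<le> 2 * (n + 1) + 1 \<and> (l = 0 \<or> even (i + l))"
    proof (cases rule: insert_label_cases)
      case 1
      have "even (p + (2 * n + 2 - p))" using p by simp
      with 1 show ?thesis using p by auto
    next
      case (2 a b c)
      then show ?thesis using D(1)[OF 2(1)] by (auto simp: shift_def)
    qed
    then show "1 \<le> i" "i < j" "j \<le> 2 * (n + 1)" "odd (i + j)" "l \<le> i" "l + j \<le> 2 * (n + 1) + 1" "l = 0 \<or> even (i + l)"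
      by auto }
  { fix i j l i' j' l'
    assume x: "(i, j, l) \<in> insert_label (p, k) C" and y: "(i', j', l') \<in> insert_label (p, k) C"
    from x show "(i, j, l) = (i', j', l') \<or> {i, j} \<inter> {i', j'} = {}"
    proof (cases rule: insert_label_cases)
      case 1
      from y show ?thesis
      proof (cases rule: insert_label_cases)
        case (2 a b c)
        then show ?thesis using 1 shift_not_new[of p a] shift_not_new[of p b] by auto
      qed (use 1 in auto)
    next
      case (2 a b c)
      from y show ?thesis
      proof (cases rule: insert_label_cases)
        case 1
        then show ?thesis using 2 shift_not_new[of p a] shift_not_new[of p b] by auto
      next
        case (2 a' b' c')
        then show ?thesis using \<open>(a, b, c) \<in> C\<close> \<open>(i, j, l) = (shift p a, shift p b, c)\<close> D(2)[OF \<open>(a, b, c) \<in> C\<close> 2(1)]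
          by (auto simp: shift_eq_iff)
      qed
    qed
    assume lt: "i < i'" "i' < j"
    from x have "j' < j \<and> l < l'"
    proof (cases rule: insert_label_cases)
      case 1
      then show ?thesis using lt by auto
    next
      case (2 a b c)
      from y show ?thesis
      proof (cases rule: insert_label_cases)
        case 1
        \<comment> \<open>The new arc lies inside (a, b). From c + b \<le> 2n + 1 and p \<le> b
          follows c < 2n + 2 - p; the dotted insertion is excluded because p = 2n + 1 exceeds
          b.\<close>
        then have "a < p" "p \<le> b" using 2 lt by (auto simp: shift_def split: if_splits)
        then show ?thesis using 1 2 p D(1)[OF 2(1)] by (auto simp: shift_def)
      next
        case (2 a' b' c')
        then show ?thesis using \<open>(i, j, l) = (shift p a, shift p b, c)\<close> D(3)[OF \<open>(a, b, c) \<in> C\<close> 2(1)] lt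
          by (auto simp: shift_less_iff)
      qed
    qed
    then show "j' < j" "l < l'" by auto }
  { fix x assume x: "1 \<le> x" "x \<le> 2 * (n + 1)"
    show "\<exists>i j l. (i, j, l) \<in> insert_label (p, k) C \<and> x \<in> {i, j}"
    proof (cases "x = p \<or> x = p + 1")
      case True
      then show ?thesis by (auto simp: insert_label_def)
    next
      case False
      then obtain y where y: "x = shift p y" using shift_surj by blast
      then have "1 \<le> y" "y \<le> 2 * n" using x p False by (auto simp: shift_def split: if_splits)
      then obtain i j l where "(i, j, l) \<in> C" "y \<in> {i, j}" using D(4) by blast
      then have "(shift p i, shift p j, l) \<in> insert_label (p, k) C" "x \<in> {shift p i, shift p j}"
        using y by (auto simp: insert_label_def shift_label_def image_iff)
      then show ?thesis by blast
    qed }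
qed

section \<open>Recovering the last insertion from a labelling\<close>

lemma shift_label_inj: "inj (shift_label p)"
  by (rule injI) (auto simp: shift_label_def shift_eq_iff)

text \<open>The inserted arc is the leftmost small arc whose label is as large as its right end permits.\<close>

lemma insert_label_position:
  assumes C': "labelling n C'" and p: "(p, k) \<in> moves n" and p': "(p', k') \<in> moves n"
    and eq: "insert_label (p, k) C = insert_label (p', k') C'"
  shows "p' \<le> p"
proof (rule ccontr)
  assume "\<not> p' \<le> p"
  have "(p, p + 1, k) \<in> insert_label (p', k') C'"
    unfolding eq[symmetric] by (simp add: insert_label_def)
  then show False
  proof (cases rule: insert_label_cases)
    case (2 i j l)
    then have "i = p" "j = p + 1" using \<open>\<not> p' \<le> p\<close> by (auto simp: shift_def split: if_splits)
    then show ?thesis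
      using labellingD(1)[OF C' 2(1)] p p' \<open>\<not> p' \<le> p\<close> 2(2) unfolding moves_iff by auto
  qed (use \<open>\<not> p' \<le> p\<close> in auto)
qed

lemma insert_label_inj:
  "inj_on (\<lambda>(m, C). insert_label m C) (moves n \<times> {C. labelling n C})"
proof (rule inj_onI)
  fix x y
  assume x: "x \<in> moves n \<times> {C. labelling n C}" and y: "y \<in> moves n \<times> {C. labelling n C}"
    and eq: "(\<lambda>(m, C). insert_label m C) x = (\<lambda>(m, C). insert_label m C) y"
  obtain p k C p' k' C' where xy: "x = ((p, k), C)" "y = ((p', k'), C')" by (metis prod.exhaust)
  have *: "(p, k) \<in> moves n" "labelling n C" "(p', k') \<in> moves n" "labelling n C'"
    "insert_label (p, k) C = insert_label (p', k') C'"
    using x y eq unfolding xy by auto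
  then have "p = p'" using insert_label_position[OF *(4,1,3,5)] insert_label_position[OF *(2,3,1) *(5)[symmetric]] by simp
  have notin: "(p, p + 1, l) \<notin> shift_label p ` B" for l B
    using shift_not_new[of p] unfolding shift_label_def by fastforce
  have "(p, p + 1, k) \<in> insert_label (p', k') C'"
    unfolding *(5)[symmetric] by (simp add: insert_label_def)
  then have "k = k'" using notin \<open>p = p'\<close> by (auto simp: insert_label_def)
  moreover have "shift_label p ` C = shift_label p ` C'"
    using *(5) \<open>p = p'\<close> \<open>k = k'\<close> notin[of k C] notin[of k C'] unfolding insert_label_def
    by (simp add: insert_ident)
  then have "C = C'" using shift_label_inj by (simp add: inj_image_eq_iff)
  ultimately show "x = y" using \<open>p = p'\<close> by (simp add: xy)
qed

text \<open>Call an arc saturated if its label is as large as its right end j permits;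
  \<open>max k 1\<close> lets a dot at the last position count as saturated, as it is inserted at
  the same place as the label 1. If the arc is not small, j - 1 is the right end of an arc inside
  it. A larger label at a right end smaller by one is saturated again, so the descent stops at a
  small arc.\<close>

lemma small_saturated_inside:
  assumes C: "labelling (n + 1) C" and c: "(i, j, k) \<in> C" "max k 1 + j = 2 * n + 3"
  shows "\<exists>i' k'. (i', i' + 1, k') \<in> C \<and> max k' 1 + (i' + 1) = 2 * n + 3 \<and> i \<le> i' \<and> i' < j"
  using c
proof (induction "j - i" arbitrary: i j k rule: less_induct)
  case less
  note D = labellingD[OF C]
  note c = D(1)[OF less.prems(1)]
  show ?case
  proof (cases "j = i + 1")
    case False
    have "1 \<le> j - 1" "j - 1 \<le> 2 * (n + 1)" using c by auto
    from D(4)[OF this] obtain a b l where abl: "(a, b, l) \<in> C" "j - 1 \<in> {a, b}" by blast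
    note c' = D(1)[OF abl(1)]
    have ne: "(a, b, l) \<noteq> (i, j, k)" using abl(2) c False by auto
    have dis: "{i, j} \<inter> {a, b} = {}" using D(2)[OF less.prems(1) abl(1)] ne by auto
    have "a \<noteq> j - 1"
    proof
      assume "a = j - 1"
      then have "i < a" "a < j" using c False by auto
      with D(3)[OF less.prems(1) abl(1)] have "b < j" by blast
      then show False using \<open>a = j - 1\<close> c' by linarith
    qed
    then have b: "b = j - 1" using abl(2) by auto
    have "\<not> a < i"
    proof
      assume "a < i"
      moreover have "i < b" using b c False by auto
      ultimately have "j < b" using D(3)[OF abl(1) less.prems(1)] by blast
      then show False using b by simp
    qed
    then have a: "i < a" using dis by auto
    moreover have "a < j" using c' b by linarith
    ultimately have kl: "k < l" using D(3)[OF less.prems(1) abl(1)] by blast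
    have "max l 1 + b = 2 * n + 3"
    proof (cases "k = 0")
      \<comment> \<open>The dotted arc ends at 2n + 2. The inner arc ends at 2n + 1, and its label,
        positive and at most 2, is even by parity.\<close>
      case True
      then have "j = 2 * n + 2" using less.prems(2) by simp
      then have "b = 2 * n + 1" "l \<le> 2" using b c' by auto
      moreover have "even l" using c' \<open>b = 2 * n + 1\<close> kl by auto
      ultimately show ?thesis using kl by (auto elim!: evenE)
    next
      case False
      then show ?thesis using less.prems(2) kl c' b c by auto
    qed
    moreover have "b - a < j - i" using a b c' c by linarith
    ultimately obtain i' k' where "(i', i' + 1, k') \<in> C" "max k' 1 + (i' + 1) = 2 * n + 3" "a \<le> i'" "i' < b"
      using less.hyps[of b a l] abl(1) by blast
    moreover from this have "i \<le> i'" "i' < j" using a b by linarith+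
    ultimately show ?thesis by blast
  qed (use less.prems in auto)
qed

text \<open>The arc ending at the last point 2n + 2 is always saturated. So there is a leftmost
  saturated small arc, and this is the one to remove.\<close>

lemma insert_label_surj:
  assumes C: "labelling (n + 1) C"
  shows "\<exists>m \<in> moves n. \<exists>B. labelling n B \<and> C = insert_label m B"
proof -
  note D = labellingD[OF C]
  let ?S = "{i. \<exists>k. (i, i + 1, k) \<in> C \<and> max k 1 + (i + 1) = 2 * n + 3}"
  obtain i j k where "(i, j, k) \<in> C" "2 * n + 2 \<in> {i, j}" using D(4)[of "2 * n + 2"] by auto
  then have "max k 1 + j = 2 * n + 3" using D(1)[of i j k] by auto
  then have ne: "?S \<noteq> {}" using small_saturated_inside[OF C \<open>(i, j, k) \<in> C\<close>] by blast
  define p where "p = (LEAST i. i \<in> ?S)"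
  have "p \<in> ?S" unfolding p_def using ne by (metis (no_types, lifting) LeastI_ex ex_in_conv)
  then obtain k where pk: "(p, p + 1, k) \<in> C" "max k 1 + (p + 1) = 2 * n + 3" by blast
  have least: "p \<le> i" if "i \<in> ?S" for i unfolding p_def using that by (rule Least_le)
  note P = D(1)[OF pk(1)]
  have m: "(p, k) \<in> moves n" unfolding moves_iff using P pk(2) by auto
  have p: "n + 1 \<le> p" "p \<le> 2 * n + 1" using m unfolding moves_iff by auto
  \<comment> \<open>By the choice of p no arc ending left of p is saturated, and parity rules out
    the next smaller value. So these arcs, whose right ends stay in place when the small arc is
    removed, already satisfy the tighter bound for n strands.\<close>
  have left: "l + j \<le> 2 * n + 1" if ijl: "(i, j, l) \<in> C" "j < p" for i j l
  proof -
    note c = D(1)[OF ijl(1)]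
    have "max l 1 + j \<noteq> 2 * n + 3"
    proof
      assume "max l 1 + j = 2 * n + 3"
      then obtain i' where "i' \<in> ?S" "i' < j" using small_saturated_inside[OF C ijl(1)] by blast
      then show False using least[of i'] ijl(2) by auto
    qed
    moreover have "l = 0 \<or> odd (l + j)" using c by auto
    moreover have "l + j \<noteq> 2 * n + 2" if "l \<noteq> 0"
    proof
      assume "l + j = 2 * n + 2"
      then have "even (l + j)" by simp
      then show False using \<open>l = 0 \<or> odd (l + j)\<close> that by blast
    qed
    ultimately show ?thesis using c ijl(2) p by (cases "l = 0") auto
  qed
  define B where "B = {(i, j, l). (shift p i, shift p j, l) \<in> C}"
  have B: "(i, j, l) \<in> B \<longleftrightarrow> (shift p i, shift p j, l) \<in> C" for i j l by (simp add: B_def)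
  have old: "\<exists>a b. i = shift p a \<and> j = shift p b \<and> (a, b, l) \<in> B"
    if "(i, j, l) \<in> C" "(i, j, l) \<noteq> (p, p + 1, k)" for i j l
  proof -
    have "{i, j} \<inter> {p, p + 1} = {}" using D(2)[OF that(1) pk(1)] that(2) by blast
    then obtain a b where "i = shift p a" "j = shift p b"
      using shift_surj[of i p] shift_surj[of j p] by auto
    then show ?thesis using that(1) B by auto
  qed
  have "labelling n B"
    unfolding labelling_def
  proof (intro conjI allI impI)
    { fix i j l assume ijl: "(i, j, l) \<in> B"
      note c = D(1)[OF ijl[unfolded B]]
      have "i < j" using c shift_less_iff by blast
      show "1 \<le> i" using c p by (auto simp: shift_def split: if_splits)
      show "i < j" by fact
      show "j \<le> 2 * n" using c p by (auto simp: shift_def split: if_splits)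
      show "odd (i + j)" using c by (simp add: even_shift)
      show "l = 0 \<or> even (i + l)" using c by (auto simp: even_shift)
      show "l + j \<le> 2 * n + 1"
      proof (cases "j < p")
        case True
        then show ?thesis using left[OF ijl[unfolded B]] by (simp add: shift_def)
      qed (use c in \<open>simp add: shift_def\<close>)
      show "l \<le> i"
      proof (cases "i < p")
        case False
        then show ?thesis using c p \<open>i < j\<close> by (auto simp: shift_def)
      qed (use c in \<open>simp add: shift_def\<close>) }
    { fix i j l i' j' l' assume "(i, j, l) \<in> B" "(i', j', l') \<in> B"
      then have c: "(shift p i, shift p j, l) \<in> C" "(shift p i', shift p j', l') \<in> C" by (simp_all add: B)
      show "(i, j, l) = (i', j', l') \<or> {i, j} \<inter> {i', j'} = {}"
        using D(2)[OF c] by (auto simp: shift_eq_iff)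
      show "i < i' \<Longrightarrow> i' < j \<Longrightarrow> j' < j" "i < i' \<Longrightarrow> i' < j \<Longrightarrow> l < l'"
        using D(3)[OF c] by (auto simp: shift_less_iff) }
    { fix x assume x: "1 \<le> x" "x \<le> 2 * n"
      then have "1 \<le> shift p x" "shift p x \<le> 2 * (n + 1)" by (auto simp: shift_def)
      then obtain i j l where ijl: "(i, j, l) \<in> C" "shift p x \<in> {i, j}" using D(4) by blast
      then have "(i, j, l) \<noteq> (p, p + 1, k)" using shift_not_new[of p x] by auto
      from old[OF ijl(1) this] obtain a b where "i = shift p a" "j = shift p b" "(a, b, l) \<in> B" by blast
      then show "\<exists>i j l. (i, j, l) \<in> B \<and> x \<in> {i, j}" using ijl(2) by (auto simp: shift_eq_iff) }
  qed
  moreover have "C = insert_label (p, k) B"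
  proof
    show "C \<subseteq> insert_label (p, k) B"
    proof
      fix c assume c: "c \<in> C"
      obtain i j l where ijl: "c = (i, j, l)" by (cases c)
      show "c \<in> insert_label (p, k) B"
      proof (cases "c = (p, p + 1, k)")
        case False
        then obtain a b where "i = shift p a" "j = shift p b" "(a, b, l) \<in> B" using old c ijl by blast
        then show ?thesis unfolding ijl by (auto simp: insert_label_def shift_label_def image_iff)
      qed (simp add: insert_label_def)
    qed
  qed (use pk(1) B in \<open>auto simp: insert_label_def shift_label_def\<close>)
  ultimately show ?thesis using m by blast
qed

lemma insert_label_bij:
  "bij_betw (\<lambda>(m, C). insert_label m C) (moves n \<times> {C. labelling n C}) {C. labelling (n + 1) C}"
  unfolding bij_betw_def
proof (intro conjI insert_label_inj)
  show "(\<lambda>(m, C). insert_label m C) ` (moves n \<times> {C. labelling n C}) = {C. labelling (n + 1) C}"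
  proof
    show "(\<lambda>(m, C). insert_label m C) ` (moves n \<times> {C. labelling n C}) \<subseteq> {C. labelling (n + 1) C}"
      using labelling_insert by auto
    show "{C. labelling (n + 1) C} \<subseteq> (\<lambda>(m, C). insert_label m C) ` (moves n \<times> {C. labelling n C})"
      using insert_label_surj by fastforce
  qed
qed

section \<open>Weights and diagrams of labellings\<close>

lemma labelling_subset: "labelling n C \<Longrightarrow> C \<subseteq> {..2 * n} \<times> {..2 * n} \<times> {..2 * n}"
  using labellingD(1) by (fastforce intro: order.trans)

lemma finite_labelling: "labelling n C \<Longrightarrow> finite C"
  by (rule finite_subset[OF labelling_subset]) simp_all

lemma finite_labellings: "finite {C. labelling n C}"
  by (rule finite_subset[of _ "Pow ({..2 * n} \<times> {..2 * n} \<times> {..2 * n})"]) (auto dest: labelling_subset)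

definition label_weight :: "labelled_arcs \<Rightarrow> qs_field" where
  "label_weight C = (\<Prod>(i, j, k) \<in> C. qnum_s k)"

definition labelling_diagram :: "nat \<Rightarrow> labelled_arcs \<Rightarrow> diagram" where
  "labelling_diagram n C =
     ((\<lambda>(i, j, k). {unfold_pos n i, unfold_pos n j}) ` C,
      (\<lambda>(i, j, k). {unfold_pos n i, unfold_pos n j}) ` {(i, j, k) \<in> C. k = 0})"

lemma insert_labelling_diagram:
  assumes C: "labelling n C"
  shows "insert_arc n p (k = 0) (labelling_diagram n C) = labelling_diagram (n + 1) (insert_label (p, k) C)"
proof -
  let ?a = "\<lambda>(i, j, k). {unfold_pos n i, unfold_pos n j}" and ?b = "\<lambda>(i, j, k). {unfold_pos (n + 1) i, unfold_pos (n + 1) j}"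
  have arc: "relabel n p ` ?a c = ?b (shift_label p c)" if "c \<in> C" for c
  proof -
    obtain i j l where c: "c = (i, j, l)" by (cases c)
    have "1 \<le> i" "i \<le> 2 * n" "1 \<le> j" "j \<le> 2 * n" using labellingD(1)[OF C] that c by fastforce+
    then show ?thesis unfolding c by (simp add: relabel_def shift_label_def fold_unfold)
  qed
  have 1: "(`) (relabel n p) ` ?a ` A = ?b ` shift_label p ` A" if "A \<subseteq> C" for A
    unfolding image_image[of "(`) (relabel n p)"] image_image[of ?b]
  proof (intro image_cong refl)
    fix c assume "c \<in> A"
    then have "c \<in> C" using that by blast
    then show "relabel n p ` ?a c = ?b (shift_label p c)" by (rule arc)
  qed
  have new: "?b (p, p + 1, k) = new_arc n p" by (simp add: new_arc_def)
  have "{(i, j, l) \<in> insert_label (p, k) C. l = 0} =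
      (if k = 0 then {(p, p + 1, k)} else {}) \<union> shift_label p ` {(i, j, l) \<in> C. l = 0}"
    by (auto simp: insert_label_def shift_label_def image_iff shift_eq_iff)
  then have 2: "?b ` {(i, j, l) \<in> insert_label (p, k) C. l = 0} =
     (if k = 0 then {new_arc n p} else {}) \<union> ?b ` shift_label p ` {(i, j, l) \<in> C. l = 0}"
    using new by (auto simp: image_Un)
  have 3: "?b ` insert_label (p, k) C = insert (new_arc n p) (?b ` shift_label p ` C)"
    using new by (simp add: insert_label_def)
  have 4: "{(i, j, l) \<in> C. l = 0} \<subseteq> C" by auto
  show ?thesis
    unfolding insert_arc_def labelling_diagram_def fst_conv snd_conv 1[OF order_refl] 1[OF 4] 2 3 ..
qed

lemma label_weight_insert:
  assumes C: "labelling n C"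
  shows "label_weight (insert_label (p, k) C) = qnum_s k * label_weight C"
proof -
  have "(p, p + 1, k) \<notin> shift_label p ` C"
    using shift_not_new[of p] unfolding shift_label_def by fastforce
  then have "label_weight (insert_label (p, k) C) = qnum_s k * (\<Prod>(i, j, k) \<in> shift_label p ` C. qnum_s k)"
    unfolding label_weight_def insert_label_def using finite_labelling[OF C] by simp
  also have "(\<Prod>(i, j, k) \<in> shift_label p ` C. qnum_s k) = label_weight C"
    unfolding label_weight_def
    by (subst prod.reindex[OF inj_on_subset[OF shift_label_inj subset_UNIV]])
      (simp add: shift_label_def split_def)
  finally show ?thesis .
qed

text \<open>The product of the [d]_s clears the denominators of all n levels of the recursion. One
  level is one insertion, and \<open>insert_label_bij\<close> turns pairs of an insertion and a
  labelling into labellings of the next size.\<close>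

lemma diag_sum_Q_labellings:
  "(\<Prod>d = 1..n. qnum_s d) * diag_sum n (Q_rep n) \<phi> =
     (\<Sum>C | labelling n C. label_weight C * \<phi> (labelling_diagram n C))"
proof (induction n arbitrary: \<phi>)
  case 0
  have "labelling 0 C \<longleftrightarrow> C = {}" for C
  proof
    assume "labelling 0 C"
    then show "C = {}" using labellingD(1)[of 0 C] by fastforce
  qed (simp add: labelling_def)
  then have "{C. labelling 0 C} = {{}}" by auto
  moreover have "labelling_diagram 0 {} = ({}, {})" by (auto simp: labelling_diagram_def)
  moreover have "letters 0 = []" by (simp add: zero_word_def)
  ultimately show ?case
    using diag_sum_single[of 0 0 1 \<phi>]
    by (simp add: label_weight_def id_diagram_def)
next
  case (Suc n)
  let ?F = "\<Prod>d = 1..n. qnum_s d" and ?S = "\<lambda>p d. diag_sum n (Q_rep n) (\<lambda>D. \<phi> (insert_arc n p d D))"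
  have S: "?F * ?S p (k = 0) = (\<Sum>C | labelling n C. label_weight C * \<phi> (labelling_diagram (n + 1) (insert_label (p, k) C)))" for p k
    unfolding Suc.IH by (intro sum.cong refl) (simp add: insert_labelling_diagram)
  have "(\<Prod>d = 1..Suc n. qnum_s d) * diag_sum (Suc n) (Q_rep (Suc n)) \<phi> =
     ?F * (qnum_s (n + 1) * diag_sum (n + 1) (Q_rep (n + 1)) \<phi>)"
    by (simp add: mult_ac)
  also have "\<dots> = ?F * (?S (2 * n + 1) True + (\<Sum>p = n + 1..2 * n + 1. qnum_s (2 * n + 2 - p) * ?S p False))"
    unfolding diag_sum_Q_Suc ..
  \<comment> \<open>As [0]_s = 1, the dotted term has the same shape as the others and joins the sum
    over \<open>moves n\<close>.\<close>
  also have "?S (2 * n + 1) True + (\<Sum>p = n + 1..2 * n + 1. qnum_s (2 * n + 2 - p) * ?S p False) =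
     (\<Sum>(p, k) \<in> moves n. qnum_s k * ?S p (k = 0))"
  proof -
    have "(\<Sum>(p, k) \<in> moves n. qnum_s k * ?S p (k = 0)) = qnum_s 0 * ?S (2 * n + 1) True +
        (\<Sum>(p, k) \<in> (\<lambda>p. (p, 2 * n + 2 - p)) ` {n + 1..2 * n + 1}. qnum_s k * ?S p (k = 0))"
      unfolding moves_def by (subst sum.insert) auto
    also have "(\<Sum>(p, k) \<in> (\<lambda>p. (p, 2 * n + 2 - p)) ` {n + 1..2 * n + 1}. qnum_s k * ?S p (k = 0)) =
       (\<Sum>p = n + 1..2 * n + 1. qnum_s (2 * n + 2 - p) * ?S p (2 * n + 2 - p = 0))"
      by (subst sum.reindex) (auto simp: inj_on_def)
    also have "\<dots> = (\<Sum>p = n + 1..2 * n + 1. qnum_s (2 * n + 2 - p) * ?S p False)"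
    proof (rule sum.cong[OF refl])
      fix p assume "p \<in> {n + 1..2 * n + 1}"
      then have "(2 * n + 2 - p = 0) = False" by auto
      then show "qnum_s (2 * n + 2 - p) * ?S p (2 * n + 2 - p = 0) = qnum_s (2 * n + 2 - p) * ?S p False" by (simp only:)
    qed
    finally show ?thesis by (simp add: qnum_s_def[of 0])
  qed
  also have "?F * (\<Sum>(p, k) \<in> moves n. qnum_s k * ?S p (k = 0)) = (\<Sum>(p, k) \<in> moves n. qnum_s k * (?F * ?S p (k = 0)))"
    by (simp add: sum_distrib_left split_def mult_ac)
  also have "\<dots> = (\<Sum>(p, k) \<in> moves n. \<Sum>C | labelling n C. label_weight (insert_label (p, k) C) * \<phi> (labelling_diagram (n + 1) (insert_label (p, k) C)))"
    unfolding S sum_distrib_left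
    by (intro sum.cong refl) (auto intro!: sum.cong simp: label_weight_insert mult_ac)
  also have "\<dots> = (\<Sum>(m, C) \<in> moves n \<times> {C. labelling n C}. label_weight (insert_label m C) * \<phi> (labelling_diagram (n + 1) (insert_label m C)))"
    by (subst sum.cartesian_product[symmetric]) (simp add: split_def)
  also have "\<dots> = (\<Sum>C | labelling (n + 1) C. label_weight C * \<phi> (labelling_diagram (n + 1) C))"
    using sum.reindex_bij_betw[OF insert_label_bij, of "\<lambda>C. label_weight C * \<phi> (labelling_diagram (n + 1) C)"]
    by (simp add: split_def)
  finally show ?case by simp
qed

section \<open>Heights and columns\<close>

text \<open>One diagram, seen only through the pairs of folded positions of its arcs:
  \<open>P\<close> for all arcs and \<open>E\<close> for the dotted ones. Its tilings and its
  labellings are compared inside this locale.\<close>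

locale noncrossing_arcs =
  fixes n :: nat and P E :: "(nat \<times> nat) set" and mu :: "step list"
  assumes range: "(i, j) \<in> P \<Longrightarrow> 1 \<le> i \<and> i < j \<and> j \<le> 2 * n"
    and disjoint: "(i, j) \<in> P \<Longrightarrow> (i', j') \<in> P \<Longrightarrow> (i, j) = (i', j') \<or> {i, j} \<inter> {i', j'} = {}"
    and noncrossing: "(i, j) \<in> P \<Longrightarrow> (i', j') \<in> P \<Longrightarrow> i < i' \<Longrightarrow> i' < j \<Longrightarrow> j' < j"
    and cover: "1 \<le> x \<Longrightarrow> x \<le> 2 * n \<Longrightarrow> \<exists>i j. (i, j) \<in> P \<and> x \<in> {i, j}"
    and path: "mu = map (\<lambda>k. if k \<in> fst ` P then Up else Down) [1..<2 * n + 1]"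
    and dots: "E \<subseteq> P" "(i, j) \<in> E \<Longrightarrow> (i', j') \<in> P \<Longrightarrow> \<not> (i' < i \<and> j < j')"
begin

text \<open>The arcs passing over the gap between the folded points x and x + 1; their number is the
  height of the Dyck path at x (\<open>height_mu\<close>).\<close>

definition open_arcs :: "nat \<Rightarrow> (nat \<times> nat) set" where
  "open_arcs x = {(i, j) \<in> P. i \<le> x \<and> x < j}"

definition dep :: "nat \<Rightarrow> nat" where "dep x = card (open_arcs x)"

lemma finite_P: "finite P"
proof (rule finite_subset)
  show "P \<subseteq> {..2 * n} \<times> {..2 * n}" using range by fastforce
qed simp

lemma finite_open: "finite (open_arcs x)"
  unfolding open_arcs_def by (rule finite_subset[OF _ finite_P]) auto

lemma open_arcs_left:
  assumes "(i, j) \<in> P"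
  shows "open_arcs i = insert (i, j) (open_arcs (i - 1))" "(i, j) \<notin> open_arcs (i - 1)"
proof -
  note r = range[OF assms]
  show "(i, j) \<notin> open_arcs (i - 1)" using r by (auto simp: open_arcs_def)
  have "(a, b) \<in> open_arcs i \<longleftrightarrow> (a, b) \<in> insert (i, j) (open_arcs (i - 1))" for a b
  proof (cases "(a, b) = (i, j)")
    case False
    have "a \<noteq> i \<and> b \<noteq> i" if "(a, b) \<in> P" using disjoint[OF that assms] False by auto
    then show ?thesis using False r by (auto simp: open_arcs_def)
  qed (use assms r in \<open>auto simp: open_arcs_def\<close>)
  then show "open_arcs i = insert (i, j) (open_arcs (i - 1))" by auto
qed

lemma open_arcs_right:
  assumes "(i, j) \<in> P"
  shows "open_arcs (j - 1) = insert (i, j) (open_arcs j)" "(i, j) \<notin> open_arcs j"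
proof -
  note r = range[OF assms]
  show "(i, j) \<notin> open_arcs j" using r by (auto simp: open_arcs_def)
  have "(a, b) \<in> open_arcs (j - 1) \<longleftrightarrow> (a, b) \<in> insert (i, j) (open_arcs j)" for a b
  proof (cases "(a, b) = (i, j)")
    case False
    have "a \<noteq> j \<and> b \<noteq> j" if "(a, b) \<in> P" using disjoint[OF that assms] False by auto
    then show ?thesis using False r by (auto simp: open_arcs_def)
  qed (use assms r in \<open>auto simp: open_arcs_def\<close>)
  then show "open_arcs (j - 1) = insert (i, j) (open_arcs j)" by auto
qed

text \<open>By noncrossing, an arc that is open just before i is still open after j, and an arc that
  opens between i and j closes before j. So the depth of an arc can be read off at either
  end.\<close>

lemma open_arcs_ends:
  assumes "(i, j) \<in> P"
  shows "open_arcs (i - 1) = open_arcs j"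
proof -
  note r = range[OF assms]
  have "a \<le> i - 1 \<and> i - 1 < b \<longleftrightarrow> a \<le> j \<and> j < b" if ab: "(a, b) \<in> P" for a b
  proof (cases "(a, b) = (i, j)")
    case False
    then have d: "a \<noteq> i" "a \<noteq> j" "b \<noteq> i" "b \<noteq> j" using disjoint[OF ab assms] by auto
    show ?thesis
      using noncrossing[OF ab assms] noncrossing[OF assms ab] d r range[OF ab] by linarith
  qed (use r in auto)
  then show ?thesis unfolding open_arcs_def by auto
qed

lemma dep_arc:
  assumes "(i, j) \<in> P"
  shows "dep (i - 1) = dep j" "dep i = dep j + 1" "dep (j - 1) = dep j + 1"
    "i \<le> x \<Longrightarrow> x < j \<Longrightarrow> dep j < dep x"
proof -
  show "dep (i - 1) = dep j" unfolding dep_def open_arcs_ends[OF assms] ..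
  then show "dep i = dep j + 1" using open_arcs_left[OF assms] finite_open by (simp add: dep_def)
  show "dep (j - 1) = dep j + 1" using open_arcs_right[OF assms] finite_open by (simp add: dep_def)
  assume x: "i \<le> x" "x < j"
  have "insert (i, j) (open_arcs j) \<subseteq> open_arcs x"
  proof -
    have "a \<le> x" if "(a, b) \<in> open_arcs j" for a b
      using that x range[OF assms] unfolding open_arcs_ends[OF assms, symmetric] by (auto simp: open_arcs_def)
    moreover have "x < b" if "(a, b) \<in> open_arcs j" for a b
      using that x by (auto simp: open_arcs_def)
    ultimately show ?thesis using assms x by (auto simp: open_arcs_def)
  qed
  then have "card (insert (i, j) (open_arcs j)) \<le> dep x"
    unfolding dep_def by (intro card_mono finite_open)
  then show "dep j < dep x" using open_arcs_right(2)[OF assms] finite_open by (simp add: dep_def)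
qed

lemma dep_0: "dep 0 = 0" and dep_end: "dep (2 * n) = 0"
proof -
  have "open_arcs 0 = {}" "open_arcs (2 * n) = {}" unfolding open_arcs_def using range by fastforce+
  then show "dep 0 = 0" "dep (2 * n) = 0" by (simp_all add: dep_def)
qed

lemma step_cases:
  assumes "x < 2 * n"
  obtains (Up) j where "(x + 1, j) \<in> P" "dep (x + 1) = dep x + 1"
  | (Down) i where "(i, x + 1) \<in> P" "dep x = dep (x + 1) + 1"
proof -
  obtain i j where ij: "(i, j) \<in> P" "x + 1 \<in> {i, j}" using cover[of "x + 1"] assms by auto
  show ?thesis
  proof (cases "x + 1 = i")
    case True
    then show ?thesis using Up[of j] ij dep_arc(1,2)[OF ij(1)] by auto
  next
    case False
    then show ?thesis using Down[of i] ij dep_arc(3)[OF ij(1)] by auto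
  qed
qed

lemma not_left_end: "(i, j) \<in> P \<Longrightarrow> j \<notin> fst ` P"
  using disjoint range by fastforce

lemma even_dep: "x \<le> 2 * n \<Longrightarrow> even (dep x + x)"
proof (induction x)
  case (Suc x)
  then have "x < 2 * n" by simp
  then show ?case using Suc by (cases rule: step_cases) auto
qed (simp add: dep_0)

lemma height_mu: "x \<le> 2 * n \<Longrightarrow> height mu x = int (dep x)"
proof (induction x)
  case 0
  show ?case by (simp add: height_def dep_0)
next
  case (Suc x)
  then have x: "x < 2 * n" by simp
  have "length mu = 2 * n" by (simp add: path)
  then have "height mu (Suc x) = height mu x + step_val (mu ! x)"
    using x by (simp add: height_def take_Suc_conv_app_nth)
  also have "mu ! x = (if x + 1 \<in> fst ` P then Up else Down)"
    unfolding path using x by (subst nth_map) (simp_all del: upt_Suc)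
  finally have h: "height mu (Suc x) = int (dep x) + step_val (if x + 1 \<in> fst ` P then Up else Down)"
    using Suc by simp
  from x show ?case
  proof (cases rule: step_cases)
    case (Up j)
    then have "x + 1 \<in> fst ` P" by force
    then show ?thesis using h Up by simp
  next
    case (Down i)
    then show ?thesis using h not_left_end[OF Down(1)] by simp
  qed
qed

section \<open>Boxes of the region by column and layer\<close>

definition top_height :: "nat \<Rightarrow> nat" where "top_height x = min x (2 * n - x)"

lemma height_top:
  assumes "x \<le> 2 * n"
  shows "height (replicate n Up @ replicate n Down) x = int (top_height x)"
proof -
  show ?thesis using assms unfolding height_def top_height_def
    by (cases "x \<le> n") (simp_all add: sum_list_replicate)
qed

lemma dep_le: "x \<le> 2 * n \<Longrightarrow> dep x \<le> top_height x"
proof -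
  have 1: "x \<le> 2 * n \<Longrightarrow> dep x \<le> x" for x
  proof (induction x)
    case (Suc x)
    then have "x < 2 * n" by simp
    then show ?case using Suc by (cases rule: step_cases) auto
  qed (simp add: dep_0)
  have 2: "y \<le> 2 * n \<Longrightarrow> dep (2 * n - y) \<le> y" for y
  proof (induction y)
    case (Suc y)
    then have "2 * n - Suc y < 2 * n" "2 * n - Suc y + 1 = 2 * n - y" by auto
    then show ?case using Suc by (cases rule: step_cases) auto
  qed (simp add: dep_end)
  show "x \<le> 2 * n \<Longrightarrow> dep x \<le> top_height x" using 1[of x] 2[of "2 * n - x"] by (simp add: top_height_def)
qed

definition layers :: "nat \<Rightarrow> nat" where "layers x = (top_height x - dep x) div 2"

lemma layers: "x \<le> 2 * n \<Longrightarrow> dep x + 2 * layers x = top_height x"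
proof -
  assume x: "x \<le> 2 * n"
  have "even (top_height x + x)" using x by (cases "x \<le> n") (auto simp: top_height_def)
  then have "even (top_height x - dep x)" using even_dep[OF x] dep_le[OF x] by (auto simp: even_diff_nat)
  then show ?thesis using dep_le[OF x] unfolding layers_def by auto
qed

text \<open>Layers are counted in each column upward from the path. Translation by (0,-2) then
  lowers the layer by one, and consecutive columns of one layer form a translate of a piece of the
  path.\<close>

definition box :: "nat \<Rightarrow> nat \<Rightarrow> box" where
  "box x l = (int x, int (dep x) + 2 * int l + 1)"

lemma box_inj: "box x l = box y m \<longleftrightarrow> x = y \<and> l = m"
  by (auto simp: box_def)

lemma region_eq: "region n mu = {box x l | x l. x \<le> 2 * n \<and> l < layers x}"
proof -
  have "(a, b) \<in> region n mu \<longleftrightarrow> (\<exists>x l. (a, b) = box x l \<and> x \<le> 2 * n \<and> l < layers x)" for a b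
  proof
    assume r: "(a, b) \<in> region n mu"
    define x where "x = nat a"
    have x: "a = int x" "x \<le> 2 * n" using r by (auto simp: region_def x_def)
    have b: "odd (a + b)" "int (dep x) \<le> b - 1" "b + 1 \<le> int (top_height x)"
      using r x height_mu[OF x(2)] height_top[OF x(2)] unfolding region_def by auto
    have "even (int (dep x) + int x)" using even_dep[OF x(2)] by (metis of_nat_add even_of_nat)
    then have ev: "even (b - 1 - int (dep x))" using b(1) x(1) by auto
    define l where "l = nat ((b - 1 - int (dep x)) div 2)"
    have l: "b = int (dep x) + 2 * int l + 1" using ev b(2) unfolding l_def by auto
    then have "l < layers x" using b(3) layers[OF x(2)] by linarith
    then show "\<exists>x l. (a, b) = box x l \<and> x \<le> 2 * n \<and> l < layers x" using x l by (auto simp: box_def)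
  next
    assume "\<exists>x l. (a, b) = box x l \<and> x \<le> 2 * n \<and> l < layers x"
    then obtain x l where x: "a = int x" "b = int (dep x) + 2 * int l + 1" "x \<le> 2 * n" "l < layers x"
      by (auto simp: box_def)
    have "even (int (dep x) + int x)" using even_dep[OF x(3)] by (metis of_nat_add even_of_nat)
    then have "odd (a + b)" using x by auto
    then show "(a, b) \<in> region n mu"
      using x height_mu[OF x(3)] height_top[OF x(3)] layers[OF x(3)] by (auto simp: region_def)
  qed
  then show ?thesis by auto
qed

lemma box_region: "box x l \<in> region n mu \<longleftrightarrow> x \<le> 2 * n \<and> l < layers x"
  unfolding region_eq by (auto simp: box_inj)

lemma region_boxE:
  assumes "c \<in> region n mu"
  obtains x l where "c = box x l" "x \<le> 2 * n" "l < layers x"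
  using assms unfolding region_eq by blast

text \<open>\<open>g t\<close> counts the layers in which the columns \<open>t - 1\<close> and \<open>t\<close> belong to the same tile.\<close>

definition gluings :: "(nat \<Rightarrow> nat) set" where
  "gluings = {g. (\<forall>t. t = 0 \<or> 2 * n < t \<longrightarrow> g t = 0) \<and>
     (\<forall>i j. (i, j) \<in> P \<longrightarrow> g j = g i \<and> (\<forall>t. i < t \<longrightarrow> t < j \<longrightarrow> g i \<le> g t)) \<and>
     (\<forall>t. 1 \<le> t \<longrightarrow> t \<le> 2 * n \<longrightarrow> g t \<le> layers (t - 1) \<and> g t \<le> layers t) \<and>
     (\<forall>i j. (i, j) \<in> E \<longrightarrow> g i = 0)}"

definition joined :: "(nat \<Rightarrow> nat) \<Rightarrow> nat \<Rightarrow> nat \<Rightarrow> nat \<Rightarrow> bool" where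
  "joined g l x y \<longleftrightarrow> (\<forall>t. min x y < t \<longrightarrow> t \<le> max x y \<longrightarrow> l < g t)"

definition tile :: "(nat \<Rightarrow> nat) \<Rightarrow> nat \<Rightarrow> nat \<Rightarrow> box set" where
  "tile g x l = {box y l | y. joined g l x y}"

definition tiling_of :: "(nat \<Rightarrow> nat) \<Rightarrow> box set set" where
  "tiling_of g = {tile g x l | x l. x \<le> 2 * n \<and> l < layers x}"

lemma gluingsD:
  assumes "g \<in> gluings"
  shows "t = 0 \<or> 2 * n < t \<Longrightarrow> g t = 0"
    "(i, j) \<in> P \<Longrightarrow> g j = g i" "(i, j) \<in> P \<Longrightarrow> i < t \<Longrightarrow> t < j \<Longrightarrow> g i \<le> g t"
    "1 \<le> t \<Longrightarrow> t \<le> 2 * n \<Longrightarrow> g t \<le> layers (t - 1) \<and> g t \<le> layers t"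
    "(i, j) \<in> E \<Longrightarrow> g i = 0"
proof -
  note * = assms[unfolded gluings_def mem_Collect_eq]
  show "t = 0 \<or> 2 * n < t \<Longrightarrow> g t = 0" by (rule mp[OF spec[OF conjunct1[OF *]]])
  show "(i, j) \<in> P \<Longrightarrow> g j = g i" "(i, j) \<in> P \<Longrightarrow> i < t \<Longrightarrow> t < j \<Longrightarrow> g i \<le> g t"
    using conjunct1[OF conjunct2[OF *]] by blast+
  show "1 \<le> t \<Longrightarrow> t \<le> 2 * n \<Longrightarrow> g t \<le> layers (t - 1) \<and> g t \<le> layers t"
    using conjunct1[OF conjunct2[OF conjunct2[OF *]]] by blast
  show "(i, j) \<in> E \<Longrightarrow> g i = 0"
    using conjunct2[OF conjunct2[OF conjunct2[OF *]]] by blast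
qed

lemma joined_refl: "joined g l x x"
  by (simp add: joined_def)

lemma joined_sym: "joined g l x y \<Longrightarrow> joined g l y x"
  by (simp add: joined_def min.commute max.commute)

lemma joined_trans: "joined g l x y \<Longrightarrow> joined g l y z \<Longrightarrow> joined g l x z"
  unfolding joined_def
proof (intro allI impI)
  fix t
  assume *: "\<forall>t. min x y < t \<longrightarrow> t \<le> max x y \<longrightarrow> l < g t" "\<forall>t. min y z < t \<longrightarrow> t \<le> max y z \<longrightarrow> l < g t"
    and t: "min x z < t" "t \<le> max x z"
  have "x < t \<and> t \<le> z \<or> z < t \<and> t \<le> x"
    using t by (auto simp: min_def max_def split: if_splits)
  then consider "y < t" "t \<le> z" | "y < t" "t \<le> x" | "t \<le> y" "x < t" | "t \<le> y" "z < t"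
    by linarith
  then show "l < g t"
  proof cases
    case 1
    show ?thesis by (rule *(2)[rule_format]) (use 1 in simp_all)
  next
    case 2
    show ?thesis by (rule *(1)[rule_format]) (use 2 in simp_all)
  next
    case 3
    show ?thesis by (rule *(1)[rule_format]) (use 3 in simp_all)
  next
    case 4
    show ?thesis by (rule *(2)[rule_format]) (use 4 in simp_all)
  qed
qed

lemma joined_between: "joined g l x y \<Longrightarrow> x \<le> z \<Longrightarrow> z \<le> y \<Longrightarrow> joined g l x z"
  by (auto simp: joined_def)

lemma joined_mono:
  assumes "joined g l x y" "m \<le> l"
  shows "joined g m x y"
  unfolding joined_def
proof (intro allI impI)
  fix t assume "min x y < t" "t \<le> max x y"
  with assms(1) have "l < g t" unfolding joined_def by blast
  with assms(2) show "m < g t" by linarith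
qed

lemma joined_region:
  assumes g: "g \<in> gluings" and x: "x \<le> 2 * n" "l < layers x" and j: "joined g l x y"
  shows "y \<le> 2 * n" "l < layers y"
proof -
  have "y \<le> 2 * n \<and> l < layers y"
  proof (cases "x = y")
    case False
    consider "x < y" | "y < x" using False by linarith
    then show ?thesis
    proof cases
      case 1
      then have "l < g y" using j by (auto simp: joined_def)
      moreover have "y \<le> 2 * n" using gluingsD(1)[OF g, of y] \<open>l < g y\<close> by (cases "2 * n < y") auto
      ultimately show ?thesis using gluingsD(4)[OF g, of y] 1 by auto
    next
      case 2
      then have "l < g (y + 1)" using j by (auto simp: joined_def)
      then show ?thesis using gluingsD(4)[OF g, of "y + 1"] 2 x by auto
    qed
  qed (use x in auto)
  then show "y \<le> 2 * n" "l < layers y" by auto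
qed

lemma tile_eq: "joined g l x y \<Longrightarrow> tile g x l = tile g y l"
  unfolding tile_def using joined_trans joined_sym by blast

lemma box_tile: "box y m \<in> tile g x l \<longleftrightarrow> m = l \<and> joined g l x y"
  by (auto simp: tile_def box_inj)

lemma tiling_of_partition:
  assumes g: "g \<in> gluings"
  shows "partition_on (region n mu) (tiling_of g)"
proof (rule partition_onI)
  show "\<Union> (tiling_of g) = region n mu"
  proof
    show "\<Union> (tiling_of g) \<subseteq> region n mu"
      unfolding tiling_of_def tile_def region_eq using joined_region[OF g] by blast
    show "region n mu \<subseteq> \<Union> (tiling_of g)"
    proof
      fix c assume "c \<in> region n mu"
      then obtain x l where c: "c = box x l" "x \<le> 2 * n" "l < layers x" by (rule region_boxE)
      then have "c \<in> tile g x l" by (simp add: box_tile joined_refl)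
      then show "c \<in> \<Union> (tiling_of g)" using c unfolding tiling_of_def by blast
    qed
  qed
  show "{} \<notin> tiling_of g"
  proof
    assume "{} \<in> tiling_of g"
    then obtain x l where "{} = tile g x l" by (auto simp: tiling_of_def)
    moreover have "box x l \<in> tile g x l" by (simp add: box_tile joined_refl)
    ultimately show False by blast
  qed
  show "disjnt d d'" if dd: "d \<in> tiling_of g" "d' \<in> tiling_of g" "d \<noteq> d'" for d d'
  proof (rule ccontr)
    assume "\<not> disjnt d d'"
    then obtain c where c: "c \<in> d" "c \<in> d'" unfolding disjnt_def by blast
    obtain x l x' l' where t: "d = tile g x l" "d' = tile g x' l'" using dd by (auto simp: tiling_of_def)
    obtain y where "c = box y l" "joined g l x y" using c(1) t(1) by (auto simp: tile_def)
    moreover from this have "l' = l" "joined g l x' y" using c(2) t(2) by (auto simp: box_tile)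
    ultimately have "d = d'" using t tile_eq[of g l x y] tile_eq[of g l x' y] by simp
    then show False using dd by simp
  qed
qed

end

section \<open>Cover-inclusive tilings as gluings\<close>

lemma finite_downset_eq:
  fixes S :: "nat set"
  assumes "finite S" "\<And>l. Suc l \<in> S \<Longrightarrow> l \<in> S"
  shows "S = {..<card S}"
proof -
  obtain m where m: "m \<notin> S" "\<forall>l < m. l \<in> S"
  proof -
    have "\<exists>m. m \<notin> S" using assms(1) ex_new_if_finite infinite_UNIV_nat by metis
    then show ?thesis using that[of "LEAST m. m \<notin> S"] not_less_Least by (metis (mono_tags, lifting) LeastI)
  qed
  have "m + k \<notin> S" for k
    by (induction k) (use m assms(2) in auto)
  then have "S = {..<m}" using m(2) by (metis le_add_diff_inverse lessThan_iff not_less subsetI subset_antisym)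
  then show ?thesis by simp
qed

context noncrossing_arcs
begin

lemma strip_dyck_tile:
  assumes u: "u \<le> v" "v \<le> 2 * n" "dep u = dep v" and low: "\<And>y. u \<le> y \<Longrightarrow> y \<le> v \<Longrightarrow> dep u \<le> dep y"
  shows "dyck_tile ((v - u) div 2) {box y l | y. u \<le> y \<and> y \<le> v}"
  unfolding dyck_tile_def
proof (intro exI[of _ "\<lambda>k. box (u + k) l"] conjI allI impI)
  have "even (dep u + u + (dep v + v))" using even_dep[of u] even_dep[of v] u by simp
  then have "even (v - u)" using u(1,3) by auto
  then have m: "2 * ((v - u) div 2) = v - u" by simp
  show "{box y l | y. u \<le> y \<and> y \<le> v} = (\<lambda>k. box (u + k) l) ` {..2 * ((v - u) div 2)}"
  proof
    show "{box y l | y. u \<le> y \<and> y \<le> v} \<subseteq> (\<lambda>k. box (u + k) l) ` {..2 * ((v - u) div 2)}"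
    proof
      fix c assume "c \<in> {box y l | y. u \<le> y \<and> y \<le> v}"
      then obtain y where "c = box y l" "u \<le> y" "y \<le> v" by blast
      then show "c \<in> (\<lambda>k. box (u + k) l) ` {..2 * ((v - u) div 2)}"
        unfolding m by (intro image_eqI[of _ _ "y - u"]) auto
    qed
  qed (use m u in force)
  show "box (u + (k + 1)) l - box (u + k) l \<in> {(1, 1), (1, - 1)}" if "k < 2 * ((v - u) div 2)" for k
  proof -
    have "u + k < 2 * n" using that m u by linarith
    then show ?thesis by (cases rule: step_cases) (auto simp: box_def)
  qed
  show "snd (box (u + 0) l) \<le> snd (box (u + k) l)" if "k \<le> 2 * ((v - u) div 2)" for k
    using that m u low[of "u + k"] by (simp add: box_def)
  show "snd (box (u + 2 * ((v - u) div 2)) l) = snd (box (u + 0) l)"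
    using m u by (simp add: box_def)
qed

text \<open>The hypothesis says that an arc with one end among u + 1, ..., v has both ends there. So
  the same arcs pass over both borders of the strip, and these pass over everything between.\<close>

lemma strip_dep:
  assumes u: "u \<le> v" "v \<le> 2 * n"
    and closed: "\<And>i j t. (i, j) \<in> P \<Longrightarrow> t \<in> {i, j} \<Longrightarrow> u < t \<Longrightarrow> t \<le> v \<Longrightarrow> u < i \<and> j \<le> v"
  shows "dep u = dep v" "u \<le> y \<Longrightarrow> y \<le> v \<Longrightarrow> dep u \<le> dep y"
proof -
  have sub: "open_arcs u \<subseteq> open_arcs y" if "u \<le> y" "y \<le> v" for y
  proof
    fix a assume a: "a \<in> open_arcs u"
    then obtain i j where ij: "a = (i, j)" "(i, j) \<in> P" "i \<le> u" "u < j" by (auto simp: open_arcs_def)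
    then have "v < j" using closed[OF ij(2), of j] by force
    then show "a \<in> open_arcs y" using ij that by (auto simp: open_arcs_def)
  qed
  have "open_arcs v \<subseteq> open_arcs u"
  proof
    fix a assume a: "a \<in> open_arcs v"
    then obtain i j where ij: "a = (i, j)" "(i, j) \<in> P" "i \<le> v" "v < j" by (auto simp: open_arcs_def)
    then have "i \<le> u" using closed[OF ij(2), of i] by force
    then show "a \<in> open_arcs u" using ij u by (auto simp: open_arcs_def)
  qed
  then show "dep u = dep v" unfolding dep_def using sub[of v] u by (metis order_refl subset_antisym)
  show "u \<le> y \<Longrightarrow> y \<le> v \<Longrightarrow> dep u \<le> dep y"
    unfolding dep_def using sub by (intro card_mono finite_open)
qed

lemma joined_step: "joined g l x (x + 1) \<longleftrightarrow> l < g (x + 1)"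
proof -
  have "x < t \<and> t \<le> x + 1 \<longleftrightarrow> t = x + 1" for t by linarith
  moreover have "min x (x + 1) = x" "max x (x + 1) = x + 1" by simp_all
  ultimately show ?thesis unfolding joined_def by metis
qed

text \<open>A tile is a maximal run of columns glued in layer l. If one end of an arc lies inside
  the run, the monotonicity in \<open>gluings\<close> glues all boundaries between its two ends; so
  the arc lies entirely in the run, and \<open>strip_dep\<close> makes the path below the run a Dyck
  path.\<close>

lemma tile_strip:
  assumes g: "g \<in> gluings" and x: "x \<le> 2 * n" "l < layers x"
  obtains u v where "u \<le> x" "x \<le> v" "v \<le> 2 * n" "tile g x l = {box y l | y. u \<le> y \<and> y \<le> v}"
    "\<not> l < g u" "dep u = dep v" "\<And>y. u \<le> y \<Longrightarrow> y \<le> v \<Longrightarrow> dep u \<le> dep y"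
proof -
  define U where "U = {y. joined g l x y}"
  have fin: "finite U" by (rule finite_subset[of _ "{..2 * n}"]) (use joined_region[OF g x] in \<open>auto simp: U_def\<close>)
  have xU: "x \<in> U" by (simp add: U_def joined_refl)
  define u v where "u = Min U" and "v = Max U"
  have uv: "u \<in> U" "v \<in> U" using Min_in[OF fin] Max_in[OF fin] xU unfolding u_def v_def by auto
  have lim: "u \<le> y \<and> y \<le> v" if "y \<in> U" for y
    using that fin unfolding u_def v_def by simp
  have bd: "u \<le> x" "x \<le> v" "v \<le> 2 * n" using lim[OF xU] uv(2) joined_region(1)[OF g x] by (auto simp: U_def)
  have juv: "joined g l u v" using uv joined_trans[OF joined_sym] unfolding U_def by blast
  have U: "y \<in> U \<longleftrightarrow> u \<le> y \<and> y \<le> v" for y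
  proof
    assume "u \<le> y \<and> y \<le> v"
    then have "joined g l u y" using joined_between[OF juv] by blast
    then show "y \<in> U" using uv(1) joined_trans unfolding U_def by blast
  qed (rule lim)
  have inside: "l < g t" if "u < t" "t \<le> v" for t
    using juv that bd unfolding joined_def by simp
  have gu: "\<not> l < g u"
  proof
    assume "l < g u"
    then have "u \<noteq> 0" using gluingsD(1)[OF g, of 0] by (metis not_less_zero)
    then have "joined g l (u - 1) u" using joined_step[of g l "u - 1"] \<open>l < g u\<close> by simp
    then have "u - 1 \<in> U" using uv(1) joined_trans[OF _ joined_sym] unfolding U_def by blast
    then show False using U \<open>u \<noteq> 0\<close> by auto
  qed
  have gv: "\<not> l < g (v + 1)"
  proof
    assume "l < g (v + 1)"
    then have "joined g l v (v + 1)" using joined_step by blast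
    then have "v + 1 \<in> U" using uv(2) joined_trans unfolding U_def by blast
    then show False using U by auto
  qed
  have closed: "u < i \<and> j \<le> v" if ij: "(i, j) \<in> P" and t: "t \<in> {i, j}" "u < t" "t \<le> v" for i j t
  proof -
    note r = range[OF ij]
    have gt: "l < g i" "l < g j" using inside[OF t(2,3)] t(1) gluingsD(2)[OF g ij] by auto
    have all: "l < g s" if s: "i \<le> s" "s \<le> j" for s
    proof -
      consider "s = i" | "s = j" | "i < s" "s < j" using s by linarith
      then show ?thesis using gt gluingsD(3)[OF g ij, of s] by cases auto
    qed
    have "u < i"
    proof (rule ccontr)
      assume "\<not> u < i"
      then have "i \<le> u" "u \<le> j" using t r by auto
      then show False using all gu by blast
    qed
    moreover have "j \<le> v"
    proof (rule ccontr)
      assume "\<not> j \<le> v"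
      then have "i \<le> v + 1" "v + 1 \<le> j" using t r by auto
      then show False using all gv by blast
    qed
    ultimately show ?thesis by blast
  qed
  have "u \<le> v" using bd by simp
  have dp1: "dep u = dep v" by (rule strip_dep(1)[OF \<open>u \<le> v\<close> bd(3)]) (rule closed)
  have dp2: "dep u \<le> dep y" if "u \<le> y" "y \<le> v" for y
    by (rule strip_dep(2)[OF \<open>u \<le> v\<close> bd(3) _ that]) (rule closed)
  have "tile g x l = {box y l | y. u \<le> y \<and> y \<le> v}"
    unfolding tile_def using U unfolding U_def by auto
  from that[OF bd this gu dp1 dp2] show thesis by blast
qed

lemma strip_height:
  assumes "u \<le> v" "\<And>y. u \<le> y \<Longrightarrow> y \<le> v \<Longrightarrow> dep u \<le> dep y"
  shows "tile_height {box y l | y. u \<le> y \<and> y \<le> v} = dep u + 2 * l + 1"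
proof -
  have "snd ` {box y l | y. u \<le> y \<and> y \<le> v} = (\<lambda>y. int (dep y) + 2 * int l + 1) ` {u..v}"
    by (auto simp: box_def image_iff)
  moreover have "Min ((\<lambda>y. int (dep y) + 2 * int l + 1) ` {u..v}) = int (dep u) + 2 * int l + 1"
    using assms by (intro Min_eqI) auto
  ultimately show ?thesis unfolding tile_height_def by (simp add: nat_add_distrib nat_mult_distrib)
qed

definition good_tilings :: "box set set set" where
  "good_tilings = {T \<in> ci_dyck_tilings n mu. \<forall>i j. (i, j) \<in> E \<longrightarrow>
     \<not> (\<exists>d. dyck_tile ((j - i + 1) div 2) d \<and> Min (fst ` d) = int i - 1 \<and> Max (fst ` d) = int j \<and> contains_dyck_tile T d)}"

lemma shift_down_box: "0 < l \<Longrightarrow> shift_down {box y l | y. Q y} = {box y (l - 1) | y. Q y}"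
  unfolding shift_down_def box_def by (auto simp: image_iff)

text \<open>The tiling is cover-inclusive because a boundary glued in layer l is glued in all lower
  layers. Dots are respected because a tile reaching from column i - 1 to column j would be glued at
  boundary i, where g is zero.\<close>

lemma tiling_of_good:
  assumes g: "g \<in> gluings"
  shows "tiling_of g \<in> good_tilings"
  unfolding good_tilings_def ci_dyck_tilings_def mem_Collect_eq
proof (intro conjI allI impI notI)
  show "dyck_tiling n mu (tiling_of g)"
    unfolding dyck_tiling_def
  proof (intro conjI ballI tiling_of_partition[OF g])
    fix d assume "d \<in> tiling_of g"
    then obtain x l where x: "d = tile g x l" "x \<le> 2 * n" "l < layers x" by (auto simp: tiling_of_def)
    obtain u v where uv: "u \<le> x" "x \<le> v" "v \<le> 2 * n" "tile g x l = {box y l | y. u \<le> y \<and> y \<le> v}"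
      "\<not> l < g u" "dep u = dep v" "\<And>y. u \<le> y \<Longrightarrow> y \<le> v \<Longrightarrow> dep u \<le> dep y"
      by (rule tile_strip[OF g x(2,3)]) blast
    then have "u \<le> v" by simp
    from strip_dyck_tile[OF this uv(3,6,7)] show "\<exists>m. dyck_tile m d" unfolding x(1) uv(4) by blast
  qed
  show "cover_inclusive mu (tiling_of g)"
    unfolding cover_inclusive_def
  proof
    fix d assume "d \<in> tiling_of g"
    then obtain x l where x: "d = tile g x l" "x \<le> 2 * n" "l < layers x" by (auto simp: tiling_of_def)
    show "below_path mu (shift_down d) \<or> (\<exists>d'\<in>tiling_of g. shift_down d \<subseteq> d')"
    proof (cases "l = 0")
      case True
      have "b + 1 \<le> height mu (nat a)" if ab: "(a, b) \<in> shift_down d" for a b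
      proof -
        obtain y where y: "joined g l x y" "(a, b) = (\<lambda>(a, b). (a, b - 2)) (box y l)"
          using ab unfolding shift_down_def x(1) tile_def by blast
        then have "y \<le> 2 * n" using joined_region[OF g x(2,3)] by blast
        then show ?thesis using y(2) True height_mu[of y] by (auto simp: box_def)
      qed
      then show ?thesis unfolding below_path_def by blast
    next
      case False
      have "shift_down d = {box y (l - 1) | y. joined g l x y}"
        unfolding x(1) tile_def using False by (intro shift_down_box) simp
      also have "\<dots> \<subseteq> tile g x (l - 1)"
        unfolding tile_def using joined_mono[of g l x _ "l - 1"] by auto
      finally have "shift_down d \<subseteq> tile g x (l - 1)" .
      moreover have "tile g x (l - 1) \<in> tiling_of g"
        unfolding tiling_of_def using x by (intro CollectI exI[of _ x] exI[of _ "l - 1"]) auto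
      ultimately show ?thesis by blast
    qed
  qed
  fix i j assume ij: "(i, j) \<in> E"
  assume "\<exists>d. dyck_tile ((j - i + 1) div 2) d \<and> Min (fst ` d) = int i - 1 \<and> Max (fst ` d) = int j \<and> contains_dyck_tile (tiling_of g) d"
  then obtain d where d: "dyck_tile ((j - i + 1) div 2) d" "Min (fst ` d) = int i - 1" "Max (fst ` d) = int j"
    "contains_dyck_tile (tiling_of g) d" by blast
  obtain x l where x: "d \<subseteq> tile g x l" using d(4) unfolding contains_dyck_tile_def tiling_of_def by blast
  have "finite d" "d \<noteq> {}" using d(1) unfolding dyck_tile_def by auto
  then have "int i - 1 \<in> fst ` d" "int j \<in> fst ` d" using Min_in[of "fst ` d"] Max_in[of "fst ` d"] d(2,3) by auto
  then have "int i - 1 \<in> fst ` tile g x l" "int j \<in> fst ` tile g x l" using x by auto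
  then obtain y z where "joined g l x y" "int i - 1 = int y" "joined g l x z" "int j = int z"
    by (auto simp: tile_def box_def)
  moreover have r: "1 \<le> i" "i < j" using range[of i j] ij dots(1) by auto
  ultimately have "joined g l (i - 1) j" using joined_trans[OF joined_sym, of g l x y z]
    by (metis One_nat_def int_ops(6) nat_int of_nat_1 of_nat_eq_iff zero_less_one_class.zero_le_one of_nat_diff)
  then have "l < g i" unfolding joined_def using r by simp
  then show False using gluingsD(5)[OF g ij] by simp
qed

text \<open>The gluing is visible in the tiling: l < g t holds iff the boxes of layer l in the
  columns t - 1 and t share a tile. If two gluings differ at t, the smaller value is a layer that
  tells them apart.\<close>

lemma tiling_of_inj: "inj_on tiling_of gluings"
proof -
  have le: "g t \<le> g' t" if g: "g \<in> gluings" and g': "g' \<in> gluings" and eq: "tiling_of g = tiling_of g'" for g g' t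
  proof (rule ccontr)
    assume "\<not> g t \<le> g' t"
    then have lt: "g' t < g t" by simp
    have t: "1 \<le> t" "t \<le> 2 * n"
      using gluingsD(1)[OF g, of t] lt by (metis One_nat_def Suc_leI neq0_conv not_less_zero, metis not_less not_less_zero)
    define l where "l = g' t"
    have l: "l < g t" "\<not> l < g' t" using lt by (auto simp: l_def)
    then have x: "t - 1 \<le> 2 * n" "l < layers (t - 1)" using gluingsD(4)[OF g t] t by auto
    then have "tile g (t - 1) l \<in> tiling_of g" unfolding tiling_of_def by blast
    then have "tile g (t - 1) l \<in> tiling_of g'" unfolding eq .
    then obtain x' l' where x': "tile g (t - 1) l = tile g' x' l'" by (auto simp: tiling_of_def)
    have "joined g l (t - 1) t" using joined_step[of g l "t - 1"] t l by simp
    then have "box (t - 1) l \<in> tile g (t - 1) l" "box t l \<in> tile g (t - 1) l"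
      by (simp_all add: box_tile joined_refl)
    then have "joined g' l x' (t - 1)" "joined g' l x' t" unfolding x' by (simp_all add: box_tile)
    then have "joined g' l (t - 1) t" using joined_trans[OF joined_sym] by blast
    then have "l < g' t" using joined_step[of g' l "t - 1"] t by simp
    then show False using l by simp
  qed
  show ?thesis
  proof (rule inj_onI, rule ext)
    fix g g' t assume "g \<in> gluings" "g' \<in> gluings" "tiling_of g = tiling_of g'"
    then show "g t = g' t" using le[of g g' t] le[of g' g t] by simp
  qed
qed

section \<open>Every admissible tiling comes from a gluing\<close>

context
  fixes T assumes T: "T \<in> good_tilings"
begin

lemma good_tiling:
  shows "\<Union> T = region n mu" "d \<in> T \<Longrightarrow> d' \<in> T \<Longrightarrow> c \<in> d \<Longrightarrow> c \<in> d' \<Longrightarrow> d = d'"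
    "d \<in> T \<Longrightarrow> \<exists>m. dyck_tile m d" "d \<in> T \<Longrightarrow> below_path mu (shift_down d) \<or> (\<exists>d'\<in>T. shift_down d \<subseteq> d')"
    "d \<in> T \<Longrightarrow> d \<noteq> {}"
proof -
  have 1: "dyck_tiling n mu T" "cover_inclusive mu T"
    using T unfolding good_tilings_def ci_dyck_tilings_def by auto
  then have 2: "partition_on (region n mu) T" "\<And>d. d \<in> T \<Longrightarrow> \<exists>m. dyck_tile m d" by (auto simp: dyck_tiling_def)
  show "\<Union> T = region n mu" using partition_onD1[OF 2(1)] by simp
  show "d \<in> T \<Longrightarrow> d' \<in> T \<Longrightarrow> c \<in> d \<Longrightarrow> c \<in> d' \<Longrightarrow> d = d'"
    using partition_onD2[OF 2(1)] unfolding disjoint_def by blast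
  show "d \<in> T \<Longrightarrow> \<exists>m. dyck_tile m d" by (rule 2(2))
  show "d \<in> T \<Longrightarrow> below_path mu (shift_down d) \<or> (\<exists>d'\<in>T. shift_down d \<subseteq> d')"
    using 1(2) unfolding cover_inclusive_def by blast
  show "d \<in> T \<Longrightarrow> d \<noteq> {}" using partition_onD3[OF 2(1)] by blast
qed

lemma good_boxE:
  assumes "d \<in> T" "c \<in> d"
  obtains x l where "c = box x l" "x \<le> 2 * n" "l < layers x"
  using assms good_tiling(1) region_boxE by blast

lemma below_path_layer:
  assumes "d \<in> T" "below_path mu (shift_down d)" "box x l \<in> d"
  shows "l = 0"
proof -
  have "x \<le> 2 * n" using assms(1,3) good_tiling(1) box_region by blast
  moreover have "(int x, int (dep x) + 2 * int l - 1) \<in> shift_down d"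
    using assms(3) unfolding shift_down_def box_def by force
  then have "int (dep x) + 2 * int l \<le> height mu (nat (int x))"
    using assms(2) unfolding below_path_def by fastforce
  ultimately show ?thesis using height_mu[of x] by simp
qed

lemma covered_layer:
  assumes "d \<in> T" "\<not> below_path mu (shift_down d)"
  obtains d' where "d' \<in> T" "\<And>x l. box x l \<in> d \<Longrightarrow> 0 < l \<and> box x (l - 1) \<in> d'"
proof -
  obtain d' where d': "d' \<in> T" "shift_down d \<subseteq> d'" using good_tiling(4)[OF assms(1)] assms(2) by blast
  have "0 < l \<and> box x (l - 1) \<in> d'" if "box x l \<in> d" for x l
  proof -
    have "(int x, int (dep x) + 2 * int l - 1) \<in> shift_down d"
      using that unfolding shift_down_def box_def by force
    then have in_d': "(int x, int (dep x) + 2 * int l - 1) \<in> d'" using d'(2) by blast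
    then obtain y m where "(int x, int (dep x) + 2 * int l - 1) = box y m" using good_boxE[OF d'(1)] by metis
    then have "x = y" "l = m + 1" by (auto simp: box_def)
    then show ?thesis using in_d' by (simp add: box_def add_ac)
  qed
  then show ?thesis using that d'(1) by blast
qed

text \<open>As long as a tile is not pushed below the path, its translate downward stays inside one
  tile; and when a tile is pushed below the path, all its boxes are in layer 0. So all boxes of a
  tile need the same number of translations to reach the path.\<close>

lemma tile_layer:
  assumes "d \<in> T" "box x l \<in> d" "box y k \<in> d"
  shows "k = l"
  using assms
proof (induction l arbitrary: d x y k)
  case 0
  have "below_path mu (shift_down d)"
  proof (rule ccontr)
    assume "\<not> below_path mu (shift_down d)"
    then obtain d' where "\<And>x l. box x l \<in> d \<Longrightarrow> 0 < l \<and> box x (l - 1) \<in> d'"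
      by (rule covered_layer[OF 0(1)]) blast
    from this[OF 0(2)] show False by simp
  qed
  then show ?case using below_path_layer 0 by blast
next
  case (Suc l)
  have "\<not> below_path mu (shift_down d)" using below_path_layer[OF Suc.prems(1) _ Suc.prems(2)] by blast
  then obtain d' where d': "d' \<in> T" "\<And>x l. box x l \<in> d \<Longrightarrow> 0 < l \<and> box x (l - 1) \<in> d'"
    by (rule covered_layer[OF Suc.prems(1)]) blast
  then have "k - 1 = l" using Suc.IH[OF d'(1), of x y "k - 1"] d'(2)[OF Suc.prems(2)] d'(2)[OF Suc.prems(3)] by simp
  moreover have "0 < k" using d'(2)[OF Suc.prems(3)] by blast
  ultimately show ?case by simp
qed

text \<open>Consecutive boxes of a Dyck tile lie in neighbouring columns and, by
  \<open>tile_layer\<close>, in one layer; so the tile is the part of this layer over an interval of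
  columns.\<close>

lemma good_strip:
  assumes d: "d \<in> T" and c: "box x l \<in> d"
  obtains u v where "u \<le> x" "x \<le> v" "v \<le> 2 * n" "d = {box y l | y. u \<le> y \<and> y \<le> v}"
    "dep u = dep v" "\<And>y. u \<le> y \<Longrightarrow> y \<le> v \<Longrightarrow> dep u \<le> dep y"
proof -
  obtain m where "dyck_tile m d" using good_tiling(3)[OF d] by blast
  then obtain b where b: "d = b ` {..2 * m}" "\<And>k. k < 2 * m \<Longrightarrow> b (k + 1) - b k \<in> {(1, 1), (1, - 1)}"
    "\<And>k. k \<le> 2 * m \<Longrightarrow> snd (b 0) \<le> snd (b k)" "snd (b (2 * m)) = snd (b 0)"
    unfolding dyck_tile_def by blast
  obtain u l0 where u: "b 0 = box u l0" using good_boxE[OF d] b(1) by blast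
  have bk: "b k = box (u + k) l \<and> u + k \<le> 2 * n" if kk: "k \<le> 2 * m" for k
  proof -
    have "fst (b k) = int (u + k)"
      using kk
    proof (induction k)
      case 0
      then show ?case by (simp add: u box_def)
    next
      case (Suc k)
      have "fst d = 1" if "d \<in> {(1, 1), (1, - 1)}" for d :: box using that by auto
      from this[OF b(2)[of k]] have "fst (b (k + 1)) - fst (b k) = 1" using Suc.prems by simp
      then show ?case using Suc by simp
    qed
    moreover obtain y m where "b k = box y m" "y \<le> 2 * n" using good_boxE[OF d, of "b k"] b(1) kk by blast
    moreover from this have "m = l" using tile_layer[OF d c] b(1) kk by (metis atMost_iff image_eqI)
    ultimately have "int y = int (u + k)" "m = l" "y \<le> 2 * n" "b k = box y m" by (auto simp: box_def)
    moreover from this have "y = u + k" by linarith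
    ultimately show ?thesis by simp
  qed
  have deq: "d = {box y l | y. u \<le> y \<and> y \<le> u + 2 * m}"
  proof
    show "d \<subseteq> {box y l | y. u \<le> y \<and> y \<le> u + 2 * m}" unfolding b(1) using bk by auto
    show "{box y l | y. u \<le> y \<and> y \<le> u + 2 * m} \<subseteq> d"
    proof
      fix c assume "c \<in> {box y l | y. u \<le> y \<and> y \<le> u + 2 * m}"
      then obtain y where "c = box y l" "u \<le> y" "y \<le> u + 2 * m" by blast
      then have "c = b (y - u)" "y - u \<le> 2 * m" using bk[of "y - u"] by auto
      then show "c \<in> d" unfolding b(1) by blast
    qed
  qed
  have "u \<le> x" "x \<le> u + 2 * m" using c unfolding deq by (auto simp: box_inj)
  moreover have "u + 2 * m \<le> 2 * n" using bk[of "2 * m"] by simp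
  moreover have "dep u = dep (u + 2 * m)" using b(4) bk[of 0] bk[of "2 * m"] by (simp add: box_def)
  moreover have "dep u \<le> dep y" if "u \<le> y" "y \<le> u + 2 * m" for y
    using b(3)[of "y - u"] bk[of 0] bk[of "y - u"] that by (simp add: box_def)
  ultimately show thesis using that deq by blast
qed

definition glued :: "nat \<Rightarrow> nat \<Rightarrow> bool" where
  "glued t l \<longleftrightarrow> 1 \<le> t \<and> (\<exists>d\<in>T. box (t - 1) l \<in> d \<and> box t l \<in> d)"

definition gluing_of :: "nat \<Rightarrow> nat" where
  "gluing_of t = card {l. glued t l}"

lemma glued_range:
  assumes "glued t l"
  shows "1 \<le> t" "t \<le> 2 * n" "l < layers (t - 1)" "l < layers t"
  using assms good_tiling(1) box_region unfolding glued_def by blast+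

lemma glued_Suc:
  assumes "glued t (Suc l)"
  shows "glued t l"
proof -
  obtain d where d: "1 \<le> t" "d \<in> T" "box (t - 1) (Suc l) \<in> d" "box t (Suc l) \<in> d" using assms unfolding glued_def by blast
  then have "\<not> below_path mu (shift_down d)" using below_path_layer by blast
  then obtain d' where d': "d' \<in> T" "\<And>x l. box x l \<in> d \<Longrightarrow> 0 < l \<and> box x (l - 1) \<in> d'"
    by (rule covered_layer[OF d(2)]) blast
  have "box (t - 1) l \<in> d'" "box t l \<in> d'" using d'(2)[OF d(3)] d'(2)[OF d(4)] by simp_all
  then show ?thesis unfolding glued_def using d(1) d'(1) by blast
qed

text \<open>By \<open>glued_Suc\<close>, which is cover-inclusiveness, the layers glued at t form an
  initial segment of the natural numbers and are described by their number.\<close>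

lemma glued_iff: "glued t l \<longleftrightarrow> l < gluing_of t"
proof -
  have "finite {l. glued t l}" by (rule finite_subset[of _ "{..<layers t}"]) (use glued_range in auto)
  then have "{l. glued t l} = {..<gluing_of t}"
    unfolding gluing_of_def using glued_Suc by (intro finite_downset_eq) auto
  then show ?thesis by auto
qed

text \<open>A Dyck tile ends at the height where it starts and never goes below it. If it crosses
  one end of the arc, it contains a column of the height just outside the arc; between i and j the
  path is strictly higher, so the tile can neither start nor end there and covers the whole
  arc.\<close>

lemma glued_arc:
  assumes ij: "(i, j) \<in> P" and t: "t \<in> {i, j}" "glued t l" and s: "i \<le> s" "s \<le> j"
  shows "glued s l" "\<exists>d\<in>T. {box y l | y. i - 1 \<le> y \<and> y \<le> j} \<subseteq> d"
proof -
  note r = range[OF ij]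
  obtain d where d: "d \<in> T" "box (t - 1) l \<in> d" "box t l \<in> d" using t(2) unfolding glued_def by blast
  obtain u v where uv: "u \<le> t" "t \<le> v" "v \<le> 2 * n" "d = {box y l | y. u \<le> y \<and> y \<le> v}"
    "dep u = dep v" "\<And>y. u \<le> y \<Longrightarrow> y \<le> v \<Longrightarrow> dep u \<le> dep y"
    by (rule good_strip[OF d(1,3)]) blast
  have ut: "u \<le> t - 1" using d(2) unfolding uv(4) by (auto simp: box_inj)
  have "u \<le> i - 1 \<and> j \<le> v"
  proof (cases "t = i")
    case True
    have "dep u \<le> dep j" using uv(6)[of "i - 1"] ut uv(2) True dep_arc(1)[OF ij] by simp
    moreover have "j \<le> v"
    proof (rule ccontr)
      assume "\<not> j \<le> v"
      then have "dep j < dep v" using dep_arc(4)[OF ij, of v] uv(2) True by simp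
      then show False using \<open>dep u \<le> dep j\<close> uv(5) by simp
    qed
    ultimately show ?thesis using ut True by simp
  next
    case False
    then have tj: "t = j" using t(1) by simp
    have "dep u \<le> dep j" using uv(6)[of j] uv(1,2) tj by simp
    moreover have "u \<le> i - 1"
    proof (rule ccontr)
      assume "\<not> u \<le> i - 1"
      then have "dep j < dep u" using dep_arc(4)[OF ij, of u] ut tj r by simp
      then show False using \<open>dep u \<le> dep j\<close> by simp
    qed
    ultimately show ?thesis using uv(2) tj by simp
  qed
  then have sub: "{box y l | y. i - 1 \<le> y \<and> y \<le> j} \<subseteq> d" unfolding uv(4) by auto
  then show "\<exists>d\<in>T. {box y l | y. i - 1 \<le> y \<and> y \<le> j} \<subseteq> d" using d(1) by blast
  have "i - 1 \<le> s - 1" "s - 1 \<le> j" "i - 1 \<le> s" using s by auto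
  then have "box (s - 1) l \<in> d" "box s l \<in> d" using sub s(2) by blast+
  then show "glued s l" unfolding glued_def using d(1) s r by auto
qed

lemma gluing_of_gluings: "gluing_of \<in> gluings"
  unfolding gluings_def mem_Collect_eq
proof (intro conjI allI impI)
  fix t assume "t = 0 \<or> 2 * n < t"
  then have "\<not> glued t 0" using glued_range[of t 0] by auto
  then show "gluing_of t = 0" unfolding glued_iff by simp
next
  fix i j assume ij: "(i, j) \<in> P"
  note r = range[OF ij]
  have "l < gluing_of j \<longleftrightarrow> l < gluing_of i" for l
    using glued_arc(1)[OF ij, of i l j] glued_arc(1)[OF ij, of j l i] r unfolding glued_iff by auto
  then show "gluing_of j = gluing_of i" by (metis less_irrefl nat_neq_iff)
  fix t assume t: "i < t" "t < j"
  show "gluing_of i \<le> gluing_of t"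
  proof (rule ccontr)
    assume "\<not> gluing_of i \<le> gluing_of t"
    then have "glued i (gluing_of t)" unfolding glued_iff by simp
    then have "glued t (gluing_of t)" using glued_arc(1)[OF ij, of i _ t] t by simp
    then show False unfolding glued_iff by simp
  qed
next
  fix t assume "1 \<le> t" "t \<le> 2 * n"
  show "gluing_of t \<le> layers (t - 1)" "gluing_of t \<le> layers t"
    using glued_range(3,4)[of t] unfolding glued_iff by (meson less_irrefl not_less)+
next
  fix i j assume ij: "(i, j) \<in> E"
  then have P: "(i, j) \<in> P" using dots(1) by blast
  note r = range[OF P]
  show "gluing_of i = 0"
  proof (rule ccontr)
    assume "gluing_of i \<noteq> 0"
    then have "glued i 0" unfolding glued_iff by simp
    then obtain d where d: "d \<in> T" "{box y 0 | y. i - 1 \<le> y \<and> y \<le> j} \<subseteq> d"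
      using glued_arc(2)[OF P, of i 0 i] r by auto
    \<comment> \<open>The part of layer 0 over the columns of a dotted arc is a Dyck tile of the
      size of the arc: the tile that the dot forbids.\<close>
    let ?d = "{box y 0 | y. i - 1 \<le> y \<and> y \<le> j}"
    have low: "dep (i - 1) \<le> dep y" if "i - 1 \<le> y" "y \<le> j" for y
    proof -
      consider "y = i - 1" | "y = j" | "i \<le> y" "y < j" using \<open>i - 1 \<le> y\<close> \<open>y \<le> j\<close> r by linarith
      then show ?thesis using dep_arc(1)[OF P] dep_arc(4)[OF P, of y] by cases auto
    qed
    have len: "j - (i - 1) = j - i + 1" using r by linarith
    have "dyck_tile ((j - (i - 1)) div 2) ?d"
      using r low dep_arc(1)[OF P] by (intro strip_dyck_tile) auto
    then have d1: "dyck_tile ((j - i + 1) div 2) ?d" unfolding len .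
    have cols: "fst ` ?d = int ` {i - 1..j}" by (auto simp: box_def image_iff)
    have "Min (int ` {i - 1..j}) = int (i - 1)"
    proof (rule Min_eqI)
      show "int (i - 1) \<in> int ` {i - 1..j}" using r by (intro imageI) auto
    qed auto
    then have d2: "Min (fst ` ?d) = int i - 1" unfolding cols using r by simp
    have d3: "Max (fst ` ?d) = int j" unfolding cols using r by (intro Max_eqI) auto
    have d4: "contains_dyck_tile T ?d" unfolding contains_dyck_tile_def using d by blast
    from d1 d2 d3 d4 have "\<exists>d. dyck_tile ((j - i + 1) div 2) d \<and> Min (fst ` d) = int i - 1 \<and> Max (fst ` d) = int j \<and> contains_dyck_tile T d"
      by blast
    then show False using T ij unfolding good_tilings_def by blast
  qed
qed

lemma good_tile_eq:
  assumes d: "d \<in> T" and c: "box x l \<in> d"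
  shows "d = tile gluing_of x l"
proof -
  obtain u v where uv: "u \<le> x" "x \<le> v" "v \<le> 2 * n" "d = {box y l | y. u \<le> y \<and> y \<le> v}"
    by (rule good_strip[OF d c]) blast
  have 1: "joined gluing_of l x y" if y: "u \<le> y" "y \<le> v" for y
    unfolding joined_def
  proof (intro allI impI)
    fix t assume "min x y < t" "t \<le> max x y"
    then have "u < t" "t \<le> v" using uv(1,2) y by (auto simp: min_less_iff_disj le_max_iff_disj)
    then have "box (t - 1) l \<in> d" "box t l \<in> d" unfolding uv(4) by auto
    then have "glued t l" unfolding glued_def using d \<open>u < t\<close> by auto
    then show "l < gluing_of t" by (simp add: glued_iff)
  qed
  have up: "box (x + k) l \<in> d" if "joined gluing_of l x (x + k)" for k
    using that
  proof (induction k)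
    case 0
    then show ?case using c by simp
  next
    case (Suc k)
    then have "box (x + k) l \<in> d" using joined_between[of gluing_of l x "x + Suc k" "x + k"] by simp
    moreover have "glued (x + Suc k) l" using Suc.prems unfolding glued_iff joined_def by simp
    then obtain d' where "d' \<in> T" "box (x + k) l \<in> d'" "box (x + Suc k) l \<in> d'" unfolding glued_def by auto
    ultimately show ?case using good_tiling(2)[OF d] by blast
  qed
  have down: "box (x - k) l \<in> d" if "joined gluing_of l x (x - k)" "k \<le> x" for k
    using that
  proof (induction k)
    case 0
    then show ?case using c by simp
  next
    case (Suc k)
    have "joined gluing_of l (x - Suc k) (x - k)"
      using joined_between[OF joined_sym[OF Suc.prems(1)], of "x - k"] by simp
    then have "joined gluing_of l x (x - k)" using joined_trans[OF Suc.prems(1)] by blast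
    then have "box (x - k) l \<in> d" using Suc by simp
    moreover have "glued (x - k) l" using Suc.prems unfolding glued_iff joined_def by simp
    then obtain d' where "d' \<in> T" "box (x - k - 1) l \<in> d'" "box (x - k) l \<in> d'" unfolding glued_def by auto
    ultimately have "box (x - k - 1) l \<in> d" using good_tiling(2)[OF d] by blast
    then show ?case by simp
  qed
  have 2: "box y l \<in> d" if "joined gluing_of l x y" for y
  proof (cases "x \<le> y")
    case True
    then show ?thesis using up[of "y - x"] that by simp
  next
    case False
    then show ?thesis using down[of "x - y"] that by simp
  qed
  show ?thesis
  proof
    show "d \<subseteq> tile gluing_of x l" unfolding uv(4) tile_def using 1 by blast
    show "tile gluing_of x l \<subseteq> d" unfolding tile_def using 2 by blast
  qed
qed

lemma good_tiling_eq: "T = tiling_of gluing_of"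
proof
  show "T \<subseteq> tiling_of gluing_of"
  proof
    fix d assume d: "d \<in> T"
    then obtain c where "c \<in> d" using good_tiling(5) by blast
    then obtain x l where "c = box x l" "x \<le> 2 * n" "l < layers x" using good_boxE[OF d] by blast
    then show "d \<in> tiling_of gluing_of" using good_tile_eq[OF d] \<open>c \<in> d\<close> unfolding tiling_of_def by blast
  qed
  show "tiling_of gluing_of \<subseteq> T"
  proof
    fix d assume "d \<in> tiling_of gluing_of"
    then obtain x l where x: "d = tile gluing_of x l" "x \<le> 2 * n" "l < layers x" unfolding tiling_of_def by blast
    then have "box x l \<in> \<Union> T" using good_tiling(1) box_region by simp
    then obtain d' where "d' \<in> T" "box x l \<in> d'" by blast
    then show "d \<in> T" using good_tile_eq x(1) by metis
  qed
qed

end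

lemma tiling_of_bij: "bij_betw tiling_of gluings good_tilings"
  unfolding bij_betw_def
proof (intro conjI tiling_of_inj)
  show "tiling_of ` gluings = good_tilings"
  proof
    show "tiling_of ` gluings \<subseteq> good_tilings" using tiling_of_good by blast
    show "good_tilings \<subseteq> tiling_of ` gluings" using good_tiling_eq gluing_of_gluings by blast
  qed
qed

end

section \<open>Weights of tilings\<close>

definition tiling_weight :: "box set set \<Rightarrow> qs_field" where
  "tiling_weight T = (\<Prod>d\<in>T. qnum_s (tile_height d) / qnum_s (tile_height d + 1))"

context noncrossing_arcs
begin

text \<open>The factor of a tile of which this box is the lowest one.\<close>

definition box_weight :: "nat \<Rightarrow> nat \<Rightarrow> qs_field" where
  "box_weight x l = qnum_s (dep x + 2 * l + 1) / qnum_s (dep x + 2 * l + 2)"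

lemma box_weight_nonzero: "box_weight x l \<noteq> 0"
  using qnum_s_nonzero by (simp add: box_weight_def)

lemma prod_ends:
  fixes F :: "nat \<Rightarrow> qs_field"
  shows "(\<Prod>x = 1..2 * n. F x) = (\<Prod>(i, j) \<in> P. F i * F j)"
proof -
  have fin: "finite (fst ` P)" "finite (snd ` P)" using finite_P by auto
  have un: "{1..2 * n} = fst ` P \<union> snd ` P"
  proof
    show "{1..2 * n} \<subseteq> fst ` P \<union> snd ` P"
    proof
      fix x assume "x \<in> {1..2 * n}"
      then obtain i j where "(i, j) \<in> P" "x \<in> {i, j}" using cover[of x] by auto
      then show "x \<in> fst ` P \<union> snd ` P" by force
    qed
    have "1 \<le> i \<and> i \<le> 2 * n \<and> 1 \<le> j \<and> j \<le> 2 * n" if "(i, j) \<in> P" for i j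
      using range[OF that] by linarith
    then show "fst ` P \<union> snd ` P \<subseteq> {1..2 * n}" by fastforce
  qed
  have "x \<notin> fst ` P" if "x \<in> snd ` P" for x
    using that not_left_end by (metis imageE prod.collapse)
  then have dis: "fst ` P \<inter> snd ` P = {}" by blast
  have inj: "inj_on fst P" "inj_on snd P"
    using disjoint by (auto simp: inj_on_def) blast+
  have "(\<Prod>x = 1..2 * n. F x) = (\<Prod>x\<in>fst ` P. F x) * (\<Prod>x\<in>snd ` P. F x)"
    unfolding un by (rule prod.union_disjoint[OF fin dis])
  also have "\<dots> = (\<Prod>a\<in>P. F (fst a)) * (\<Prod>a\<in>P. F (snd a))"
    by (simp add: prod.reindex[OF inj(1)] prod.reindex[OF inj(2)])
  finally show ?thesis by (simp add: prod.distrib split_def)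
qed

text \<open>Each tile is represented by its leftmost box, which is also its lowest one.\<close>

lemma tiling_weight_columns:
  assumes g: "g \<in> gluings"
  shows "tiling_weight (tiling_of g) = (\<Prod>x\<le>2 * n. \<Prod>l\<in>{g x..<layers x}. box_weight x l)"
proof -
  let ?I = "SIGMA x:{..2 * n}. {g x..<layers x}"
  have height: "tile_height (tile g x l) = dep x + 2 * l + 1" if xl: "(x, l) \<in> ?I" for x l
  proof -
    have x: "x \<le> 2 * n" "l < layers x" "\<not> l < g x" using xl by auto
    obtain u v where uv: "u \<le> x" "x \<le> v" "v \<le> 2 * n" "tile g x l = {box y l | y. u \<le> y \<and> y \<le> v}"
      "\<not> l < g u" "dep u = dep v" "\<And>y. u \<le> y \<Longrightarrow> y \<le> v \<Longrightarrow> dep u \<le> dep y"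
      by (rule tile_strip[OF g x(1,2)]) blast
    have "box u l \<in> tile g x l" unfolding uv(4) using uv(1,2) by auto
    then have "joined g l x u" by (simp add: box_tile)
    have "u = x"
    proof (rule ccontr)
      assume "u \<noteq> x"
      then have "u < x" using uv(1) by simp
      then have "l < g x" using \<open>joined g l x u\<close> unfolding joined_def by simp
      then show False using x by simp
    qed
    have "tile_height {box y l | y. u \<le> y \<and> y \<le> v} = dep u + 2 * l + 1"
      by (rule strip_height) (use uv in auto)
    then show ?thesis using uv(4) \<open>u = x\<close> by simp
  qed
  have "bij_betw (\<lambda>(x, l). tile g x l) ?I (tiling_of g)"
    unfolding bij_betw_def
  proof
    show "inj_on (\<lambda>(x, l). tile g x l) ?I"
    proof (rule inj_onI, clarsimp)
      fix x l x' l'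
      assume *: "g x \<le> l" "g x' \<le> l'" "tile g x l = tile g x' l'"
      have "box x l \<in> tile g x' l'" unfolding *(3)[symmetric] by (simp add: box_tile joined_refl)
      then have j: "l = l'" "joined g l x' x" by (auto simp: box_tile)
      have "\<not> x < x'" "\<not> x' < x" using j *(1,2) unfolding joined_def by auto
      then show "x = x' \<and> l = l'" using j by simp
    qed
    show "(\<lambda>(x, l). tile g x l) ` ?I = tiling_of g"
    proof
      show "(\<lambda>(x, l). tile g x l) ` ?I \<subseteq> tiling_of g"
      proof (rule image_subsetI)
        fix p assume "p \<in> ?I"
        then obtain x l where "p = (x, l)" "x \<le> 2 * n" "l < layers x" by auto
        then show "(\<lambda>(x, l). tile g x l) p \<in> tiling_of g"
          unfolding tiling_of_def by (intro CollectI exI[of _ x] exI[of _ l]) auto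
      qed
      show "tiling_of g \<subseteq> (\<lambda>(x, l). tile g x l) ` ?I"
      proof
        fix d assume "d \<in> tiling_of g"
        then obtain x l where x: "d = tile g x l" "x \<le> 2 * n" "l < layers x" by (auto simp: tiling_of_def)
        obtain u v where uv: "u \<le> x" "x \<le> v" "tile g x l = {box y l | y. u \<le> y \<and> y \<le> v}" "\<not> l < g u"
          by (rule tile_strip[OF g x(2,3)]) blast
        have "box u l \<in> tile g x l" unfolding uv(3) using uv(1,2) by auto
        then have "joined g l x u" by (simp add: box_tile)
        then have "d = tile g u l" "u \<le> 2 * n" "l < layers u"
          using tile_eq x(1) joined_region[OF g x(2,3)] by auto
        then show "d \<in> (\<lambda>(x, l). tile g x l) ` ?I" using uv(4) by (intro image_eqI[of _ _ "(u, l)"]) auto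
      qed
    qed
  qed
  then have "tiling_weight (tiling_of g) = (\<Prod>(x, l)\<in>?I. qnum_s (tile_height (tile g x l)) / qnum_s (tile_height (tile g x l) + 1))"
    unfolding tiling_weight_def by (subst prod.reindex_bij_betw[symmetric]) (auto simp: split_def)
  also have "\<dots> = (\<Prod>(x, l)\<in>?I. box_weight x l)"
    using height by (intro prod.cong refl) (auto simp: box_weight_def)
  also have "\<dots> = (\<Prod>x\<le>2 * n. \<Prod>l\<in>{g x..<layers x}. box_weight x l)"
    by (simp add: prod.Sigma)
  finally show ?thesis .
qed

text \<open>For an arc of depth a, layer l has the box weight [a+2l+2]_s / [a+2l+3]_s in column i,
  where the path is one higher, and [a+2l+1]_s / [a+2l+2]_s in column j. So each layer contributes
  [a+2l+1]_s / [a+2l+3]_s.\<close>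

lemma telescope:
  "(\<Prod>l<m. (qnum_s (a + 2 * l + 2) / qnum_s (a + 2 * l + 3)) * (qnum_s (a + 2 * l + 1) / qnum_s (a + 2 * l + 2)))
     * qnum_s (a + 1 + 2 * m) = qnum_s (a + 1)"
proof (induction m)
  case (Suc m)
  have e: "a + 1 + 2 * Suc m = a + 2 * m + 3" "a + 1 + 2 * m = a + 2 * m + 1" by auto
  have "(qnum_s (a + 2 * m + 2) / qnum_s (a + 2 * m + 3)) * (qnum_s (a + 2 * m + 1) / qnum_s (a + 2 * m + 2)) * qnum_s (a + 2 * m + 3)
     = qnum_s (a + 2 * m + 1)"
    using qnum_s_nonzero[of "a + 2 * m + 2"] qnum_s_nonzero[of "a + 2 * m + 3"] by (simp add: field_simps)
  then show ?case using Suc unfolding e prod.lessThan_Suc by (simp only: mult.assoc)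
qed simp

text \<open>The first product collects the boxes that are glued to their left neighbours and so no
  longer start a tile. The columns i and j of an arc are glued to the left in the same layers, hence
  these boxes pair off by arcs and each pair is an instance of \<open>telescope\<close>.\<close>

lemma glued_box_weights:
  assumes g: "g \<in> gluings"
  shows "(\<Prod>x\<le>2 * n. \<Prod>l<g x. box_weight x l) * (\<Prod>(i, j)\<in>P. qnum_s (dep j + 1 + 2 * g i)) = (\<Prod>(i, j)\<in>P. qnum_s (dep j + 1))"
proof -
  let ?F = "\<lambda>x. \<Prod>l<g x. box_weight x l"
  have "{..2 * n} = insert 0 {1..2 * n}" by auto
  then have "(\<Prod>x\<le>2 * n. ?F x) = ?F 0 * (\<Prod>x = 1..2 * n. ?F x)" by simp
  also have "?F 0 = 1" using gluingsD(1)[OF g, of 0] by simp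
  finally have "(\<Prod>x\<le>2 * n. ?F x) = (\<Prod>(i, j)\<in>P. ?F i * ?F j)" unfolding prod_ends by simp
  then have "(\<Prod>x\<le>2 * n. ?F x) * (\<Prod>(i, j)\<in>P. qnum_s (dep j + 1 + 2 * g i)) =
      (\<Prod>(i, j)\<in>P. ?F i * ?F j * qnum_s (dep j + 1 + 2 * g i))"
    by (simp add: prod.distrib split_def)
  also have "\<dots> = (\<Prod>(i, j)\<in>P. qnum_s (dep j + 1))"
  proof (rule prod.cong[OF refl], clarify)
    fix i j assume ij: "(i, j) \<in> P"
    have "?F i * ?F j = (\<Prod>l<g i. (qnum_s (dep j + 2 * l + 2) / qnum_s (dep j + 2 * l + 3)) * (qnum_s (dep j + 2 * l + 1) / qnum_s (dep j + 2 * l + 2)))"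
      unfolding gluingsD(2)[OF g ij] prod.distrib[symmetric] box_weight_def dep_arc(2)[OF ij]
      by (intro prod.cong refl) (simp add: eval_nat_numeral)
    then show "?F i * ?F j * qnum_s (dep j + 1 + 2 * g i) = qnum_s (dep j + 1)"
      by (simp only: telescope)
  qed
  finally show ?thesis .
qed

lemma top_height_Suc: "x < n \<Longrightarrow> top_height (x + 1) = top_height x + 1" "n \<le> x \<Longrightarrow> x < 2 * n \<Longrightarrow> top_height x = top_height (x + 1) + 1"
  by (auto simp: top_height_def)

lemma layers_0: "layers 0 = 0" and layers_end: "layers (2 * n) = 0"
  by (simp_all add: layers_def top_height_def)

text \<open>Numerators of column x + 1 against denominators of column x. After an up step they agree
  layer by layer; after a down step they agree with a shift by one layer, which leaves the lowest
  numerator, a factor of the arc that ends there. In the right half the descending upper border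
  removes one numerator, and the factor of \<open>top_height x\<close> restores it.\<close>

lemma column_step:
  assumes x: "x < 2 * n"
  shows "(\<Prod>l<layers (x + 1). qnum_s (dep (x + 1) + 2 * l + 1)) * (if n \<le> x then qnum_s (top_height x) else 1) =
     (\<Prod>l<layers x. qnum_s (dep x + 2 * l + 2)) * (if x + 1 \<in> snd ` P then qnum_s (dep (x + 1) + 1) else 1)"
proof -
  have L: "dep x + 2 * layers x = top_height x" "dep (x + 1) + 2 * layers (x + 1) = top_height (x + 1)"
    using layers[of x] layers[of "x + 1"] x by auto
  from x show ?thesis
  proof (cases rule: step_cases)
    case (Up j)
    have s: "x + 1 \<notin> snd ` P" using not_left_end Up(1) by force
    show ?thesis
    proof (cases "n \<le> x")
      case False
      then have "layers (x + 1) = layers x" using L Up(2) top_height_Suc(1)[of x] by linarith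
      then show ?thesis using False s Up(2) by simp
    next
      case True
      then have l: "layers x = Suc (layers (x + 1))" using L Up(2) top_height_Suc(2)[OF True x] by linarith
      have "top_height x = dep x + 2 * layers (x + 1) + 2" using L(1) l by simp
      then show ?thesis using True s Up(2) unfolding l prod.lessThan_Suc by simp
    qed
  next
    case (Down i)
    have s: "x + 1 \<in> snd ` P" using Down(1) by force
    show ?thesis
    proof (cases "n \<le> x")
      case False
      then have l: "layers (x + 1) = Suc (layers x)" using L Down(2) top_height_Suc(1)[of x] by linarith
      show ?thesis using False s Down(2) unfolding l prod.lessThan_Suc_shift by (simp add: mult_ac)
    next
      case True
      then have l: "layers (x + 1) = layers x" using L Down(2) top_height_Suc(2)[OF True x] by linarith
      have "(\<Prod>l<layers x. qnum_s (dep (x + 1) + 2 * l + 1)) * qnum_s (dep (x + 1) + 2 * layers x + 1) =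
         (\<Prod>l<Suc (layers x). qnum_s (dep (x + 1) + 2 * l + 1))" by simp
      also have "\<dots> = qnum_s (dep (x + 1) + 1) * (\<Prod>l<layers x. qnum_s (dep (x + 1) + 2 * l + 3))"
        unfolding prod.lessThan_Suc_shift by (simp add: eval_nat_numeral)
      finally show ?thesis using True s Down(2) L(1) l by (simp add: eval_nat_numeral mult_ac)
    qed
  qed
qed

text \<open>The weight of the tiling by unit boxes. The columns 0 and 2n are empty, so the product
  of the numerators can be shifted by one column, and \<open>column_step\<close> cancels it against
  the denominators; the upper border leaves [1]_s, ..., [n]_s and the right ends of the arcs leave
  the product on the right.\<close>

lemma all_box_weights:
  "(\<Prod>x\<le>2 * n. \<Prod>l<layers x. box_weight x l) * (\<Prod>d = 1..n. qnum_s d) = (\<Prod>(i, j)\<in>P. qnum_s (dep j + 1))"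
proof -
  let ?c = "\<lambda>x. \<Prod>l<layers x. qnum_s (dep x + 2 * l + 1)" and ?d = "\<lambda>x. \<Prod>l<layers x. qnum_s (dep x + 2 * l + 2)"
  have nz: "(\<Prod>x<2 * n. ?d x) \<noteq> 0" using qnum_s_nonzero by simp
  have c: "(\<Prod>x\<le>2 * n. ?c x) = (\<Prod>x<2 * n. ?c (x + 1))"
    unfolding lessThan_Suc_atMost[symmetric] prod.lessThan_Suc_shift by (simp add: layers_0)
  have d: "(\<Prod>x\<le>2 * n. ?d x) = (\<Prod>x<2 * n. ?d x)"
    unfolding lessThan_Suc_atMost[symmetric] prod.lessThan_Suc by (simp add: layers_end)
  have "(\<Prod>x<2 * n. ?c (x + 1)) * (\<Prod>x<2 * n. if n \<le> x then qnum_s (top_height x) else 1) =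
     (\<Prod>x<2 * n. ?d x) * (\<Prod>x<2 * n. if x + 1 \<in> snd ` P then qnum_s (dep (x + 1) + 1) else 1)"
    unfolding prod.distrib[symmetric] by (intro prod.cong refl column_step) simp
  also have "(\<Prod>x<2 * n. if n \<le> x then qnum_s (top_height x) else 1) = (\<Prod>d = 1..n. qnum_s d)"
  proof -
    have "(\<Prod>x<2 * n. if n \<le> x then qnum_s (top_height x) else 1) = (\<Prod>x = n..<2 * n. qnum_s (top_height x))"
      by (intro prod.mono_neutral_cong_right) auto
    also have "\<dots> = (\<Prod>d = 1..n. qnum_s d)"
      by (rule prod.reindex_bij_witness[of _ "\<lambda>d. 2 * n - d" "\<lambda>x. 2 * n - x"]) (auto simp: top_height_def)
    finally show ?thesis .
  qed
  also have "(\<Prod>x<2 * n. if x + 1 \<in> snd ` P then qnum_s (dep (x + 1) + 1) else 1) = (\<Prod>(i, j)\<in>P. qnum_s (dep j + 1))"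
  proof -
    let ?G = "\<lambda>x. if x \<in> snd ` P then qnum_s (dep x + 1) else 1"
    have "(\<Prod>x<2 * n. ?G (x + 1)) = (\<Prod>x = 1..2 * n. ?G x)"
      by (rule prod.reindex_bij_witness[of _ "\<lambda>x. x - 1" "\<lambda>x. x + 1"]) auto
    also have "\<dots> = (\<Prod>(i, j)\<in>P. ?G i * ?G j)" by (rule prod_ends)
    also have "\<dots> = (\<Prod>(i, j)\<in>P. qnum_s (dep j + 1))"
    proof (rule prod.cong[OF refl], clarify)
      fix i j assume ij: "(i, j) \<in> P"
      have "i \<notin> snd ` P" using not_left_end ij by force
      moreover have "j \<in> snd ` P" using ij by force
      ultimately show "?G i * ?G j = qnum_s (dep j + 1)" by simp
    qed
    finally show ?thesis .
  qed
  finally have main: "(\<Prod>x<2 * n. ?c (x + 1)) * (\<Prod>d = 1..n. qnum_s d) = (\<Prod>x<2 * n. ?d x) * (\<Prod>(i, j)\<in>P. qnum_s (dep j + 1))" .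
  have "(\<Prod>x\<le>2 * n. \<Prod>l<layers x. box_weight x l) = (\<Prod>x\<le>2 * n. ?c x) / (\<Prod>x\<le>2 * n. ?d x)"
    unfolding box_weight_def prod_dividef ..
  then have "(\<Prod>x\<le>2 * n. \<Prod>l<layers x. box_weight x l) * (\<Prod>d = 1..n. qnum_s d) =
      ((\<Prod>x<2 * n. ?c (x + 1)) * (\<Prod>d = 1..n. qnum_s d)) / (\<Prod>x<2 * n. ?d x)"
    unfolding c d by simp
  also have "\<dots> = (\<Prod>(i, j)\<in>P. qnum_s (dep j + 1))" unfolding main using nz by simp
  finally show ?thesis .
qed

text \<open>The weight of the unit box tiling is divided by the weights of the boxes that do not
  start a tile. The arc factors [a+1]_s cancel between \<open>all_box_weights\<close> and
  \<open>glued_box_weights\<close>.\<close>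

lemma tiling_weight_gluing:
  assumes g: "g \<in> gluings"
  shows "tiling_weight (tiling_of g) * (\<Prod>d = 1..n. qnum_s d) = (\<Prod>(i, j)\<in>P. qnum_s (dep j + 1 + 2 * g i))"
proof -
  let ?W = "\<Prod>x\<le>2 * n. \<Prod>l<g x. box_weight x l"
  have nz: "?W \<noteq> 0" using box_weight_nonzero by simp
  have le: "g x \<le> layers x" if "x \<le> 2 * n" for x
    using gluingsD(1)[OF g, of 0] gluingsD(4)[OF g, of x] that by (cases "x = 0") auto
  have "?W * tiling_weight (tiling_of g) = (\<Prod>x\<le>2 * n. (\<Prod>l<g x. box_weight x l) * (\<Prod>l\<in>{g x..<layers x}. box_weight x l))"
    unfolding tiling_weight_columns[OF g] prod.distrib ..
  also have "\<dots> = (\<Prod>x\<le>2 * n. \<Prod>l<layers x. box_weight x l)"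
  proof (rule prod.cong[OF refl])
    fix x assume "x \<in> {..2 * n}"
    then have "{..<layers x} = {..<g x} \<union> {g x..<layers x}" using le[of x] by auto
    then show "(\<Prod>l<g x. box_weight x l) * (\<Prod>l\<in>{g x..<layers x}. box_weight x l) = (\<Prod>l<layers x. box_weight x l)"
      by (simp add: prod.union_disjoint[symmetric] ivl_disj_int)
  qed
  finally have "?W * (tiling_weight (tiling_of g) * (\<Prod>d = 1..n. qnum_s d)) = (\<Prod>(i, j)\<in>P. qnum_s (dep j + 1))"
    using all_box_weights by (simp add: mult.assoc[symmetric])
  also have "\<dots> = ?W * (\<Prod>(i, j)\<in>P. qnum_s (dep j + 1 + 2 * g i))"
    using glued_box_weights[OF g] by simp
  finally show ?thesis using nz by simp
qed

end

section \<open>Labellings as gluings\<close>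

context noncrossing_arcs
begin

definition dotted_labellings :: "labelled_arcs set" where
  "dotted_labellings = {C. labelling n C \<and> (\<lambda>(i, j, k). (i, j)) ` C = P \<and> (\<lambda>(i, j, k). (i, j)) ` {(i, j, k) \<in> C. k = 0} = E}"

definition label_of :: "(nat \<Rightarrow> nat) \<Rightarrow> nat \<times> nat \<Rightarrow> nat" where
  "label_of g = (\<lambda>(i, j). if (i, j) \<in> E then 0 else dep j + 1 + 2 * g i)"

definition labelling_of :: "(nat \<Rightarrow> nat) \<Rightarrow> labelled_arcs" where
  "labelling_of g = (\<lambda>(i, j). (i, j, label_of g (i, j))) ` P"

lemma labelling_of_iff: "(i, j, k) \<in> labelling_of g \<longleftrightarrow> (i, j) \<in> P \<and> k = label_of g (i, j)"
  by (auto simp: labelling_of_def)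

lemma dotted_dep:
  assumes "(i, j) \<in> E"
  shows "dep j = 0"
proof -
  have ij: "(i, j) \<in> P" using assms dots(1) by blast
  note r = range[OF ij]
  have "open_arcs j = {}"
  proof (rule ccontr)
    assume "open_arcs j \<noteq> {}"
    then obtain a b where ab: "(a, b) \<in> open_arcs j" by auto
    then have "(a, b) \<in> P" "j < b" "a \<le> i - 1"
      using open_arcs_ends[OF ij] unfolding open_arcs_def by auto
    then show False using dots(2)[OF assms, of a b] r by auto
  qed
  then show ?thesis by (simp add: dep_def)
qed

lemma arc_parity: "(i, j) \<in> P \<Longrightarrow> odd (i + j)"
proof -
  assume ij: "(i, j) \<in> P"
  note r = range[OF ij]
  have "i - 1 \<le> 2 * n" using r by linarith
  then have "even (dep j + (i - 1) + (dep j + j))"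
    using even_dep[of "i - 1"] even_dep[of j] dep_arc(1)[OF ij] r by simp
  then have "even ((i - 1) + j)" by presburger
  then show ?thesis using r by (cases i) auto
qed

lemma labelling_of_dotted:
  assumes g: "g \<in> gluings"
  shows "labelling_of g \<in> dotted_labellings"
proof -
  have "labelling n (labelling_of g)"
    unfolding labelling_def labelling_of_iff
  proof (intro conjI allI impI; (elim conjE)?)
    { fix i j k assume ij: "(i, j) \<in> P" and k: "k = label_of g (i, j)"
      note r = range[OF ij]
      show "1 \<le> i" "i < j" "j \<le> 2 * n" using r by auto
      show odd: "odd (i + j)" by (rule arc_parity[OF ij])
      have "g i \<le> layers (i - 1)" "g j \<le> layers j"
        using gluingsD(4)[OF g, of i] gluingsD(4)[OF g, of j] r by auto
      moreover have "i - 1 \<le> 2 * n" using r by linarith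
      \<comment> \<open>These are the bounds on labels in disguise, because the upper border has
        height at most i - 1 at i - 1 and at most 2n - j at j.\<close>
      ultimately have b: "dep j + 2 * g i \<le> top_height (i - 1)" "dep j + 2 * g i \<le> top_height j"
        using layers[of "i - 1"] layers[of j] dep_arc(1)[OF ij] gluingsD(2)[OF g ij] r by auto
      then show "k \<le> i" "k + j \<le> 2 * n + 1"
        using r unfolding k label_of_def top_height_def by auto
      have "even (dep j + j)" using even_dep[of j] r by simp
      then have "even (i + (dep j + 1 + 2 * g i))" using odd by auto
      then show "k = 0 \<or> even (i + k)" unfolding k label_of_def by auto }
    { fix i j k i' j' k' assume ij: "(i, j) \<in> P" "k = label_of g (i, j)" and ij': "(i', j') \<in> P" "k' = label_of g (i', j')"
      show "(i, j, k) = (i', j', k') \<or> {i, j} \<inter> {i', j'} = {}"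
        using disjoint[OF ij(1) ij'(1)] ij(2) ij'(2) by auto
      assume lt: "i < i'" "i' < j"
      show j': "j' < j" by (rule noncrossing[OF ij(1) ij'(1) lt])
      \<comment> \<open>A dotted arc is outermost, so the inner arc has a positive label; the outer
        one may be dotted, which only lowers its label.\<close>
      have "(i', j') \<notin> E" using dots(2)[of i' j' i j] ij(1) lt j' by blast
      then have k': "k' = dep j' + 1 + 2 * g i'" by (simp add: ij'(2) label_of_def)
      have "dep j < dep j'" using dep_arc(4)[OF ij(1), of "i' - 1"] dep_arc(1)[OF ij'(1)] lt by auto
      moreover have "g i \<le> g i'" by (rule gluingsD(3)[OF g ij(1) lt])
      moreover have "k \<le> dep j + 1 + 2 * g i" by (simp add: ij(2) label_of_def)
      ultimately show "k < k'" unfolding k' by linarith }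
    { fix x assume "1 \<le> x" "x \<le> 2 * n"
      from cover[OF this] obtain i j where "(i, j) \<in> P" "x \<in> {i, j}" by blast
      then show "\<exists>i j k. ((i, j) \<in> P \<and> k = label_of g (i, j)) \<and> x \<in> {i, j}" by blast }
  qed
  moreover have "(\<lambda>(i, j, k). (i, j)) ` labelling_of g = P"
    by (force simp: labelling_of_def)
  moreover have "(\<lambda>(i, j, k). (i, j)) ` {(i, j, k) \<in> labelling_of g. k = 0} = E"
  proof -
    have "{(i, j, k) \<in> labelling_of g. k = 0} = (\<lambda>(i, j). (i, j, 0)) ` E"
      using dots(1) by (auto simp: labelling_of_iff label_of_def split: if_splits)
    then show ?thesis by force
  qed
  ultimately show ?thesis unfolding dotted_labellings_def by blast
qed

text \<open>The label of a dotted arc does not show g, but there g is zero by the last condition in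
  \<open>gluings\<close>.\<close>

lemma labelling_of_inj: "inj_on labelling_of gluings"
proof (rule inj_onI, rule ext)
  fix g g' t assume g: "g \<in> gluings" and g': "g' \<in> gluings" and eq: "labelling_of g = labelling_of g'"
  show "g t = g' t"
  proof (cases "1 \<le> t \<and> t \<le> 2 * n")
    case True
    then obtain i j where ij: "(i, j) \<in> P" "t \<in> {i, j}" using cover by blast
    have "(i, j, label_of g (i, j)) \<in> labelling_of g'" unfolding eq[symmetric] labelling_of_iff using ij by simp
    then have "label_of g (i, j) = label_of g' (i, j)" by (simp add: labelling_of_iff)
    then have "g i = g' i" using gluingsD(5)[OF g, of i j] gluingsD(5)[OF g', of i j]
      by (auto simp: label_of_def split: if_splits)
    then show ?thesis using ij gluingsD(2)[OF g ij(1)] gluingsD(2)[OF g' ij(1)] by auto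
  next
    case False
    then have "t = 0 \<or> 2 * n < t" by auto
    then show ?thesis using gluingsD(1)[OF g] gluingsD(1)[OF g'] by simp
  qed
qed

section \<open>The gluing read off from a labelling\<close>

context
  fixes C assumes C: "C \<in> dotted_labellings"
begin

lemma dotted_labelling:
  shows "labelling n C" "(i, j, k) \<in> C \<Longrightarrow> (i, j) \<in> P" "(i, j) \<in> P \<Longrightarrow> \<exists>k. (i, j, k) \<in> C"
    "(i, j, 0) \<in> C \<longleftrightarrow> (i, j) \<in> E"
proof -
  have c: "labelling n C" "(\<lambda>(i, j, k). (i, j)) ` C = P" "(\<lambda>(i, j, k). (i, j)) ` {(i, j, k) \<in> C. k = 0} = E"
    using C unfolding dotted_labellings_def by auto
  show "labelling n C" by (rule c(1))
  show "(i, j, k) \<in> C \<Longrightarrow> (i, j) \<in> P" unfolding c(2)[symmetric] by force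
  show "(i, j) \<in> P \<Longrightarrow> \<exists>k. (i, j, k) \<in> C" unfolding c(2)[symmetric] by auto
  show "(i, j, 0) \<in> C \<longleftrightarrow> (i, j) \<in> E" unfolding c(3)[symmetric] by force
qed

definition arc_label :: "nat \<times> nat \<Rightarrow> nat" where
  "arc_label = (\<lambda>(i, j). THE k. (i, j, k) \<in> C)"

lemma arc_label_eq: "(i, j, k) \<in> C \<Longrightarrow> arc_label (i, j) = k"
proof -
  assume ijk: "(i, j, k) \<in> C"
  have "k' = k" if "(i, j, k') \<in> C" for k'
    using labellingD(2)[OF dotted_labelling(1) ijk that] by auto
  then show ?thesis unfolding arc_label_def prod.case using ijk by (rule the_equality[rotated])
qed

lemma arc_label: "(i, j) \<in> P \<Longrightarrow> (i, j, arc_label (i, j)) \<in> C"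
  using dotted_labelling(3) arc_label_eq by metis

lemma arc_label_zero: "(i, j) \<in> P \<Longrightarrow> arc_label (i, j) = 0 \<longleftrightarrow> (i, j) \<in> E"
  using arc_label dotted_labelling(4) arc_label_eq by metis

lemma arc_label_less:
  assumes "(i, j) \<in> P" "(i', j') \<in> P" "i < i'" "i' < j"
  shows "arc_label (i, j) < arc_label (i', j')"
  using labellingD(3)[OF dotted_labelling(1) arc_label[OF assms(1)] arc_label[OF assms(2)] assms(3,4)] by simp

text \<open>The labels of the arcs through a vertical line increase strictly inward, so there are at most
  as many such arcs as available labels.\<close>

lemma card_open_arcs_le:
  assumes M: "M \<subseteq> open_arcs x" and lab: "\<And>a. a \<in> M \<Longrightarrow> arc_label a \<in> {m..<k}"
  shows "card M \<le> k - m"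
proof -
  have "inj_on arc_label M"
  proof (rule inj_onI)
    fix u v assume uv: "u \<in> M" "v \<in> M" and eq: "arc_label u = arc_label v"
    then have "u \<in> open_arcs x" "v \<in> open_arcs x" using M by auto
    obtain a b where u: "u = (a, b)" "(a, b) \<in> P" "a \<le> x" "x < b"
      using \<open>u \<in> open_arcs x\<close> unfolding open_arcs_def by blast
    obtain a' b' where v: "v = (a', b')" "(a', b') \<in> P" "a' \<le> x" "x < b'"
      using \<open>v \<in> open_arcs x\<close> unfolding open_arcs_def by blast
    have "\<not> a < a'" using arc_label_less[OF u(2) v(2)] eq u v by auto
    moreover have "\<not> a' < a" using arc_label_less[OF v(2) u(2)] eq u v by auto
    ultimately show "u = v" using disjoint[OF u(2) v(2)] u(1) v(1) by auto
  qed
  then have "card M = card (arc_label ` M)" by (simp add: card_image)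
  also have "\<dots> \<le> card {m..<k}" using lab by (intro card_mono) auto
  finally show ?thesis by simp
qed

text \<open>Let the arc have depth a and label k. The a arcs around it have distinct labels below k,
  so a \<le> k; the parity condition on labels excludes a = k and makes k - 1 - a even.\<close>

lemma label_dep:
  assumes ij: "(i, j) \<in> P" "(i, j) \<notin> E"
  shows "dep j + 1 \<le> arc_label (i, j)" "even (arc_label (i, j) - 1 - dep j)"
proof -
  note r = range[OF ij(1)]
  note c = labellingD(1)[OF dotted_labelling(1) arc_label[OF ij(1)]]
  have k: "arc_label (i, j) \<noteq> 0" using arc_label_zero[OF ij(1)] ij(2) by simp
  have "card (open_arcs (i - 1)) \<le> arc_label (i, j) - 0"
  proof (rule card_open_arcs_le[OF order_refl])
    fix a assume "a \<in> open_arcs (i - 1)"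
    then obtain b e where a: "a = (b, e)" "(b, e) \<in> P" "b \<le> i - 1" "i - 1 < e" by (auto simp: open_arcs_def)
    then have "e \<noteq> i" using disjoint[OF a(2) ij(1)] r by auto
    then have "arc_label a < arc_label (i, j)" using arc_label_less[OF a(2) ij(1)] a r by auto
    then show "arc_label a \<in> {0..<arc_label (i, j)}" by simp
  qed
  then have le: "dep j \<le> arc_label (i, j)" using dep_arc(1)[OF ij(1)] by (simp add: dep_def)
  have "i - 1 \<le> 2 * n" using r by linarith
  then have "even (dep j + (i - 1))" using even_dep[of "i - 1"] dep_arc(1)[OF ij(1)] by simp
  then have odd: "odd (dep j + arc_label (i, j))" using c k r by (cases i) auto
  then have "dep j \<noteq> arc_label (i, j)" by auto
  then show "dep j + 1 \<le> arc_label (i, j)" using le by simp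
  then show "even (arc_label (i, j) - 1 - dep j)" using odd by (simp add: even_diff_nat)
qed

text \<open>This gives the monotonicity of g under nesting. For depths a, a' and labels k, k' of the
  outer and the inner arc, the a' - a arcs that are open before i' but not before i have distinct
  labels among k, ..., k' - 1.\<close>

lemma label_dep_nested:
  assumes ij: "(i, j) \<in> P" and ij': "(i', j') \<in> P" and lt: "i < i'" "i' < j"
  shows "dep j' + arc_label (i, j) \<le> dep j + arc_label (i', j')"
proof -
  note r' = range[OF ij']
  let ?M = "open_arcs (i' - 1) - open_arcs (i - 1)"
  have sub: "open_arcs (i - 1) \<subseteq> open_arcs (i' - 1)"
  proof
    fix a assume a: "a \<in> open_arcs (i - 1)"
    then have "a \<in> open_arcs j" unfolding open_arcs_ends[OF ij] .
    then show "a \<in> open_arcs (i' - 1)" using a lt by (auto simp: open_arcs_def)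
  qed
  have "card ?M \<le> arc_label (i', j') - arc_label (i, j)"
  proof (rule card_open_arcs_le)
    fix a assume aM: "a \<in> ?M"
    then obtain b e where a: "a = (b, e)" "(b, e) \<in> P" "b \<le> i' - 1" "i' - 1 < e" by (auto simp: open_arcs_def)
    have b: "i \<le> b"
    proof (rule ccontr)
      assume "\<not> i \<le> b"
      then have "a \<in> open_arcs (i - 1)" using a lt by (auto simp: open_arcs_def)
      then show False using aM by simp
    qed
    have "e \<noteq> i'" using disjoint[OF a(2) ij'] a(3) r' lt by auto
    then have "arc_label a < arc_label (i', j')" using arc_label_less[OF a(2) ij'] a lt by auto
    moreover have "arc_label (i, j) \<le> arc_label a"
    proof (cases "b = i")
      case True
      then show ?thesis using disjoint[OF ij a(2)] a(1) by auto
    next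
      case False
      then have "i < b" "b < j" using a(3) b lt by linarith+
      then show ?thesis using arc_label_less[OF ij a(2)] a(1) by simp
    qed
    ultimately show "arc_label a \<in> {arc_label (i, j)..<arc_label (i', j')}" by simp
  qed blast
  moreover have "card ?M = dep (i' - 1) - dep (i - 1)"
    unfolding dep_def by (rule card_Diff_subset[OF finite_open sub])
  moreover have "dep (i - 1) \<le> dep (i' - 1)" unfolding dep_def by (rule card_mono[OF finite_open sub])
  moreover have "arc_label (i, j) < arc_label (i', j')" by (rule arc_label_less[OF ij ij' lt])
  ultimately show ?thesis using dep_arc(1)[OF ij] dep_arc(1)[OF ij'] by linarith
qed

definition arc_of :: "nat \<Rightarrow> nat \<times> nat" where
  "arc_of t = (THE a. a \<in> P \<and> (t = fst a \<or> t = snd a))"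

lemma arc_of_eq:
  assumes "(i, j) \<in> P" "t \<in> {i, j}"
  shows "arc_of t = (i, j)"
  unfolding arc_of_def
proof (rule the_equality)
  show "(i, j) \<in> P \<and> (t = fst (i, j) \<or> t = snd (i, j))" using assms by auto
  fix a assume a: "a \<in> P \<and> (t = fst a \<or> t = snd a)"
  obtain b e where "a = (b, e)" by (cases a)
  then show "a = (i, j)" using disjoint[of b e i j] a assms by auto
qed

text \<open>Solves k = a + 1 + 2g for g. On a dotted arc, k = 0 gives g = 0 through truncated
  subtraction.\<close>

definition gluing_from :: "nat \<Rightarrow> nat" where
  "gluing_from t = (if 1 \<le> t \<and> t \<le> 2 * n then (arc_label (arc_of t) - 1 - dep (snd (arc_of t))) div 2 else 0)"

lemma gluing_from_eq:
  assumes "(i, j) \<in> P" "t \<in> {i, j}"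
  shows "gluing_from t = (arc_label (i, j) - 1 - dep j) div 2"
  using arc_of_eq[OF assms] range[OF assms(1)] assms(2) by (auto simp: gluing_from_def)

lemma gluing_from_label:
  assumes ij: "(i, j) \<in> P" "(i, j) \<notin> E"
  shows "arc_label (i, j) = dep j + 1 + 2 * gluing_from i"
  using label_dep[OF ij] gluing_from_eq[OF ij(1), of i] by auto

lemma gluing_from_gluings: "gluing_from \<in> gluings"
  unfolding gluings_def mem_Collect_eq
proof (intro conjI allI impI)
  fix t assume "t = 0 \<or> 2 * n < t"
  then show "gluing_from t = 0" by (auto simp: gluing_from_def)
next
  fix i j assume ij: "(i, j) \<in> P"
  show "gluing_from j = gluing_from i" using gluing_from_eq[OF ij] by simp
  fix t assume t: "i < t" "t < j"
  then have "1 \<le> t" "t \<le> 2 * n" using range[OF ij] by auto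
  from cover[OF this] obtain i' j' where ij': "(i', j') \<in> P" "t \<in> {i', j'}" by blast
  have lt: "i < i'" "i' < j"
  proof -
    have "(i', j') \<noteq> (i, j)" using ij'(2) t by auto
    then have d: "i' \<noteq> i" "i' \<noteq> j" "j' \<noteq> i" "j' \<noteq> j" using disjoint[OF ij'(1) ij] by auto
    have "\<not> i' < i" using noncrossing[OF ij'(1) ij] ij'(2) t range[OF ij'(1)] by auto
    then show "i < i'" using d by simp
    show "i' < j" using ij'(2) t range[OF ij'(1)] by auto
  qed
  have "arc_label (i, j) - 1 - dep j \<le> arc_label (i', j') - 1 - dep j'"
    using label_dep_nested[OF ij ij'(1) lt] by linarith
  then show "gluing_from i \<le> gluing_from t"
    using gluing_from_eq[OF ij, of i] gluing_from_eq[OF ij'] by (simp add: div_le_mono)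
next
  fix t assume t: "1 \<le> t" "t \<le> 2 * n"
  from cover[OF t] obtain i j where ij: "(i, j) \<in> P" "t \<in> {i, j}" by blast
  note r = range[OF ij(1)]
  have g: "gluing_from t = gluing_from i" using gluing_from_eq[OF ij] gluing_from_eq[OF ij(1), of i] by simp
  have "gluing_from t \<le> layers (t - 1) \<and> gluing_from t \<le> layers t"
  proof (cases "(i, j) \<in> E")
    case True
    then have "arc_label (i, j) = 0" using arc_label_zero[OF ij(1)] by simp
    then show ?thesis using gluing_from_eq[OF ij] by simp
  next
    case False
    note c = labellingD(1)[OF dotted_labelling(1) arc_label[OF ij(1)]]
    have b: "dep j + 1 + 2 * gluing_from i \<le> i" "dep j + 1 + 2 * gluing_from i + j \<le> 2 * n + 1"
      using c unfolding gluing_from_label[OF ij(1) False] by auto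
    have L: "dep x + 2 * layers x = top_height x" if "x \<in> {i - 1, i, j - 1, j}" for x
      using layers[of x] that r by auto
    note L' = L[of "i - 1"] L[of i] L[of "j - 1"] L[of j]
    note d = dep_arc(1-3)[OF ij(1)]
    show ?thesis
    proof (cases "t = i")
      case True
      have "2 * gluing_from i \<le> 2 * layers (i - 1)" "2 * gluing_from i \<le> 2 * layers i"
        using L'(1,2) d b r unfolding top_height_def by auto
      then show ?thesis using True by simp
    next
      case False
      then have "t = j" using ij(2) by simp
      moreover have "2 * gluing_from i \<le> 2 * layers (j - 1)" "2 * gluing_from i \<le> 2 * layers j"
        using L'(3,4) d b r unfolding top_height_def by auto
      ultimately show ?thesis using g by simp
    qed
  qed
  then show "gluing_from t \<le> layers (t - 1)" "gluing_from t \<le> layers t" by auto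
next
  fix i j assume "(i, j) \<in> E"
  then have "(i, j) \<in> P" "arc_label (i, j) = 0" using arc_label_zero dots(1) by auto
  then show "gluing_from i = 0" using gluing_from_eq[of i j i] by simp
qed

lemma labelling_of_gluing_from: "labelling_of gluing_from = C"
proof -
  have eq: "label_of gluing_from (i, j) = arc_label (i, j)" if "(i, j) \<in> P" for i j
    using gluing_from_label[OF that] arc_label_zero[OF that] by (auto simp: label_of_def)
  have "(i, j, k) \<in> labelling_of gluing_from \<longleftrightarrow> (i, j, k) \<in> C" for i j k
    unfolding labelling_of_iff using eq arc_label dotted_labelling(2) arc_label_eq by metis
  then show ?thesis by auto
qed

end

lemma labelling_of_bij: "bij_betw labelling_of gluings dotted_labellings"
  unfolding bij_betw_def
proof (intro conjI labelling_of_inj)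
  show "labelling_of ` gluings = dotted_labellings"
  proof
    show "labelling_of ` gluings \<subseteq> dotted_labellings" using labelling_of_dotted by blast
    show "dotted_labellings \<subseteq> labelling_of ` gluings"
      using labelling_of_gluing_from gluing_from_gluings by blast
  qed
qed

text \<open>A dotted arc has depth 0 and g = 0, so it contributes [1]_s on the right but [0]_s = 1
  to the weight of the labelling; the power of [1]_s makes up for this.\<close>

lemma label_weight_gluing:
  assumes g: "g \<in> gluings"
  shows "qnum_s 1 ^ card E * label_weight (labelling_of g) = (\<Prod>(i, j)\<in>P. qnum_s (dep j + 1 + 2 * g i))"
proof -
  let ?F = "\<lambda>(i, j). qnum_s (dep j + 1 + 2 * g i)"
  have "label_weight (labelling_of g) = (\<Prod>a\<in>P. qnum_s (label_of g a))"
    unfolding label_weight_def labelling_of_def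
    by (subst prod.reindex) (auto simp: inj_on_def split_def)
  also have "\<dots> = (\<Prod>a\<in>P - E. qnum_s (label_of g a)) * (\<Prod>a\<in>E. qnum_s (label_of g a))"
    by (rule prod.subset_diff[OF dots(1) finite_P])
  also have "(\<Prod>a\<in>E. qnum_s (label_of g a)) = 1"
    by (intro prod.neutral) (auto simp: label_of_def qnum_s_def)
  also have "(\<Prod>a\<in>P - E. qnum_s (label_of g a)) = (\<Prod>a\<in>P - E. ?F a)"
    by (intro prod.cong) (auto simp: label_of_def)
  finally have 1: "label_weight (labelling_of g) = (\<Prod>a\<in>P - E. ?F a)" by simp
  have "(\<Prod>a\<in>E. ?F a) = (\<Prod>a\<in>E. qnum_s 1)"
  proof (rule prod.cong[OF refl])
    fix a assume a: "a \<in> E"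
    obtain i j where ij: "a = (i, j)" by (cases a)
    then show "?F a = qnum_s 1" using dotted_dep[of i j] gluingsD(5)[OF g, of i j] a by simp
  qed
  then have "(\<Prod>a\<in>E. ?F a) = qnum_s 1 ^ card E" by simp
  then show ?thesis
    using prod.subset_diff[OF dots(1) finite_P, of ?F] 1 by (simp add: mult.commute)
qed

theorem sum_labellings_eq_sum_tilings:
  "(\<Sum>C\<in>dotted_labellings. label_weight C) =
     (\<Prod>d = 1..n. qnum_s d) * ((1 / qnum_s 1) ^ card E * (\<Sum>T\<in>good_tilings. tiling_weight T))"
proof -
  have q: "qnum_s 1 ^ card E \<noteq> 0" using qnum_s_nonzero by simp
  have w: "label_weight (labelling_of g) = (\<Prod>d = 1..n. qnum_s d) * ((1 / qnum_s 1) ^ card E * tiling_weight (tiling_of g))"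
    if g: "g \<in> gluings" for g
  proof -
    have "qnum_s 1 ^ card E * label_weight (labelling_of g) = tiling_weight (tiling_of g) * (\<Prod>d = 1..n. qnum_s d)"
      using label_weight_gluing[OF g] tiling_weight_gluing[OF g] by simp
    then have "label_weight (labelling_of g) = tiling_weight (tiling_of g) * (\<Prod>d = 1..n. qnum_s d) / qnum_s 1 ^ card E"
      using q by (simp add: field_simps)
    then show ?thesis by (simp add: power_one_over)
  qed
  have "(\<Sum>C\<in>dotted_labellings. label_weight C) = (\<Sum>g\<in>gluings. label_weight (labelling_of g))"
    by (rule sum.reindex_bij_betw[OF labelling_of_bij, symmetric])
  also have "\<dots> = (\<Prod>d = 1..n. qnum_s d) * ((1 / qnum_s 1) ^ card E * (\<Sum>g\<in>gluings. tiling_weight (tiling_of g)))"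
    using w by (simp add: sum_distrib_left)
  also have "(\<Sum>g\<in>gluings. tiling_weight (tiling_of g)) = (\<Sum>T\<in>good_tilings. tiling_weight T)"
    by (rule sum.reindex_bij_betw[OF tiling_of_bij])
  finally show ?thesis .
qed

end

section \<open>From a diagram to the pairs of folded positions\<close>

definition arc_ends :: "nat \<Rightarrow> arc \<Rightarrow> nat \<times> nat" where
  "arc_ends n c = (arc_lo n c, arc_hi n c)"

lemma arc_ends_unfold:
  assumes "1 \<le> i" "i < j" "j \<le> 2 * n"
  shows "arc_ends n {unfold_pos n i, unfold_pos n j} = (i, j)"
  using assms by (simp add: arc_ends_def arc_lo_def arc_hi_def fold_unfold)

lemma TL_arc:
  assumes A: "A \<in> TL_diagrams n" and c: "c \<in> A"
  obtains i j where "arc_ends n c = (i, j)" "1 \<le> i" "i < j" "j \<le> 2 * n" "c = {unfold_pos n i, unfold_pos n j}"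
proof -
  have part: "partition_on (points n) A" and "card c = 2" using A c by (auto simp: TL_diagrams_def)
  then obtain a b where ab: "c = {a, b}" "a \<noteq> b" by (auto simp: card_2_iff)
  have pts: "a \<in> points n" "b \<in> points n" using ab c part by (auto simp: partition_on_def)
  let ?x = "fold_pos n a" and ?y = "fold_pos n b"
  have u: "unfold_pos n ?x = a" "unfold_pos n ?y = b" using unfold_fold pts by auto
  have r: "1 \<le> ?x" "?x \<le> 2 * n" "1 \<le> ?y" "?y \<le> 2 * n" using fold_pos_range pts by auto
  have "?x \<noteq> ?y" using u ab(2) by metis
  then consider "?x < ?y" | "?y < ?x" by linarith
  then show ?thesis
  proof cases
    case 1
    then show ?thesis using that[of ?x ?y] r u ab(1) arc_ends_unfold[of ?x ?y n] by simp
  next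
    case 2
    then show ?thesis using that[of ?y ?x] r u ab(1) arc_ends_unfold[of ?y ?x n] by (simp add: insert_commute)
  qed
qed

lemma noncrossing_arcs_diagram:
  assumes D: "D \<in> B_diagrams n"
  shows "noncrossing_arcs n (arc_ends n ` arcs D) (arc_ends n ` dotted D) (dyck_path_of n (arcs D))"
proof -
  obtain A S where AS: "D = (A, S)" by (cases D)
  have A: "A \<in> TL_diagrams n" and S: "\<And>c. c \<in> S \<Longrightarrow> left_exposed n A c"
    using D AS by (auto simp: B_diagrams_def)
  have part: "partition_on (points n) A" using A by (simp add: TL_diagrams_def)
  have arcE: "\<exists>c\<in>A. arc_ends n c = (i, j) \<and> 1 \<le> i \<and> i < j \<and> j \<le> 2 * n \<and> c = {unfold_pos n i, unfold_pos n j}"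
    if ij: "(i, j) \<in> arc_ends n ` A" for i j
  proof -
    obtain c where c: "c \<in> A" "arc_ends n c = (i, j)" using ij by auto
    obtain i' j' where "arc_ends n c = (i', j')" "1 \<le> i'" "i' < j'" "j' \<le> 2 * n" "c = {unfold_pos n i', unfold_pos n j'}"
      by (rule TL_arc[OF A c(1)])
    then show ?thesis using c by auto
  qed
  show ?thesis
    unfolding AS fst_conv snd_conv
  proof
    fix i j assume ij: "(i, j) \<in> arc_ends n ` A"
    then obtain c where c: "c \<in> A" "arc_ends n c = (i, j)" "1 \<le> i" "i < j" "j \<le> 2 * n" "c = {unfold_pos n i, unfold_pos n j}"
      using arcE by blast
    then show "1 \<le> i \<and> i < j \<and> j \<le> 2 * n" by simp
    fix i' j' assume ij': "(i', j') \<in> arc_ends n ` A"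
    then obtain c' where c': "c' \<in> A" "arc_ends n c' = (i', j')" "1 \<le> i'" "i' < j'" "j' \<le> 2 * n" "c' = {unfold_pos n i', unfold_pos n j'}"
      using arcE by blast
    show "(i, j) = (i', j') \<or> {i, j} \<inter> {i', j'} = {}"
    proof (cases "c = c'")
      case False
      then have "c \<inter> c' = {}" using part c(1) c'(1) by (auto simp: partition_on_def disjoint_def)
      then show ?thesis unfolding c(6) c'(6) by auto
    qed (use c(2) c'(2) in auto)
    assume "i < i'" "i' < j"
    moreover have "\<not> (i < i' \<and> i' < j \<and> j < j')"
      using A c(1,2) c'(1,2) unfolding TL_diagrams_def arc_ends_def by fastforce
    moreover have "j' \<noteq> j"
    proof
      assume "j' = j"
      then have "(i, j) = (i', j')" using \<open>(i, j) = (i', j') \<or> {i, j} \<inter> {i', j'} = {}\<close> by auto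
      then show False using \<open>i < i'\<close> by simp
    qed
    ultimately show "j' < j" by linarith
  next
    fix x assume x: "1 \<le> x" "x \<le> 2 * n"
    then have "unfold_pos n x \<in> \<Union> A" using unfold_pos_points part by (simp add: partition_on_def)
    then obtain c where c: "c \<in> A" "unfold_pos n x \<in> c" by blast
    obtain i j where ij: "arc_ends n c = (i, j)" "1 \<le> i" "i < j" "j \<le> 2 * n" "c = {unfold_pos n i, unfold_pos n j}"
      by (rule TL_arc[OF A c(1)])
    have "x \<in> {i, j}" using c(2) ij x unfold_pos_inj[of x n i] unfold_pos_inj[of x n j] by auto
    then show "\<exists>i j. (i, j) \<in> arc_ends n ` A \<and> x \<in> {i, j}" using c(1) ij(1) by (metis imageI)
  next
    have "fst ` arc_ends n ` A = arc_lo n ` A" by (simp add: image_image arc_ends_def)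
    then show "dyck_path_of n A = map (\<lambda>k. if k \<in> fst ` arc_ends n ` A then Up else Down) [1..<2 * n + 1]"
      unfolding dyck_path_of_def by simp
  next
    show "arc_ends n ` S \<subseteq> arc_ends n ` A" using S by (auto simp: left_exposed_def)
  next
    fix i j i' j' assume "(i, j) \<in> arc_ends n ` S" "(i', j') \<in> arc_ends n ` A"
    then show "\<not> (i' < i \<and> j < j')" using S by (auto simp: left_exposed_def arc_ends_def)
  qed
qed

theorem theorem5p3:
  fixes n :: nat and D :: diagram and mu :: "step list"
  assumes "n \<ge> 1"
    and "D \<in> B_diagrams n"
    and "mu = dyck_path_of n (arcs D)"
  shows "Coeff_B n D =
    (1 / qnum_s 1) ^ card (dotted D) *
    (\<Sum>T \<in> admissible_tilings n D mu. \<Prod>d\<in>T. qnum_s (tile_height d) / qnum_s (tile_height d + 1))"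
proof -
  let ?P = "arc_ends n ` arcs D" and ?E = "arc_ends n ` dotted D"
  interpret noncrossing_arcs n ?P ?E mu
    unfolding assms(3) by (rule noncrossing_arcs_diagram[OF assms(2)])
  have A: "arcs D \<in> TL_diagrams n" and S: "dotted D \<subseteq> arcs D"
    using assms(2) by (auto simp: B_diagrams_def left_exposed_def)
  let ?u = "\<lambda>(i, j). {unfold_pos n i, unfold_pos n j}"
  have u: "?u (arc_ends n c) = c" if "c \<in> arcs D" for c
    by (rule TL_arc[OF A that]) simp
  have "?u ` arc_ends n ` B = B" if "B \<subseteq> arcs D" for B
  proof -
    have "?u ` arc_ends n ` B = (\<lambda>c. c) ` B"
      unfolding image_image
    proof (rule image_cong[OF refl])
      fix c assume "c \<in> B"
      then have "c \<in> arcs D" using that by blast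
      then show "?u (arc_ends n c) = c" by (rule u)
    qed
    then show ?thesis by simp
  qed
  note uB = this[OF order_refl] this[OF S]
  have card: "card ?E = card (dotted D)"
  proof (intro card_image inj_onI)
    fix c d assume "c \<in> dotted D" "d \<in> dotted D" and eq: "arc_ends n c = arc_ends n d"
    then have "c \<in> arcs D" "d \<in> arcs D" using S by auto
    have "c = ?u (arc_ends n c)" using u[OF \<open>c \<in> arcs D\<close>] by (rule sym)
    also have "\<dots> = d" unfolding eq by (rule u[OF \<open>d \<in> arcs D\<close>])
    finally show "c = d" .
  qed
  have "admissible_tilings n D mu = good_tilings"
  proof -
    have ball: "(\<forall>i j. (i, j) \<in> ?E \<longrightarrow> Q i j) \<longleftrightarrow> (\<forall>c\<in>dotted D. Q (fst (arc_ends n c)) (snd (arc_ends n c)))"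
      for Q :: "nat \<Rightarrow> nat \<Rightarrow> bool"
    proof (intro iffI ballI allI impI)
      fix c assume *: "\<forall>i j. (i, j) \<in> ?E \<longrightarrow> Q i j" and c: "c \<in> dotted D"
      have "(fst (arc_ends n c), snd (arc_ends n c)) \<in> ?E" using c by simp
      then show "Q (fst (arc_ends n c)) (snd (arc_ends n c))" using * by blast
    next
      fix i j assume *: "\<forall>c\<in>dotted D. Q (fst (arc_ends n c)) (snd (arc_ends n c))" and "(i, j) \<in> ?E"
      then obtain c where "c \<in> dotted D" "(i, j) = arc_ends n c" by blast
      with * show "Q i j" by (metis fst_conv snd_conv)
    qed
    have eqs: "lies_above n c d \<longleftrightarrow> Min (fst ` d) = int (fst (arc_ends n c)) - 1 \<and> Max (fst ` d) = int (snd (arc_ends n c))"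
      "arc_size n c = (snd (arc_ends n c) - fst (arc_ends n c) + 1) div 2" for c d
      by (simp_all add: lies_above_def arc_ends_def arc_size_def)
    show ?thesis unfolding admissible_tilings_def good_tilings_def by (simp only: ball eqs conj_assoc)
  qed
  \<comment> \<open>Arcs and their pairs of folded ends determine each other, so equality with D can
    be tested on the pairs.\<close>
  have labs: "labelling_diagram n C = D \<longleftrightarrow>
      (\<lambda>(i, j, k). (i, j)) ` C = ?P \<and> (\<lambda>(i, j, k). (i, j)) ` {(i, j, k) \<in> C. k = 0} = ?E"
    if C: "labelling n C" for C
  proof -
    let ?p = "\<lambda>(i, j, k). (i, j)"
    let ?Z = "{(i, j, k) \<in> C. k = 0}"
    have d: "labelling_diagram n C = (?u ` ?p ` C, ?u ` ?p ` ?Z)"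
      unfolding labelling_diagram_def image_image by (simp add: split_def)
    have e: "arc_ends n ` ?u ` ?p ` B = ?p ` B" if "B \<subseteq> C" for B
    proof -
      have "arc_ends n (?u (?p b)) = ?p b" if "b \<in> B" for b
      proof -
        obtain i j k where b: "b = (i, j, k)" by (cases b)
        then have "1 \<le> i" "i < j" "j \<le> 2 * n"
          using labellingD(1)[OF C, of i j k] \<open>b \<in> B\<close> \<open>B \<subseteq> C\<close> by auto
        then show ?thesis unfolding b by (simp add: arc_ends_unfold)
      qed
      then show ?thesis unfolding image_image by (rule image_cong[OF refl])
    qed
    have Z: "?Z \<subseteq> C" by auto
    show ?thesis
    proof
      assume eq: "labelling_diagram n C = D"
      have "arcs D = ?u ` ?p ` C" "dotted D = ?u ` ?p ` ?Z"
        unfolding eq[symmetric] d by (rule fst_conv, rule snd_conv)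
      then show "?p ` C = ?P \<and> ?p ` ?Z = ?E" using e[OF order_refl] e[OF Z] by simp
    next
      assume "?p ` C = ?P \<and> ?p ` ?Z = ?E"
      then have "labelling_diagram n C = (?u ` ?P, ?u ` ?E)" unfolding d by simp
      then show "labelling_diagram n C = D" unfolding uB by simp
    qed
  qed
  let ?q = "\<Prod>d = 1..n. qnum_s d"
  \<comment> \<open>The test function is the indicator of D, so only the labellings with the arcs
    and dots of D survive.\<close>
  have "?q * Coeff_B n D = (\<Sum>C | labelling n C. label_weight C * (if labelling_diagram n C = D then 1 else 0))"
    unfolding Coeff_B_eq by (rule diag_sum_Q_labellings)
  also have "\<dots> = (\<Sum>C\<in>dotted_labellings. label_weight C)"
    unfolding dotted_labellings_def using labs
    by (intro sum.mono_neutral_cong_right finite_labellings) auto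
  also have "\<dots> = ?q * ((1 / qnum_s 1) ^ card ?E * (\<Sum>T\<in>good_tilings. tiling_weight T))"
    by (rule sum_labellings_eq_sum_tilings)
  finally have "Coeff_B n D = (1 / qnum_s 1) ^ card ?E * (\<Sum>T\<in>good_tilings. tiling_weight T)"
    using qnum_s_nonzero by simp
  then show ?thesis
    unfolding card \<open>admissible_tilings n D mu = good_tilings\<close> tiling_weight_def .
qed

end
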